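(* Let $M$ be a simple polytope of dimension $n\geq 1$. Let $\ell\in\{1,\ldots,n-1\}$ and let $\mathcal F$ be the set of all faces of $M$ of dimension $\ell$. Let $Y$ be a locally convex topological vector space and $m\in\mathbb N_0\cup\{\infty\}$. Let $\mathcal E$ be the closed vector subspace of $\prod_{F\in\mathcal F}C^m(F,Y)$ consisting of all $(f_F)_{F\in\mathcal F}$ such that \[ f_F|_{F\cap G}=f_G|_{F\cap G}\quad\text{for all }F,G\in\mathcal F. \] Then the mapping \[ r\colon C^m(M,Y)\to\mathcal E,\qquad f\mapsto(f|_F)_{F\in\mathcal F} \] is surjective, continuous, linear, and admits a continuous linear right inverse $\sigma\colon\mathcal E\to C^m(M,Y)$.
   Context: All vector spaces are real; locally convex spaces are assumed Hausdorff. $\mathbb N_0=\{0,1,2,\dots\}$. A polytope $M$ in a finite-dimensional vector space $E$ is the convex hull of a non-empty finite subset; $\operatorname{aff}(M)$ is its affine hull, and $\dim M:=\dim\operatorname{aff}(M)$. A face of $M$ is a convex subset $F\subseteq M$ such that $x,y\in M$, $t\in\,]0,1[$ and $tx+(1-t)y\in F$ imply $x,y\in F$. Non-empty faces are polytopes; faces of dimension $0$, $1$ are called vertices, edges. An $n$-dimensional polytope is simple if each vertex is contained in exactly $n$ edges (equivalently, in exactly $n$ faces of dimension $n-1$). For a convex subset $U\subseteq\mathbb R^n$ with non-empty (hence, in $U$, dense) interior $\mathring U$, a map $f\colon U\to Y$ is $C^m$ if it is continuous, $f|_{\mathring U}$ is $C^m$ (i.e. the iterated directional derivatives $d^kf(x,y_1,\dots,y_k)=(D_{y_k}\cdots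 D_{y_1}f)(x)$, $k\le m$, exist and are continuous on $\mathring U\times(\mathbb R^n)^k$), and each $d^k(f|_{\mathring U})$, $k\le m$, extends to a continuous map $d^kf\colon U\times(\mathbb R^n)^k\to Y$. $C^m(U,Y)$ carries the compact-open $C^m$-topology, i.e. the initial topology with respect to the maps $f\mapsto d^kf\in C(U\times(\mathbb R^n)^k,Y)$ for $k\in\mathbb N_0$, $k\le m$, with compact-open topologies on the ranges. For a $d$-dimensional polytope $P$ in a finite-dimensional vector space, $C^m$-maps $P\to Y$ and the topology on $C^m(P,Y)$ are defined by transport via an affine bijection $\mathbb R^d\to\operatorname{aff}(P)$ (independent of the choice). In particular this applies to faces $F$ of $M$, viewed as polytopes in $\operatorname{aff}(F)$. *)

theory Defs
  imports "HOL-Analysis.Analysis"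
begin

section \<open>Locally convex spaces\<close>

text \<open>Hausdorff is part of the notion. Continuity of negation, required by
  \<^class>\<open>topological_group_add\<close>, is implied by continuity of scalar multiplication.\<close>

class locally_convex_space = real_vector + topological_group_add + t2_space +
  assumes tendsto_scaleR_Pair_nhds:
    "LIM p (nhds c \<times>\<^sub>F nhds a). scaleR (fst p) (snd p) :> nhds (scaleR c a)"
  and convex_nhds_0:
    "open U \<Longrightarrow> 0 \<in> U \<Longrightarrow> \<exists>V. open V \<and> 0 \<in> V \<and> V \<subseteq> U \<and>
       (\<forall>x\<in>V. \<forall>y\<in>V. \<forall>u\<ge>0. \<forall>v\<ge>0. u + v = 1 \<longrightarrow> scaleR u x + scaleR v y \<in> V)"

lemma locally_convex_convex_nhds_0:
  fixes U :: "'y::locally_convex_space set"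
  assumes "open U" "0 \<in> U"
  shows "\<exists>V. open V \<and> 0 \<in> V \<and> V \<subseteq> U \<and> convex V"
  using convex_nhds_0[OF assms] unfolding convex_def .

section \<open>Simple polytopes\<close>

definition simple_polytope :: "'e::euclidean_space set \<Rightarrow> bool" where
  "simple_polytope M \<longleftrightarrow> polytope M \<and> M \<noteq> {} \<and>
     (\<forall>V. V face_of M \<and> aff_dim V = 0 \<longrightarrow> int (card {e. e edge_of M \<and> V \<subseteq> e}) = aff_dim M)"

definition faces_of_dim :: "'e::euclidean_space set \<Rightarrow> nat \<Rightarrow> 'e set set" where
  "faces_of_dim M l = {F. F face_of M \<and> aff_dim F = int l}"

section \<open>The compact-open topology\<close>

text \<open>A function on a subset \<open>S\<close> of a type is represented by a total function in
  \<^term>\<open>extensional S\<close>, so that equality is equality on \<open>S\<close>.\<close>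

definition continuous_maps :: "'a topology \<Rightarrow> ('a \<Rightarrow> 'y::topological_space) set" where
  "continuous_maps X = {h \<in> extensional (topspace X). continuous_map X euclidean h}"

definition compact_open_topology :: "'a topology \<Rightarrow> ('a \<Rightarrow> 'y::topological_space) topology" where
  "compact_open_topology X = topology_generated_by
     {{h \<in> continuous_maps X. h ` K \<subseteq> V} | K V. compactin X K \<and> open V}"

section \<open>\<open>C\<^sup>m\<close>-maps on subsets of \<open>\<real>\<^sup>d\<close>\<close>

text \<open>\<open>\<real>\<^sup>d\<close> is \<^term>\<open>Euclidean_space d\<close>, whose points are the sequences vanishing from index
  \<open>d\<close> on. The following notions are intended for a convex \<open>U\<close> in \<open>\<real>\<^sup>d\<close> with non-empty interior.\<close>

abbreviation interior_in :: "nat \<Rightarrow> (nat \<Rightarrow> real) set \<Rightarrow> (nat \<Rightarrow> real) set" where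
  "interior_in d U \<equiv> Euclidean_space d interior_of U"

definition has_dir_deriv ::
  "((nat \<Rightarrow> real) \<Rightarrow> 'y::locally_convex_space) \<Rightarrow> (nat \<Rightarrow> real) \<Rightarrow> (nat \<Rightarrow> real) \<Rightarrow> 'y \<Rightarrow> bool" where
  "has_dir_deriv g x y v \<longleftrightarrow>
     ((\<lambda>t. (1 / t) *\<^sub>R (g (\<lambda>i. x i + t * y i) - g x)) \<longlongrightarrow> v) (at (0::real))"

definition dir_deriv ::
  "((nat \<Rightarrow> real) \<Rightarrow> 'y::locally_convex_space) \<Rightarrow> (nat \<Rightarrow> real) \<Rightarrow> (nat \<Rightarrow> real) \<Rightarrow> 'y" where
  "dir_deriv g x y = (THE v. has_dir_deriv g x y v)"

text \<open>\<open>iter_deriv k g ys x\<close> is \<open>(D\<^bsub>y\<^sub>k\<^esub> \<dots> D\<^bsub>y\<^sub>1\<^esub> g)(x)\<close>, where \<open>ys j\<close> is the direction \<open>y\<^bsub>j+1\<^esub>\<close>.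
  At an interior point of \<open>U\<close> it depends only on \<open>g\<close> near that point, hence not on the values
  of \<open>g\<close> outside \<open>U\<close>.\<close>

primrec iter_deriv ::
  "nat \<Rightarrow> ((nat \<Rightarrow> real) \<Rightarrow> 'y::locally_convex_space) \<Rightarrow> (nat \<Rightarrow> nat \<Rightarrow> real) \<Rightarrow> (nat \<Rightarrow> real) \<Rightarrow> 'y" where
  "iter_deriv 0 g ys = g"
| "iter_deriv (Suc k) g ys = (\<lambda>x. dir_deriv (iter_deriv k g ys) x (ys k))"

definition directions :: "nat \<Rightarrow> nat \<Rightarrow> (nat \<Rightarrow> nat \<Rightarrow> real) topology" where
  "directions d k = product_topology (\<lambda>_. Euclidean_space d) {..<k}"

definition deriv_domain ::
  "nat \<Rightarrow> (nat \<Rightarrow> real) set \<Rightarrow> nat \<Rightarrow> ((nat \<Rightarrow> real) \<times> (nat \<Rightarrow> nat \<Rightarrow> real)) topology" where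
  "deriv_domain d U k = prod_topology (subtopology (Euclidean_space d) U) (directions d k)"

definition Cm_open ::
  "nat \<Rightarrow> enat \<Rightarrow> (nat \<Rightarrow> real) set \<Rightarrow> ((nat \<Rightarrow> real) \<Rightarrow> 'y::locally_convex_space) \<Rightarrow> bool" where
  "Cm_open d m W g \<longleftrightarrow>
     (\<forall>k. enat (Suc k) \<le> m \<longrightarrow> (\<forall>x\<in>W. \<forall>ys\<in>topspace (directions d (Suc k)).
        \<exists>v. has_dir_deriv (iter_deriv k g ys) x (ys k) v)) \<and>
     (\<forall>k. enat k \<le> m \<longrightarrow>
        continuous_map (deriv_domain d W k) euclidean (\<lambda>(x, ys). iter_deriv k g ys x))"

definition extends_deriv ::
  "nat \<Rightarrow> (nat \<Rightarrow> real) set \<Rightarrow> nat \<Rightarrow> ((nat \<Rightarrow> real) \<Rightarrow> 'y::locally_convex_space) \<Rightarrow>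
     ((nat \<Rightarrow> real) \<times> (nat \<Rightarrow> nat \<Rightarrow> real) \<Rightarrow> 'y) \<Rightarrow> bool" where
  "extends_deriv d U k g h \<longleftrightarrow> h \<in> continuous_maps (deriv_domain d U k) \<and>
     (\<forall>x\<in>interior_in d U. \<forall>ys\<in>topspace (directions d k). h (x, ys) = iter_deriv k g ys x)"

definition Cm_on ::
  "nat \<Rightarrow> enat \<Rightarrow> (nat \<Rightarrow> real) set \<Rightarrow> ((nat \<Rightarrow> real) \<Rightarrow> 'y::locally_convex_space) set" where
  "Cm_on d m U = {g \<in> continuous_maps (subtopology (Euclidean_space d) U).
     Cm_open d m (interior_in d U) g \<and> (\<forall>k. enat k \<le> m \<longrightarrow> (\<exists>h. extends_deriv d U k g h))}"

text \<open>The extension is unique because the interior is dense in \<open>U\<close> and \<open>'y\<close> is Hausdorff.\<close>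

definition deriv_ext ::
  "nat \<Rightarrow> (nat \<Rightarrow> real) set \<Rightarrow> nat \<Rightarrow> ((nat \<Rightarrow> real) \<Rightarrow> 'y::locally_convex_space) \<Rightarrow>
     (nat \<Rightarrow> real) \<times> (nat \<Rightarrow> nat \<Rightarrow> real) \<Rightarrow> 'y" where
  "deriv_ext d U k g = (THE h. extends_deriv d U k g h)"

definition Cm_on_topology ::
  "nat \<Rightarrow> enat \<Rightarrow> (nat \<Rightarrow> real) set \<Rightarrow> ((nat \<Rightarrow> real) \<Rightarrow> 'y::locally_convex_space) topology" where
  "Cm_on_topology d m U = topology_generated_by
     {{g \<in> Cm_on d m U. deriv_ext d U k g \<in> W} | k W.
        enat k \<le> m \<and> openin (compact_open_topology (deriv_domain d U k)) W}"

section \<open>\<open>C\<^sup>m\<close>-maps on polytopes\<close>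

definition affine_chart :: "nat \<Rightarrow> 'e::euclidean_space set \<Rightarrow> ((nat \<Rightarrow> real) \<Rightarrow> 'e) \<Rightarrow> bool" where
  "affine_chart d A \<phi> \<longleftrightarrow> bij_betw \<phi> (topspace (Euclidean_space d)) A \<and>
     (\<forall>x\<in>topspace (Euclidean_space d). \<forall>y\<in>topspace (Euclidean_space d). \<forall>t::real.
        \<phi> (\<lambda>i. (1 - t) * x i + t * y i) = (1 - t) *\<^sub>R \<phi> x + t *\<^sub>R \<phi> y)"

definition pdim :: "'e::euclidean_space set \<Rightarrow> nat" where
  "pdim P = nat (aff_dim P)"

text \<open>The choice of the chart does not affect the \<open>C\<^sup>m\<close>-maps or their topology.\<close>

definition chart :: "'e::euclidean_space set \<Rightarrow> (nat \<Rightarrow> real) \<Rightarrow> 'e" where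
  "chart P = (SOME \<phi>. affine_chart (pdim P) (affine hull P) \<phi>)"

definition chart_domain :: "'e::euclidean_space set \<Rightarrow> (nat \<Rightarrow> real) set" where
  "chart_domain P = {x \<in> topspace (Euclidean_space (pdim P)). chart P x \<in> P}"

definition transport ::
  "'e::euclidean_space set \<Rightarrow> ('e \<Rightarrow> 'y) \<Rightarrow> (nat \<Rightarrow> real) \<Rightarrow> 'y" where
  "transport P f = restrict (f \<circ> chart P) (chart_domain P)"

definition Cm :: "enat \<Rightarrow> 'e::euclidean_space set \<Rightarrow> ('e \<Rightarrow> 'y::locally_convex_space) set" where
  "Cm m P = {f \<in> extensional P. transport P f \<in> Cm_on (pdim P) m (chart_domain P)}"

definition Cm_topology ::
  "enat \<Rightarrow> 'e::euclidean_space set \<Rightarrow> ('e \<Rightarrow> 'y::locally_convex_space) topology" where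
  "Cm_topology m P =
     pullback_topology (Cm m P) (transport P) (Cm_on_topology (pdim P) m (chart_domain P))"

section \<open>Linear structure and compatible families\<close>

text \<open>Vector spaces of functions on proper subsets have carriers that are not whole types; their
  pointwise linear structure is given by the operation \<open>(a, u, b, v) \<mapsto> a u + b v\<close>.\<close>

definition fun_lincomb ::
  "'e set \<Rightarrow> real \<Rightarrow> ('e \<Rightarrow> 'y::real_vector) \<Rightarrow> real \<Rightarrow> ('e \<Rightarrow> 'y) \<Rightarrow> 'e \<Rightarrow> 'y" where
  "fun_lincomb P a f b g = (\<lambda>x\<in>P. a *\<^sub>R f x + b *\<^sub>R g x)"

definition family_lincomb ::
  "'e set set \<Rightarrow> real \<Rightarrow> ('e set \<Rightarrow> 'e \<Rightarrow> 'y::real_vector) \<Rightarrow> real \<Rightarrow> ('e set \<Rightarrow> 'e \<Rightarrow> 'y) \<Rightarrow>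
     'e set \<Rightarrow> 'e \<Rightarrow> 'y" where
  "family_lincomb \<F> a u b v = (\<lambda>F\<in>\<F>. fun_lincomb F a (u F) b (v F))"

definition lincomb_closed :: "(real \<Rightarrow> 'v \<Rightarrow> real \<Rightarrow> 'v \<Rightarrow> 'v) \<Rightarrow> 'v set \<Rightarrow> bool" where
  "lincomb_closed lc V \<longleftrightarrow> V \<noteq> {} \<and> (\<forall>a b. \<forall>u\<in>V. \<forall>v\<in>V. lc a u b v \<in> V)"

definition linear_between ::
  "(real \<Rightarrow> 'v \<Rightarrow> real \<Rightarrow> 'v \<Rightarrow> 'v) \<Rightarrow> 'v set \<Rightarrow> (real \<Rightarrow> 'w \<Rightarrow> real \<Rightarrow> 'w \<Rightarrow> 'w) \<Rightarrow> 'w set \<Rightarrow>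
     ('v \<Rightarrow> 'w) \<Rightarrow> bool" where
  "linear_between lcV V lcW W T \<longleftrightarrow> T ` V \<subseteq> W \<and>
     (\<forall>a b. \<forall>u\<in>V. \<forall>v\<in>V. T (lcV a u b v) = lcW a (T u) b (T v))"

definition Cm_product_topology ::
  "enat \<Rightarrow> 'e::euclidean_space set set \<Rightarrow> ('e set \<Rightarrow> 'e \<Rightarrow> 'y::locally_convex_space) topology" where
  "Cm_product_topology m \<F> = product_topology (Cm_topology m) \<F>"

definition compatible_families ::
  "enat \<Rightarrow> 'e::euclidean_space set set \<Rightarrow> ('e set \<Rightarrow> 'e \<Rightarrow> 'y::locally_convex_space) set" where
  "compatible_families m \<F> = {u \<in> Pi\<^sub>E \<F> (Cm m).
     \<forall>F\<in>\<F>. \<forall>G\<in>\<F>. restrict (u F) (F \<inter> G) = restrict (u G) (F \<inter> G)}"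

definition restrict_to_faces :: "'e set set \<Rightarrow> ('e \<Rightarrow> 'y) \<Rightarrow> 'e set \<Rightarrow> 'e \<Rightarrow> 'y" where
  "restrict_to_faces \<F> f = (\<lambda>F\<in>\<F>. restrict f F)"

end

theory Submission
  imports Defs "HOL-Computational_Algebra.Polynomial"
begin

text \<open>Near a point \<open>p\<close> of a simple polytope \<open>M\<close> the normals of the facets through \<open>p\<close> are linearly
  independent. Hence for every proper face \<open>F\<close> through \<open>p\<close> there is an affine map \<open>\<pi>\<close> which near \<open>p\<close>
  sends \<open>M\<close> to \<open>F\<close>, fixes \<open>F\<close> and preserves every face through \<open>p\<close>. If \<open>A u\<close> extends the data
  from some faces through \<open>p\<close>, then \<open>A u + (u\<^sub>F - A u) \<circ> \<pi>\<close> extends them from these faces and \<open>F\<close>;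
  the resulting local extension operators are glued by a smooth partition of unity.

  On the analytic side, \<open>C\<^sup>k\<close>-maps on a convex set \<open>P\<close> are described by iterated one-sided derivatives
  along segments in \<open>P\<close>, which exist up to the boundary by a mean value argument. This description
  involves no charts and is stable under affine maps between convex sets of different dimension.
  For compact \<open>P\<close>, convergence in \<open>C\<^sup>m(P, Y)\<close> is uniform convergence of these derivatives, since they
  are multilinear in the directions.\<close>

text \<open>The correction \<open>(u F - A u)\<close> composed with \<pi> does not spoil the faces
  treated before: \<pi> maps such a face \<open>G\<close> into \<open>G \<inter> F\<close>, where
  \<open>A u\<close>, \<open>u G\<close> and \<open>u F\<close> agree, so it vanishes on
  \<open>G\<close>. For this, \<pi> has to respect all facets through \<open>p\<close> at once. It
  moves a point along vectors dual to the facet normals, and such vectors exist precisely when the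
  normals, as functionals on \<open>dirs M\<close>, are linearly independent; this is where
  simplicity enters. Simplicity speaks of vertices only, so a general \<open>p\<close> is first
  replaced by a vertex lying on all facets through \<open>p\<close>.

  The space \<open>'y\<close> has neither a norm nor completeness. Estimates are therefore made with
  convex neighbourhoods of zero, and continuity of an operator is expressed by convergence along an
  arbitrary filter, for which testing subbasic open sets is enough. Regularity of a single map is
  the case of the trivial filter, so each closure property is proved once, for convergence, and then
  read off for maps.\<close>

instance locally_convex_space < topological_ab_group_add ..

text \<open>Lets the notions for maps into \<open>'y\<close> apply verbatim to real-valued cut-off
  functions.\<close>

instance real_normed_vector < locally_convex_space
proof
  fix c :: real and a :: 'a
  show "LIM p (nhds c \<times>\<^sub>F nhds a). fst p *\<^sub>R snd p :> nhds (c *\<^sub>R a)"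
    by (intro tendsto_scaleR filterlim_fst filterlim_snd)
next
  fix U :: "'a set" assume "open U" "0 \<in> U"
  then obtain e where e: "e > 0" "ball 0 e \<subseteq> U"
    using open_contains_ball by blast
  have "convex (ball (0::'a) e)" by simp
  then show "\<exists>V. open V \<and> 0 \<in> V \<and> V \<subseteq> U \<and>
       (\<forall>x\<in>V. \<forall>y\<in>V. \<forall>u\<ge>0. \<forall>v\<ge>0. u + v = 1 \<longrightarrow> u *\<^sub>R x + v *\<^sub>R y \<in> V)"
    using e unfolding convex_def by (intro exI[of _ "ball 0 e"]) auto
qed

section \<open>Scalar multiplication and neighbourhoods of zero\<close>

lemma tendsto_scaleR_lcs:
  fixes g :: "'a \<Rightarrow> 'y::locally_convex_space"
  assumes "(f \<longlongrightarrow> a) F" "(g \<longlongrightarrow> b) F"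
  shows "((\<lambda>x. f x *\<^sub>R g x) \<longlongrightarrow> a *\<^sub>R b) F"
  using filterlim_compose[OF tendsto_scaleR_Pair_nhds filterlim_Pair[OF assms]] by simp

lemma continuous_on_scaleR_lcs:
  fixes g :: "'a::topological_space \<Rightarrow> 'y::locally_convex_space"
  assumes "continuous_on S f" "continuous_on S g"
  shows "continuous_on S (\<lambda>x. f x *\<^sub>R g x)"
  using assms unfolding continuous_on_def by (auto intro: tendsto_scaleR_lcs)

lemma open_translation_lcs:
  fixes U :: "'y::locally_convex_space set"
  assumes "open U"
  shows "open {x. x + b \<in> U}" "open {x. x - b \<in> U}"
proof -
  have "continuous_on UNIV (\<lambda>x::'y. x + b)" "continuous_on UNIV (\<lambda>x::'y. x - b)"
    by (intro continuous_intros)+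
  then show "open {x. x + b \<in> U}" "open {x. x - b \<in> U}"
    using open_vimage[OF assms] unfolding vimage_def by blast+
qed

text \<open>If \<open>C\<close> exceeds \<open>\<bar>c\<bar>\<close>, then
  \<open>c *\<^sub>R x\<close> is a convex combination of \<open>C *\<^sub>R x\<close> and its
  negative. So a single neighbourhood serves all bounded scalars: it is enough that both these
  points lie in a convex \<open>V0\<close>.\<close>

lemma nhd_0_scale:
  fixes U :: "'y::locally_convex_space set"
  assumes "open U" "0 \<in> U"
  obtains V where "open V" "0 \<in> V" "\<And>c x. \<bar>c\<bar> \<le> B \<Longrightarrow> x \<in> V \<Longrightarrow> c *\<^sub>R x \<in> U"
proof -
  obtain V0 where V0: "open V0" "0 \<in> V0" "V0 \<subseteq> U" "convex V0"
    using locally_convex_convex_nhds_0[OF assms] by blast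
  define C where "C = \<bar>B\<bar> + 1"
  have C: "C > 0" "B < C" by (auto simp: C_def)
  define V where "V = {x. C *\<^sub>R x \<in> V0} \<inter> {x. (-C) *\<^sub>R x \<in> V0}"
  have cont: "continuous_on UNIV (\<lambda>x::'y. c *\<^sub>R x)" for c :: real
    by (intro continuous_on_scaleR_lcs continuous_intros)
  have "open V"
    unfolding V_def using open_vimage[OF V0(1) cont] unfolding vimage_def by (intro open_Int) blast+
  moreover have "0 \<in> V" using V0 by (simp add: V_def)
  moreover have "c *\<^sub>R x \<in> U" if c: "\<bar>c\<bar> \<le> B" and x: "x \<in> V" for c x
  proof -
    have 1: "C *\<^sub>R x \<in> V0" "(-C) *\<^sub>R x \<in> V0" using x by (auto simp: V_def)
    \<comment> \<open>The weight that solves \<open>s * C - (1 - s) * C = c\<close>.\<close>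
    define s where "s = (1 + c / C) / 2"
    have cC: "-1 \<le> c / C" "c / C \<le> 1" using c C by (simp_all add: pos_le_divide_eq)
    then have s: "0 \<le> s" "s \<le> 1" by (auto simp: s_def)
    have "s *\<^sub>R (C *\<^sub>R x) + (1 - s) *\<^sub>R ((-C) *\<^sub>R x) \<in> V0"
      by (rule convexD[OF V0(4)]) (use 1 s in auto)
    moreover have "s *\<^sub>R (C *\<^sub>R x) + (1 - s) *\<^sub>R ((-C) *\<^sub>R x) = (s * C - (1 - s) * C) *\<^sub>R x"
      by (simp add: scaleR_diff_left)
    moreover have "s * C - (1 - s) * C = c"
      using C by (simp add: s_def field_simps)
    ultimately show ?thesis using V0(3) by auto
  qed
  ultimately show ?thesis using that by blast
qed

text \<open>Halving comes from convexity: \<open>x + y\<close> is twice the midpoint of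
  \<open>x\<close> and \<open>y\<close>, and the factor 2 is absorbed by \<open>W\<close>.
  Intersecting with the reflected set makes \<open>V\<close> symmetric, so that it also controls
  differences.\<close>

lemma nhd_0_add:
  fixes U :: "'y::locally_convex_space set"
  assumes "open U" "0 \<in> U"
  obtains V where "open V" "0 \<in> V" "\<And>x y. x \<in> V \<Longrightarrow> y \<in> V \<Longrightarrow> x + y \<in> U"
    "\<And>x. x \<in> V \<Longrightarrow> - x \<in> V" "convex V"
proof -
  obtain W where W: "open W" "0 \<in> W" "\<And>c x. \<bar>c\<bar> \<le> 2 \<Longrightarrow> x \<in> W \<Longrightarrow> c *\<^sub>R x \<in> U"
    using nhd_0_scale[OF assms] by blast
  obtain V0 where V0: "open V0" "0 \<in> V0" "V0 \<subseteq> W" "convex V0"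
    using locally_convex_convex_nhds_0[OF W(1,2)] by blast
  have "continuous_on UNIV (\<lambda>x::'y. - x)" by (intro continuous_intros)
  then have o: "open {x. - x \<in> V0}"
    using open_vimage[OF V0(1)] unfolding vimage_def by blast
  define V where "V = V0 \<inter> {x. - x \<in> V0}"
  have "x + y \<in> U" if "x \<in> V" "y \<in> V" for x y
  proof -
    have "(1/2) *\<^sub>R x + (1/2) *\<^sub>R y \<in> V0"
      using that V0(4) unfolding V_def convex_def by auto
    then have "2 *\<^sub>R ((1/2) *\<^sub>R x + (1/2) *\<^sub>R y) \<in> U"
      using W(3) V0(3) by auto
    then show ?thesis by (simp add: scaleR_add_right)
  qed
  moreover have "convex V"
  proof -
    have "{x. - x \<in> V0} = (\<lambda>x. - x) ` V0" by (auto simp: image_iff) (metis minus_minus)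
    then show ?thesis unfolding V_def using V0(4) by (simp add: convex_Int convex_negations)
  qed
  ultimately show ?thesis using that[of V] V0 o unfolding V_def by auto
qed

section \<open>The mean value theorem\<close>

text \<open>If the quotients over \<open>[a, b]\<close> and \<open>[b, c]\<close> lie in the convex set \<open>W\<close>, so does the one over
  \<open>[a, c]\<close>; hence bisection localises the claim.\<close>

lemma mean_value_convex:
  fixes f f' :: "real \<Rightarrow> 'y::locally_convex_space"
  assumes "a < b" and W: "open W" "convex W"
    and der: "\<And>t. a \<le> t \<Longrightarrow> t \<le> b \<Longrightarrow>
      ((\<lambda>s. (1 / (s - t)) *\<^sub>R (f s - f t)) \<longlongrightarrow> f' t) (at t within {a..b})"
    and in_W: "\<And>t. a \<le> t \<Longrightarrow> t \<le> b \<Longrightarrow> f' t \<in> W"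
  shows "(1 / (b - a)) *\<^sub>R (f b - f a) \<in> W"
proof -
  define q where "q s t = (1 / (t - s)) *\<^sub>R (f t - f s)" for s t :: real
  have q_sym: "q s t = q t s" for s t
  proof -
    have "1 / (t - s) = - (1 / (s - t))" by (metis minus_diff_eq minus_divide_right)
    then have "q s t = - ((1 / (s - t)) *\<^sub>R (f t - f s))" by (simp only: q_def scaleR_minus_left)
    also have "\<dots> = q t s" by (simp only: q_def scaleR_minus_right[symmetric] minus_diff_eq)
    finally show ?thesis .
  qed
  have split: "q r t \<in> W" if "r < s" "s < t" "q r s \<in> W" "q s t \<in> W" for r s t
  proof -
    \<comment> \<open>The share of \<open>[r, s]\<close> in the length of \<open>[r, t]\<close>: the
      quotient over an interval is the length-weighted mean of those over its two parts.\<close>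
    define u where "u = (s - r) / (t - r)"
    have u: "0 \<le> u" "u \<le> 1" using that by (auto simp: u_def)
    have "1 - u = (t - s) / (t - r)" using that by (simp add: u_def field_simps)
    then have "u *\<^sub>R q r s + (1 - u) *\<^sub>R q s t =
        (1 / (t - r)) *\<^sub>R ((f s - f r) + (f t - f s))"
      using that unfolding scaleR_add_right by (simp add: u_def q_def)
    then have "u *\<^sub>R q r s + (1 - u) *\<^sub>R q s t = q r t"
      by (simp add: q_def)
    moreover have "u *\<^sub>R q r s + (1 - u) *\<^sub>R q s t \<in> W"
      by (rule convexD[OF W(2)]) (use that u in auto)
    ultimately show ?thesis by simp
  qed
  define P where "P s t \<longleftrightarrow> (a \<le> s \<and> s < t \<and> t \<le> b \<longrightarrow> q s t \<in> W)" for s t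
  have "P a b"
  proof (rule Bolzano)
    show "a \<le> b" using assms by simp
  next
    fix r s t assume "P r s" "P s t" "r \<le> s" "s \<le> t"
    then show "P r t"
      unfolding P_def using split[of r s t]
      by (metis less_eq_real_def order_le_less_trans order_less_le_trans)
  next
    fix x assume x: "a \<le> x" "x \<le> b"
    have "\<forall>\<^sub>F s in at x within {a..b}. q x s \<in> W"
      using der[OF x] in_W[OF x] W(1) unfolding tendsto_def q_def by blast
    then obtain d where d: "d > 0" "\<And>s. s \<in> {a..b} \<Longrightarrow> s \<noteq> x \<Longrightarrow> dist s x < d \<Longrightarrow> q x s \<in> W"
      unfolding eventually_at by auto
    \<comment> \<open>\<open>Bolzano\<close> only asks for short intervals containing
      \<open>x\<close>. Such an interval is cut at \<open>x\<close>; both quotients then have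
      \<open>x\<close> as an end point and are so close to \<open>f' x\<close> that they lie in the
      open set \<open>W\<close>.\<close>
    have "P s t" if "s \<le> x" "x \<le> t" "t - s < d" for s t
      unfolding P_def
    proof safe
      assume st: "a \<le> s" "s < t" "t \<le> b"
      have "q s x \<in> W" if "s < x"
        using d(2)[of s] that st \<open>x \<le> t\<close> \<open>t - s < d\<close> q_sym[of s x] by (auto simp: dist_real_def)
      moreover have "q x t \<in> W" if "x < t"
        using d(2)[of t] that st \<open>s \<le> x\<close> \<open>t - s < d\<close> by (auto simp: dist_real_def)
      ultimately show "q s t \<in> W"
        using split[of s x t] st that by (cases "s < x"; cases "x < t") auto
    qed
    then show "\<exists>d>0. \<forall>s t. s \<le> x \<and> x \<le> t \<and> t - s < d \<longrightarrow> P s t"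
      using d(1) by blast
  qed
  then show ?thesis using assms(1) by (simp add: P_def q_def)
qed

text \<open>Made for limits of mean values: quotients confined to the convex set \<open>W\<close>
  may converge to a point outside \<open>W\<close>, but the limit differs from one of them by an
  element of \<open>N\<close> and thus stays in \<open>V\<close>.\<close>

lemma nhd_convex:
  fixes V :: "'y::locally_convex_space set"
  assumes "open V" "a \<in> V"
  obtains W N where "open W" "convex W" "a \<in> W" "open N" "0 \<in> N"
    "\<And>q v. q - v \<in> N \<Longrightarrow> v \<in> W \<Longrightarrow> q \<in> V" "W \<subseteq> V"
proof -
  have "0 \<in> {v. v + a \<in> V}" using assms(2) by simp
  then obtain N where N: "open N" "0 \<in> N" "\<And>u v. u \<in> N \<Longrightarrow> v \<in> N \<Longrightarrow> u + v \<in> {v. v + a \<in> V}"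
    "\<And>u. u \<in> N \<Longrightarrow> - u \<in> N" "convex N"
    by (rule nhd_0_add[OF open_translation_lcs(1)[OF assms(1), of a]]) (rule that)
  define W where "W = {v. v - a \<in> N}"
  have "W = (\<lambda>v. a + v) ` N"
    unfolding W_def by (auto intro!: image_eqI[of _ _ "_ - a"])
  then have "convex W" using convex_translation[OF N(5), of a] by simp
  moreover have "open W" unfolding W_def by (rule open_translation_lcs(2)[OF N(1)])
  moreover have "a \<in> W" using N by (simp add: W_def)
  moreover have q: "q \<in> V" if "q - v \<in> N" "v \<in> W" for q v
    using N(3)[of "q - v" "v - a"] that by (simp add: W_def)
  moreover have "W \<subseteq> V" using q[of v v for v] N(2) by auto
  ultimately show ?thesis using that[of W N] N(1,2) by blast
qed

section \<open>Directional derivatives relative to a convex set\<close>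

text \<open>The direction space of the affine hull, built from differences to avoid a base point; it
  is the zero space if \<open>P\<close> is empty or a single point.\<close>

definition dirs :: "'e::euclidean_space set \<Rightarrow> 'e set" where
  "dirs P = span {x - y | x y. x \<in> P \<and> y \<in> P}"

lemma subspace_dirs [simp]: "subspace (dirs P)"
  by (simp add: dirs_def)

lemma diff_in_dirs: "x \<in> P \<Longrightarrow> y \<in> P \<Longrightarrow> x - y \<in> dirs P"
  unfolding dirs_def by (rule span_base) auto

lemma dirs_mono: "P \<subseteq> Q \<Longrightarrow> dirs P \<subseteq> dirs Q"
  unfolding dirs_def by (rule span_mono) auto

text \<open>The vectors whose translations preserve the affine hull form a subspace, and this
  subspace contains all differences of points of \<open>P\<close>.\<close>

lemma affine_hull_add_dirs:
  assumes "x \<in> affine hull P" "y \<in> dirs P"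
  shows "x + y \<in> affine hull P"
proof -
  have aff: "u *\<^sub>R a + v *\<^sub>R b + w *\<^sub>R c \<in> affine hull P"
    if "a \<in> affine hull P" "b \<in> affine hull P" "c \<in> affine hull P" "u + v + w = 1" for a b c u v w
    using that affine_affine_hull[of P] mem_affine_3 by blast
  define S where "S = {y. \<forall>x\<in>affine hull P. x + y \<in> affine hull P}"
  have "subspace S"
    unfolding subspace_def
  proof (intro conjI ballI allI)
    show "0 \<in> S" by (simp add: S_def)
    show "a + b \<in> S" if "a \<in> S" "b \<in> S" for a b
      using that unfolding S_def by (auto simp: add.assoc[symmetric])
    show "c *\<^sub>R a \<in> S" if "a \<in> S" for c a
      unfolding S_def
    proof safe
      fix x assume x: "x \<in> affine hull P"
      then have "c *\<^sub>R (x + a) + (1 - c) *\<^sub>R x + 0 *\<^sub>R x \<in> affine hull P"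
        using that by (intro aff) (auto simp: S_def)
      then show "x + c *\<^sub>R a \<in> affine hull P" by (simp add: algebra_simps)
    qed
  qed
  moreover have "{x - y | x y. x \<in> P \<and> y \<in> P} \<subseteq> S"
  proof (clarsimp simp: S_def)
    fix x a b assume "x \<in> affine hull P" "a \<in> P" "b \<in> P"
    then have "1 *\<^sub>R x + 1 *\<^sub>R a + (-1) *\<^sub>R b \<in> affine hull P"
      by (intro aff) (auto intro: hull_inc)
    then show "x + (a - b) \<in> affine hull P" by (simp add: algebra_simps)
  qed
  ultimately have "dirs P \<subseteq> S" unfolding dirs_def by (intro span_minimal)
  then show ?thesis using assms by (auto simp: S_def)
qed

lemma affine_hull_diff_in_dirs:
  assumes "x \<in> affine hull P" "y \<in> affine hull P"
  shows "x - y \<in> dirs P"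
proof -
  obtain a where a: "a \<in> P" using assms by fastforce
  have "affine {z. z - a \<in> dirs P}"
    unfolding affine_def
  proof (clarsimp)
    fix x y and u v :: real assume *: "x - a \<in> dirs P" "y - a \<in> dirs P" "u + v = 1"
    have "u *\<^sub>R (x - a) + v *\<^sub>R (y - a) \<in> dirs P"
      using * by (intro subspace_add subspace_scale) auto
    moreover have "u *\<^sub>R (x - a) + v *\<^sub>R (y - a) = u *\<^sub>R x + v *\<^sub>R y - (u + v) *\<^sub>R a"
      by (simp add: algebra_simps)
    ultimately show "u *\<^sub>R x + v *\<^sub>R y - a \<in> dirs P" using * by simp
  qed
  then have "affine hull P \<subseteq> {z. z - a \<in> dirs P}"
    using a by (intro hull_minimal) (auto intro: diff_in_dirs)
  then have "(x - a) - (y - a) \<in> dirs P" using assms by (metis (lifting) subspace_diff[OF subspace_dirs] mem_Collect_eq subsetD)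
  then show ?thesis by simp
qed

lemma eventually_rel_interior_line:
  assumes "x \<in> rel_interior P" "y \<in> dirs P" "open O'" "x \<in> O'"
  shows "\<forall>\<^sub>F t in nhds 0. x + t *\<^sub>R y \<in> rel_interior P \<inter> O'"
proof -
  have "openin (top_of_set (affine hull P)) (rel_interior P)" by (rule openin_rel_interior)
  then obtain U where U: "open U" "rel_interior P = affine hull P \<inter> U"
    unfolding openin_open by blast
  have lim: "((\<lambda>t. x + t *\<^sub>R y) \<longlongrightarrow> x + 0 *\<^sub>R y) (nhds 0)"
    by (intro tendsto_intros filterlim_ident)
  have "\<forall>\<^sub>F t in nhds 0. x + t *\<^sub>R y \<in> U \<inter> O'"
    by (rule topological_tendstoD[OF lim]) (use assms U in auto)
  moreover have "x + t *\<^sub>R y \<in> affine hull P" for t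
    using assms by (intro affine_hull_add_dirs subspace_scale) (auto simp: U)
  ultimately show ?thesis unfolding U(2) by (auto elim: eventually_mono)
qed

lemma rel_interior_approach:
  fixes P :: "'e::euclidean_space set"
  assumes "convex P" "x \<in> P" "c \<in> rel_interior P"
  shows "((\<lambda>e. x - e *\<^sub>R (x - c)) \<longlongrightarrow> x) (at_right 0)"
    "\<forall>\<^sub>F e in at_right 0. x - e *\<^sub>R (x - c) \<in> rel_interior P"
proof -
  have "((\<lambda>e. x - e *\<^sub>R (x - c)) \<longlongrightarrow> x - 0 *\<^sub>R (x - c)) (at_right 0)"
    by (intro tendsto_intros)
  then show "((\<lambda>e. x - e *\<^sub>R (x - c)) \<longlongrightarrow> x) (at_right 0)" by simp
  show "\<forall>\<^sub>F e in at_right 0. x - e *\<^sub>R (x - c) \<in> rel_interior P"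
    unfolding eventually_at_right_field
    using rel_interior_convex_shrink[OF assms(1,3,2)] by (intro exI[of _ 1]) auto
qed

text \<open>The segment from \<open>x\<close> towards a point \<open>c\<close> of the relative
  interior approaches \<open>x\<close> from within the relative interior, which is therefore dense.
  The open set localises the claim to maps known to agree only near \<open>x\<close>.\<close>

lemma continuous_eq_from_rel_interior:
  fixes f g :: "'e::euclidean_space \<Rightarrow> 'y::t2_space"
  assumes "convex P" "continuous_on P f" "continuous_on P g" "open O'"
    and eq: "\<And>x. x \<in> rel_interior P \<Longrightarrow> x \<in> O' \<Longrightarrow> f x = g x"
    and x: "x \<in> P" "x \<in> O'"
  shows "f x = g x"
proof -
  obtain c where c: "c \<in> rel_interior P"
    using x assms(1) rel_interior_eq_empty by blast
  let ?p = "\<lambda>e. x - e *\<^sub>R (x - c)"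
  note ap = rel_interior_approach[OF assms(1) x(1) c]
  have ev: "\<forall>\<^sub>F e in at_right 0. ?p e \<in> P"
    using ap(2) by eventually_elim (use rel_interior_subset in blast)
  have f: "((\<lambda>e. f (?p e)) \<longlongrightarrow> f x) (at_right 0)"
    by (rule continuous_on_tendsto_compose[OF assms(2) ap(1) x(1) ev])
  have g: "((\<lambda>e. g (?p e)) \<longlongrightarrow> g x) (at_right 0)"
    by (rule continuous_on_tendsto_compose[OF assms(3) ap(1) x(1) ev])
  have "\<forall>\<^sub>F e in at_right 0. ?p e \<in> O'"
    using topological_tendstoD[OF ap(1) assms(4) x(2)] .
  with ap(2) have "\<forall>\<^sub>F e in at_right 0. g (?p e) = f (?p e)"
    by eventually_elim (simp add: eq)
  then have "((\<lambda>e. f (?p e)) \<longlongrightarrow> g x) (at_right 0)"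
    using g tendsto_cong by fast
  then show ?thesis using f tendsto_unique trivial_limit_at_right_real by blast
qed

text \<open>The limit runs over those \<open>t\<close> for which the moved point is in
  \<open>S\<close>. If no small nonzero \<open>t\<close> qualifies, the filter is trivial and every
  \<open>v\<close> is a derivative; at such boundary points the value is pinned down only by the
  continuity demanded in \<open>has_dd\<close>.\<close>

definition has_line_deriv ::
  "'e::euclidean_space set \<Rightarrow> 'e \<Rightarrow> ('e \<Rightarrow> 'y::locally_convex_space) \<Rightarrow> 'e \<Rightarrow> 'y \<Rightarrow> bool" where
  "has_line_deriv S y f x v \<longleftrightarrow>
     ((\<lambda>t. (1 / t) *\<^sub>R (f (x + t *\<^sub>R y) - f x)) \<longlongrightarrow> v) (at 0 within {t. x + t *\<^sub>R y \<in> S})"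

lemma has_line_deriv_cong:
  assumes "has_line_deriv S y f x v" "\<And>z. z \<in> S \<Longrightarrow> f z = g z" "f x = g x"
  shows "has_line_deriv S y g x v"
  using assms(1) unfolding has_line_deriv_def
  by (rule Lim_transform_within[OF _ zero_less_one]) (auto simp: assms)

lemma has_line_deriv_cong_local:
  assumes "has_line_deriv S y f x v" "open U" "x \<in> U" "\<And>z. z \<in> S \<Longrightarrow> z \<in> U \<Longrightarrow> f z = g z" "f x = g x"
  shows "has_line_deriv S y g x v"
proof -
  have lim: "((\<lambda>t. x + t *\<^sub>R y) \<longlongrightarrow> x + 0 *\<^sub>R y) (at 0 within {t. x + t *\<^sub>R y \<in> S})"
    by (intro tendsto_intros)
  have "\<forall>\<^sub>F t in at 0 within {t. x + t *\<^sub>R y \<in> S}. x + t *\<^sub>R y \<in> U"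
    by (rule topological_tendstoD[OF lim]) (use assms in auto)
  moreover have "\<forall>\<^sub>F t in at 0 within {t. x + t *\<^sub>R y \<in> S}. x + t *\<^sub>R y \<in> S"
    unfolding eventually_at_filter by simp
  ultimately have "\<forall>\<^sub>F t in at 0 within {t. x + t *\<^sub>R y \<in> S}.
      (1 / t) *\<^sub>R (f (x + t *\<^sub>R y) - f x) = (1 / t) *\<^sub>R (g (x + t *\<^sub>R y) - g x)"
    by eventually_elim (simp add: assms)
  then show ?thesis
    using assms(1) unfolding has_line_deriv_def by (rule Lim_transform_eventually[rotated])
qed

lemma mean_value_line:
  fixes f :: "'e::euclidean_space \<Rightarrow> 'y::locally_convex_space"
  assumes W: "open W" "convex W" and "a \<noteq> 0"
    and seg: "\<And>s. s \<in> closed_segment 0 a \<Longrightarrow> x + s *\<^sub>R y \<in> S"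
    and der: "\<And>s. s \<in> closed_segment 0 a \<Longrightarrow> has_line_deriv S y f (x + s *\<^sub>R y) (g (x + s *\<^sub>R y))"
    and in_W: "\<And>s. s \<in> closed_segment 0 a \<Longrightarrow> g (x + s *\<^sub>R y) \<in> W"
  shows "(1 / a) *\<^sub>R (f (x + a *\<^sub>R y) - f x) \<in> W"
proof -
  let ?f = "\<lambda>s. f (x + s *\<^sub>R y)"
  have der': "((\<lambda>s'. (1 / (s' - s)) *\<^sub>R (?f s' - ?f s)) \<longlongrightarrow> g (x + s *\<^sub>R y)) (at s within closed_segment 0 a)"
    if s: "s \<in> closed_segment 0 a" for s
  proof -
    have "((\<lambda>s'. s' - s) \<longlongrightarrow> s - s) (at s within closed_segment 0 a)"
      by (intro tendsto_intros)
    then have "LIM s' at s within closed_segment 0 a. s' - s :>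
        at 0 within {t. x + s *\<^sub>R y + t *\<^sub>R y \<in> S}"
      unfolding filterlim_at
    proof (intro conjI)
      have "\<forall>\<^sub>F s' in at s within closed_segment 0 a. s' \<in> closed_segment 0 a \<and> s' \<noteq> s"
        unfolding eventually_at_filter by simp
      then show "\<forall>\<^sub>F s' in at s within closed_segment 0 a. s' - s \<in> {t. x + s *\<^sub>R y + t *\<^sub>R y \<in> S} \<and> s' - s \<noteq> 0"
        by eventually_elim (use seg in \<open>auto simp: algebra_simps\<close>)
    qed simp
    from filterlim_compose[OF der[OF s, unfolded has_line_deriv_def] this]
    show ?thesis by (simp add: algebra_simps)
  qed
  \<comment> \<open>For negative \<open>a\<close> the interval is \<open>[a, 0]\<close>, and the
    mean value theorem yields the quotient with exchanged end points.\<close>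
  have sym: "(1 / (0 - a)) *\<^sub>R (?f 0 - ?f a) = (1 / a) *\<^sub>R (?f a - ?f 0)"
  proof -
    have "?f 0 - ?f a = - (?f a - ?f 0)" "1 / (0 - a) = - (1 / a)" by auto
    then show ?thesis by (simp only: scaleR_minus_left scaleR_minus_right minus_minus)
  qed
  show ?thesis
  proof (cases "0 < a")
    case True
    then have "(1 / (a - 0)) *\<^sub>R (?f a - ?f 0) \<in> W"
      using der' in_W closed_segment_eq_real_ivl[of 0 a] by (intro mean_value_convex[OF True W, of ?f "\<lambda>s. g (x + s *\<^sub>R y)"]) auto
    then show ?thesis by simp
  next
    case False
    then have a: "a < 0" using assms by simp
    have "(1 / (0 - a)) *\<^sub>R (?f 0 - ?f a) \<in> W"
      using der' in_W closed_segment_eq_real_ivl[of 0 a] a by (intro mean_value_convex[OF a W, of ?f "\<lambda>s. g (x + s *\<^sub>R y)"]) auto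
    then show ?thesis by (simp only: sym) simp
  qed
qed

definition has_dd ::
  "'e::euclidean_space set \<Rightarrow> 'e \<Rightarrow> ('e \<Rightarrow> 'y::locally_convex_space) \<Rightarrow> ('e \<Rightarrow> 'y) \<Rightarrow> bool" where
  "has_dd P y f g \<longleftrightarrow> continuous_on P f \<and> continuous_on P g \<and> (\<forall>x\<in>P. has_line_deriv P y f x (g x))"

lemma has_dd_cong:
  assumes "\<And>x. x \<in> P \<Longrightarrow> f x = f' x" "\<And>x. x \<in> P \<Longrightarrow> g x = g' x"
  shows "has_dd P y f g \<longleftrightarrow> has_dd P y f' g'"
proof -
  have "has_line_deriv P y f x (g x) \<longleftrightarrow> has_line_deriv P y f' x (g' x)" if "x \<in> P" for x
    using has_line_deriv_cong[of P y f x "g x" f'] has_line_deriv_cong[of P y f' x "g' x" f] that assms by auto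
  then show ?thesis
    unfolding has_dd_def using assms continuous_on_cong[OF refl, of P f f'] continuous_on_cong[OF refl, of P g g']
    by auto
qed

text \<open>From a relative interior point, a line in a direction of \<open>dirs P\<close> stays in
  the relative interior for small parameters. Derivatives there are thus two-sided limits and
  unique.\<close>

lemma at_within_rel_interior:
  assumes "x \<in> rel_interior P" "y \<in> dirs P" "rel_interior P \<subseteq> S"
  shows "at 0 within {t. x + t *\<^sub>R y \<in> S} = at (0::real)"
proof -
  have "\<forall>\<^sub>F t in nhds 0. x + t *\<^sub>R y \<in> S"
    using eventually_rel_interior_line[OF assms(1,2), of UNIV]
    by (rule eventually_mono) (use assms(3) in auto)
  then obtain T where T: "open T" "(0::real) \<in> T" "\<And>t. t \<in> T \<Longrightarrow> x + t *\<^sub>R y \<in> S"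
    unfolding eventually_nhds by blast
  then show ?thesis
    by (intro at_within_nhd[OF T(2,1)]) auto
qed

lemma has_line_deriv_unique:
  assumes "x \<in> rel_interior P" "y \<in> dirs P" "has_line_deriv P y f x u" "has_line_deriv P y f x v"
  shows "u = v"
  using assms(3,4)
  unfolding has_line_deriv_def at_within_rel_interior[OF assms(1,2) rel_interior_subset]
  by (rule tendsto_unique[OF trivial_limit_at])

lemma has_dd_unique_local:
  assumes "convex P" "y \<in> dirs P" "has_dd P y f g" "has_dd P y f' g'" "open U"
    and eq: "\<And>x. x \<in> P \<Longrightarrow> x \<in> U \<Longrightarrow> f x = f' x" and x: "x \<in> P" "x \<in> U"
  shows "g x = g' x"
proof (rule continuous_eq_from_rel_interior[OF assms(1) _ _ assms(5) _ x])
  show "continuous_on P g" "continuous_on P g'" using assms by (auto simp: has_dd_def)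
  fix z assume z: "z \<in> rel_interior P" "z \<in> U"
  have zP: "z \<in> P" using z rel_interior_subset by blast
  have "has_line_deriv P y f' z (g z)"
    by (rule has_line_deriv_cong_local[of _ _ f _ _ U]) (use assms zP z in \<open>auto simp: has_dd_def\<close>)
  moreover have "has_line_deriv P y f' z (g' z)" using assms zP by (auto simp: has_dd_def)
  ultimately show "g z = g' z" using has_line_deriv_unique z(1) assms(2) by blast
qed

lemma has_dd_unique:
  assumes "convex P" "y \<in> dirs P" "has_dd P y f g" "has_dd P y f g'" "x \<in> P"
  shows "g x = g' x"
  using has_dd_unique_local[OF assms(1-4), of UNIV x] assms(5) by auto

text \<open>The increment along \<open>y + z\<close> splits into one along \<open>y\<close> from
  \<open>x\<close> and one along \<open>z\<close> from the moving point
  \<open>x + t *\<^sub>R y\<close>. The latter quotient is a mean value of \<open>h\<close> near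
  \<open>x\<close>, so continuity of \<open>h\<close> gives its limit. This takes place in the
  relative interior, where there is room for the detour; boundary points follow by density.\<close>

lemma has_dd_add_direction:
  assumes P: "convex P" "y \<in> dirs P" "z \<in> dirs P"
    and dd: "has_dd P y f g" "has_dd P z f h" "has_dd P (y + z) f k" and x: "x \<in> P"
  shows "k x = g x + h x"
proof (rule continuous_eq_from_rel_interior[OF P(1) _ _ open_UNIV _ x UNIV_I])
  show "continuous_on P k" "continuous_on P (\<lambda>x. g x + h x)"
    using dd by (auto simp: has_dd_def intro!: continuous_intros)
  fix x assume x: "x \<in> rel_interior P"
  have xP: "x \<in> P" using x rel_interior_subset by blast
  note at0 = at_within_rel_interior[OF x _ rel_interior_subset]
  have lim_k: "((\<lambda>t. (1 / t) *\<^sub>R (f (x + t *\<^sub>R (y + z)) - f x)) \<longlongrightarrow> k x) (at 0)"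
    using dd(3) xP at0[of "y + z"] P subspace_add[OF subspace_dirs, of y P z] unfolding has_dd_def has_line_deriv_def
    by auto
  have lim_g: "((\<lambda>t. (1 / t) *\<^sub>R (f (x + t *\<^sub>R y) - f x)) \<longlongrightarrow> g x) (at 0)"
    using dd(1) xP at0[of y] P unfolding has_dd_def has_line_deriv_def by auto
  have lim_h: "((\<lambda>t. (1 / t) *\<^sub>R (f (x + t *\<^sub>R (y + z)) - f (x + t *\<^sub>R y))) \<longlongrightarrow> h x) (at 0)"
    unfolding tendsto_def
  proof (intro allI impI)
    fix V :: "'b set" assume V: "open V" "h x \<in> V"
    obtain W where W: "open W" "convex W" "h x \<in> W" "W \<subseteq> V"
      by (rule nhd_convex[OF V]) blast
    have "continuous_on P h" using dd by (simp add: has_dd_def)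
    then obtain U where U: "open U" "x \<in> U" "\<And>u. u \<in> P \<Longrightarrow> u \<in> U \<Longrightarrow> h u \<in> W"
      using \<open>continuous_on P h\<close>[unfolded continuous_on_topological, rule_format, OF xP W(1,3)] by blast
    obtain O' where O': "open O'" "rel_interior P = affine hull P \<inter> O'"
      using openin_rel_interior[of P] unfolding openin_open by blast
    obtain d where d: "d > 0" "ball x d \<subseteq> O' \<inter> U"
      using open_contains_ball[of "O' \<inter> U"] O' U x by blast
    have "((\<lambda>t. \<bar>t\<bar> * (norm y + norm z)) \<longlongrightarrow> \<bar>0\<bar> * (norm y + norm z)) (at (0::real))"
      by (intro tendsto_intros)
    then have "\<forall>\<^sub>F t in at 0. \<bar>t\<bar> * (norm y + norm z) < d"
      using d by (intro order_tendstoD(2)[of _ 0]) auto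
    moreover have "\<forall>\<^sub>F t in at 0. t \<noteq> (0::real)" by (simp add: eventually_at_filter)
    ultimately show "\<forall>\<^sub>F t in at 0. (1 / t) *\<^sub>R (f (x + t *\<^sub>R (y + z)) - f (x + t *\<^sub>R y)) \<in> V"
    proof eventually_elim
      case (elim t)
      \<comment> \<open>Along the whole detour the displacement is at most
        \<open>\<bar>t\<bar> * (norm y + norm z)\<close>, which is below \<open>d\<close>.\<close>
      have mem: "x + t *\<^sub>R y + s *\<^sub>R z \<in> P \<inter> U" if "s \<in> closed_segment 0 t" for s
      proof -
        have "\<bar>s\<bar> \<le> \<bar>t\<bar>" using that by (auto simp: closed_segment_eq_real_ivl split: if_splits)
        then have "norm (t *\<^sub>R y + s *\<^sub>R z) \<le> \<bar>t\<bar> * norm y + \<bar>t\<bar> * norm z"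
          by (intro norm_triangle_mono) (auto intro: mult_right_mono)
        then have "norm (t *\<^sub>R y + s *\<^sub>R z) < d" using elim by (simp add: algebra_simps)
        moreover have "dist x (x + v) = norm v" for v by (simp add: dist_norm)
        ultimately have "x + (t *\<^sub>R y + s *\<^sub>R z) \<in> ball x d" by (simp only: mem_ball)
        moreover have "x + (t *\<^sub>R y + s *\<^sub>R z) \<in> affine hull P"
          using P xP by (intro affine_hull_add_dirs subspace_add subspace_scale) (auto intro: hull_inc)
        ultimately have "x + (t *\<^sub>R y + s *\<^sub>R z) \<in> rel_interior P \<inter> U" using d O' by blast
        then show ?thesis using rel_interior_subset by (auto simp: add.assoc)
      qed
      have "(1 / t) *\<^sub>R (f (x + t *\<^sub>R y + t *\<^sub>R z) - f (x + t *\<^sub>R y)) \<in> W"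
        by (rule mean_value_line[where S = P and g = h])
          (use W elim mem U dd in \<open>auto simp: has_dd_def\<close>)
      then show ?case using W by (auto simp: algebra_simps)
    qed
  qed
  have "((\<lambda>t. (1 / t) *\<^sub>R (f (x + t *\<^sub>R y) - f x) + (1 / t) *\<^sub>R (f (x + t *\<^sub>R (y + z)) - f (x + t *\<^sub>R y)))
      \<longlongrightarrow> g x + h x) (at 0)"
    by (intro tendsto_intros lim_g lim_h)
  then have "((\<lambda>t. (1 / t) *\<^sub>R (f (x + t *\<^sub>R (y + z)) - f x)) \<longlongrightarrow> g x + h x) (at 0)"
    by (simp add: scaleR_add_right[symmetric])
  then show "k x = g x + h x" using tendsto_unique[OF trivial_limit_at lim_k] by blast
qed

text \<open>Segments in the relative interior approximate those meeting the boundary.\<close>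

lemma has_dd_from_rel_interior:
  fixes f :: "'e::euclidean_space \<Rightarrow> 'y::locally_convex_space"
  assumes P: "convex P" and cf: "continuous_on P f" and cg: "continuous_on P g"
    and der: "\<And>x. x \<in> rel_interior P \<Longrightarrow> has_line_deriv (rel_interior P) y f x (g x)"
  shows "has_dd P y f g"
  unfolding has_dd_def
proof (intro conjI ballI cf cg)
  fix x assume x: "x \<in> P"
  obtain c where c: "c \<in> rel_interior P"
    using x P rel_interior_eq_empty by blast
  show "has_line_deriv P y f x (g x)"
    unfolding has_line_deriv_def tendsto_def
  proof (intro allI impI)
    fix V assume V: "open V" "g x \<in> V"
    obtain W N where W: "open W" "convex W" "g x \<in> W" and N: "open N" "0 \<in> N"
      "\<And>q v. q - v \<in> N \<Longrightarrow> v \<in> W \<Longrightarrow> q \<in> V"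
      by (rule nhd_convex[OF V]) blast
    obtain U where U: "open U" "x \<in> U" "\<And>u. u \<in> P \<Longrightarrow> u \<in> U \<Longrightarrow> g u \<in> W"
      using cg[unfolded continuous_on_topological, rule_format, OF x W(1,3)] by blast
    obtain d where d: "d > 0" "ball x d \<subseteq> U" using U open_contains_ball by blast
    have "((\<lambda>t. \<bar>t\<bar> * norm y) \<longlongrightarrow> \<bar>0\<bar> * norm y) (at (0::real) within {t. x + t *\<^sub>R y \<in> P})"
      by (intro tendsto_intros)
    then have "\<forall>\<^sub>F t in at 0 within {t. x + t *\<^sub>R y \<in> P}. \<bar>t\<bar> * norm y < d"
      using d by (intro order_tendstoD(2)[of _ 0]) auto
    moreover have "\<forall>\<^sub>F t in at 0 within {t. x + t *\<^sub>R y \<in> P}. t \<noteq> 0 \<and> x + t *\<^sub>R y \<in> P"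
      by (simp add: eventually_at_filter)
    ultimately show "\<forall>\<^sub>F t in at 0 within {t. x + t *\<^sub>R y \<in> P}. (1 / t) *\<^sub>R (f (x + t *\<^sub>R y) - f x) \<in> V"
    proof eventually_elim
      case (elim t)
      then have t: "t \<noteq> 0" "x + t *\<^sub>R y \<in> P" "\<bar>t\<bar> * norm y < d" by auto
      define q where "q = (1 / t) *\<^sub>R (f (x + t *\<^sub>R y) - f x)"
      \<comment> \<open>The segment from \<open>x\<close> to \<open>x + t *\<^sub>R y\<close> is
        contracted towards \<open>c\<close> by the factor \<open>1 - e\<close>. Its image lies in
        the relative interior and is still parallel to \<open>y\<close>, with parameter length
        \<open>(1 - e) * t\<close>; hence the normalisation in \<open>q'\<close>.\<close>
      define p where "p e = x - e *\<^sub>R (x - c)" for e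
      define p' where "p' e = x + t *\<^sub>R y - e *\<^sub>R (x + t *\<^sub>R y - c)" for e
      define q' where "q' e = (1 / ((1 - e) * t)) *\<^sub>R (f (p' e) - f (p e))" for e
      have p: "(p \<longlongrightarrow> x) (at_right 0)" "\<forall>\<^sub>F e in at_right 0. p e \<in> rel_interior P"
        using rel_interior_approach[OF P x c] unfolding p_def[abs_def] by auto
      have p': "(p' \<longlongrightarrow> x + t *\<^sub>R y) (at_right 0)" "\<forall>\<^sub>F e in at_right 0. p' e \<in> rel_interior P"
        using rel_interior_approach[OF P t(2) c] unfolding p'_def[abs_def] by auto
      have P1: "\<forall>\<^sub>F e in at_right 0. p e \<in> P" "\<forall>\<^sub>F e in at_right 0. p' e \<in> P"
        using rel_interior_subset[of P] by (auto intro: eventually_mono[OF p(2)] eventually_mono[OF p'(2)])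
      have "((\<lambda>e. 1 / ((1 - e) * t)) \<longlongrightarrow> 1 / ((1 - 0) * t)) (at_right 0)"
        using t by (intro tendsto_intros) auto
      moreover have "((\<lambda>e. f (p e)) \<longlongrightarrow> f x) (at_right 0)"
        by (rule continuous_on_tendsto_compose[OF cf p(1) x P1(1)])
      moreover have "((\<lambda>e. f (p' e)) \<longlongrightarrow> f (x + t *\<^sub>R y)) (at_right 0)"
        by (rule continuous_on_tendsto_compose[OF cf p'(1) t(2) P1(2)])
      ultimately have "(q' \<longlongrightarrow> q) (at_right 0)"
        unfolding q'_def[abs_def] q_def by (auto intro!: tendsto_scaleR_lcs tendsto_diff)
      then have "((\<lambda>e. q - q' e) \<longlongrightarrow> q - q) (at_right 0)" by (intro tendsto_intros)
      then have "\<forall>\<^sub>F e in at_right 0. q - q' e \<in> N"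
        using N by (intro topological_tendstoD) auto
      \<comment> \<open>Keeps the contracted segment inside \<open>ball x d\<close>, where the
        values of \<open>g\<close> lie in \<open>W\<close>.\<close>
      moreover have "((\<lambda>e. norm (p e - x) + \<bar>t\<bar> * norm y) \<longlongrightarrow> norm (x - x) + \<bar>t\<bar> * norm y) (at_right 0)"
        by (intro tendsto_intros p(1))
      then have "\<forall>\<^sub>F e in at_right 0. norm (p e - x) + \<bar>t\<bar> * norm y < d"
        using t by (intro order_tendstoD(2)) auto
      moreover have "\<forall>\<^sub>F e in at_right 0. e \<in> {0<..<1::real}"
        by (rule eventually_at_rightI[of 0 1]) auto
      ultimately have "\<forall>\<^sub>F e in at_right 0. q - q' e \<in> N \<and> norm (p e - x) + \<bar>t\<bar> * norm y < d
          \<and> e \<in> {0<..<1} \<and> p e \<in> rel_interior P \<and> p' e \<in> rel_interior P"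
        using p(2) p'(2) by eventually_elim auto
      then obtain e where e: "q - q' e \<in> N" "norm (p e - x) + \<bar>t\<bar> * norm y < d"
        "0 < e" "e < 1" "p e \<in> rel_interior P" "p' e \<in> rel_interior P"
        using eventually_happens'[OF trivial_limit_at_right_real, of _ 0] by auto
      have pp: "p' e = p e + ((1 - e) * t) *\<^sub>R y" by (simp add: p_def p'_def algebra_simps)
      have mem: "p e + s *\<^sub>R y \<in> rel_interior P \<and> p e + s *\<^sub>R y \<in> U"
        if seg: "s \<in> closed_segment 0 ((1 - e) * t)" for s
      proof
        obtain u where u0: "0 \<le> u" "u \<le> 1" "s = (1 - u) *\<^sub>R 0 + u *\<^sub>R ((1 - e) * t)"
          using seg unfolding in_segment by blast
        then have u: "0 \<le> u" "u \<le> 1" "s = u * ((1 - e) * t)" by simp_all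
        have "(1 - u) *\<^sub>R p e + u *\<^sub>R p' e \<in> rel_interior P"
          by (rule convexD[OF convex_rel_interior[OF P] e(5,6)]) (use u(1,2) in simp_all)
        moreover have "(1 - u) *\<^sub>R p e + u *\<^sub>R p' e = p e + s *\<^sub>R y"
          unfolding pp u(3) by (simp add: scaleR_add_right scaleR_diff_left)
        ultimately show "p e + s *\<^sub>R y \<in> rel_interior P" by simp
        have "\<bar>s\<bar> = (u * (1 - e)) * \<bar>t\<bar>" using u e by (simp add: abs_mult)
        also have "\<dots> \<le> 1 * \<bar>t\<bar>" using u e by (intro mult_right_mono mult_le_one) auto
        finally have "norm (s *\<^sub>R y) \<le> \<bar>t\<bar> * norm y" by (simp add: mult_right_mono)
        then have "norm ((p e - x) + s *\<^sub>R y) < d"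
          using norm_triangle_ineq[of "p e - x" "s *\<^sub>R y"] e(2) by linarith
        moreover have "dist x (p e + s *\<^sub>R y) = norm ((p e - x) + s *\<^sub>R y)"
          by (simp add: dist_norm norm_minus_commute algebra_simps)
        ultimately show "p e + s *\<^sub>R y \<in> U" using d(2) by auto
      qed
      have "(1 / ((1 - e) * t)) *\<^sub>R (f (p e + ((1 - e) * t) *\<^sub>R y) - f (p e)) \<in> W"
      proof (rule mean_value_line[where S = "rel_interior P" and g = g])
        show "(1 - e) * t \<noteq> 0" using e t by auto
      qed (use W mem der U rel_interior_subset[of P] in auto)
      then show ?case using N(3)[OF e(1)] by (simp add: q'_def pp q_def)
    qed
  qed
qed

section \<open>\<open>C\<^sup>k\<close>-maps and \<open>C\<^sup>k\<close>-convergence on convex sets\<close>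

definition uniform_conv ::
  "'e set \<Rightarrow> ('i \<Rightarrow> 'e \<Rightarrow> 'y::locally_convex_space) \<Rightarrow> ('e \<Rightarrow> 'y) \<Rightarrow> 'i filter \<Rightarrow> bool" where
  "uniform_conv P u f F \<longleftrightarrow> (\<forall>V. open V \<longrightarrow> 0 \<in> V \<longrightarrow> (\<forall>\<^sub>F i in F. \<forall>x\<in>P. u i x - f x \<in> V))"

text \<open>Only single directions are involved. On a convex \<open>P\<close>, continuity jointly in
  point and directions is a consequence: derivatives are linear in the direction and
  \<open>dirs P\<close> has finite dimension. As 0 is a direction, continuity of \<open>f\<close> is
  included at every order.\<close>

primrec Ck :: "nat \<Rightarrow> 'e::euclidean_space set \<Rightarrow> ('e \<Rightarrow> 'y::locally_convex_space) \<Rightarrow> bool" where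
  "Ck 0 P f \<longleftrightarrow> continuous_on P f"
| "Ck (Suc k) P f \<longleftrightarrow> (\<forall>y\<in>dirs P. \<exists>g. has_dd P y f g \<and> Ck k P g)"

text \<open>The derivatives of the net are existentially quantified, so that sums, products and
  affine substitutions are treated by exhibiting theirs. For the filter \<open>bot\<close> nothing
  is asked of \<open>u\<close>, and what remains is \<open>Ck k P f\<close>.\<close>

primrec Ck_conv ::
  "nat \<Rightarrow> 'e::euclidean_space set \<Rightarrow> ('i \<Rightarrow> 'e \<Rightarrow> 'y::locally_convex_space) \<Rightarrow> ('e \<Rightarrow> 'y) \<Rightarrow> 'i filter \<Rightarrow> bool" where
  "Ck_conv 0 P u f F \<longleftrightarrow> continuous_on P f \<and> uniform_conv P u f F"
| "Ck_conv (Suc k) P u f F \<longleftrightarrow> uniform_conv P u f F \<and>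
     (\<forall>y\<in>dirs P. \<exists>g h. has_dd P y f h \<and> (\<forall>\<^sub>F i in F. has_dd P y (u i) (g i)) \<and> Ck_conv k P g h F)"

lemma zero_in_dirs: "0 \<in> dirs P"
  by (rule subspace_0[OF subspace_dirs])

lemma Ck_imp_continuous_on: "Ck k P f \<Longrightarrow> continuous_on P f"
  using zero_in_dirs[of P] by (cases k; simp add: has_dd_def; blast)

lemma Ck_conv_imp_continuous_on: "Ck_conv k P u f F \<Longrightarrow> continuous_on P f"
  using zero_in_dirs[of P] by (cases k; simp add: has_dd_def; blast)

lemma Ck_conv_imp_uniform: "Ck_conv k P u f F \<Longrightarrow> uniform_conv P u f F"
  by (cases k) auto

lemma Ck_cong:
  assumes "\<And>x. x \<in> P \<Longrightarrow> f x = g x"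
  shows "Ck k P f \<longleftrightarrow> Ck k P g"
proof (cases k)
  case 0
  then show ?thesis using continuous_on_cong[OF refl, of P f g] assms by simp
next
  case (Suc j)
  have "has_dd P y f h \<longleftrightarrow> has_dd P y g h" for y h
    using assms by (intro has_dd_cong) auto
  then show ?thesis by (simp add: Suc)
qed

lemma uniform_conv_cong:
  fixes f :: "'e \<Rightarrow> 'y::locally_convex_space"
  assumes "\<forall>\<^sub>F i in F. \<forall>x\<in>P. u i x = u' i x" "\<And>x. x \<in> P \<Longrightarrow> f x = f' x" "uniform_conv P u f F"
  shows "uniform_conv P u' f' F"
  unfolding uniform_conv_def
proof (intro allI impI)
  fix V :: "'y set" assume "open V" "0 \<in> V"
  then have "\<forall>\<^sub>F i in F. \<forall>x\<in>P. u i x - f x \<in> V" using assms(3) by (simp add: uniform_conv_def)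
  with assms(1) show "\<forall>\<^sub>F i in F. \<forall>x\<in>P. u' i x - f' x \<in> V"
    by eventually_elim (use assms(2) in auto)
qed

lemma Ck_conv_cong:
  assumes u: "\<forall>\<^sub>F i in F. \<forall>x\<in>P. u i x = u' i x" and f: "\<And>x. x \<in> P \<Longrightarrow> f x = f' x"
    and conv: "Ck_conv k P u f F"
  shows "Ck_conv k P u' f' F"
proof (cases k)
  case 0
  then show ?thesis
    using conv f continuous_on_cong[OF refl, of P f f'] uniform_conv_cong[OF u, of f f'] by auto
next
  case (Suc j)
  have "\<exists>g h. has_dd P y f' h \<and> (\<forall>\<^sub>F i in F. has_dd P y (u' i) (g i)) \<and> Ck_conv j P g h F"
    if y: "y \<in> dirs P" for y
  proof -
    obtain g h where gh: "has_dd P y f h" "\<forall>\<^sub>F i in F. has_dd P y (u i) (g i)" "Ck_conv j P g h F"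
      using conv y by (auto simp: Suc)
    have "has_dd P y f' h" using gh(1) has_dd_cong[of P f f' h h y] f by simp
    moreover have "\<forall>\<^sub>F i in F. has_dd P y (u' i) (g i)"
      using gh(2) u
    proof eventually_elim
      case (elim i)
      then show ?case using has_dd_cong[of P "u i" "u' i" "g i" "g i" y] by simp
    qed
    ultimately show ?thesis using gh(3) by blast
  qed
  then show ?thesis using conv uniform_conv_cong[OF u, of f f'] f by (auto simp: Suc)
qed

lemma Ck_conv_SucD: "Ck_conv (Suc k) P u f F \<Longrightarrow> Ck_conv k P u f F"
proof (induction k arbitrary: u f)
  case 0
  then show ?case using Ck_conv_imp_continuous_on[OF 0] by simp
next
  case (Suc k)
  show ?case
    unfolding Ck_conv.simps(2)[of k]
  proof (intro conjI ballI)
    show "uniform_conv P u f F" using Suc.prems by simp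
    fix y assume y: "y \<in> dirs P"
    then obtain g h where "has_dd P y f h" "\<forall>\<^sub>F i in F. has_dd P y (u i) (g i)" "Ck_conv (Suc k) P g h F"
      using Suc.prems by (auto simp only: Ck_conv.simps(2)[of "Suc k"])
    then show "\<exists>g h. has_dd P y f h \<and> (\<forall>\<^sub>F i in F. has_dd P y (u i) (g i)) \<and> Ck_conv k P g h F"
      using Suc.IH by blast
  qed
qed

lemma Ck_conv_imp_Ck: "Ck_conv k P u f F \<Longrightarrow> Ck k P f"
proof (induction k arbitrary: u f)
  case (Suc k)
  show ?case
    unfolding Ck.simps
  proof
    fix y assume "y \<in> dirs P"
    then obtain g h where "has_dd P y f h" "Ck_conv k P g h F" using Suc.prems by auto
    then show "\<exists>g. has_dd P y f g \<and> Ck k P g" using Suc.IH by blast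
  qed
qed simp

lemma uniform_conv_const: "uniform_conv P (\<lambda>_. f) f F"
  by (auto simp: uniform_conv_def)

text \<open>Together with \<open>Ck_conv_imp_Ck\<close> this transfers each closure property from
  convergence to single maps, with \<open>bot\<close> as the filter.\<close>

lemma Ck_conv_const: "Ck k P f \<Longrightarrow> Ck_conv k P (\<lambda>_. f) f F"
proof (induction k arbitrary: f)
  case (Suc k)
  have "\<exists>g h. has_dd P y f h \<and> (\<forall>\<^sub>F i in F. has_dd P y f (g i)) \<and> Ck_conv k P g h F" if y: "y \<in> dirs P" for y
  proof -
    obtain h where "has_dd P y f h" "Ck k P h" using Suc.prems y by auto
    then show ?thesis using Suc.IH[of h] by (intro exI[of _ "\<lambda>_. h"] exI[of _ h]) auto
  qed
  then show ?case by (auto simp: uniform_conv_const)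
qed (auto simp: uniform_conv_const)

lemma Ck_SucD: "Ck (Suc k) P f \<Longrightarrow> Ck k P f"
  using Ck_conv_imp_Ck[OF Ck_conv_SucD[OF Ck_conv_const[of "Suc k" P f "bot :: unit filter"]]] .

lemma Ck_le: "j \<le> k \<Longrightarrow> Ck k P f \<Longrightarrow> Ck j P f"
  by (induction rule: dec_induct) (auto dest: Ck_SucD simp del: Ck.simps)

section \<open>Constants, sums and products\<close>

lemma has_dd_const: "has_dd P y (\<lambda>_. c) (\<lambda>_. 0)"
  by (auto simp: has_dd_def has_line_deriv_def)

lemma Ck_const: "Ck k P (\<lambda>_. c)"
proof (induction k arbitrary: c)
  case (Suc k)
  then show ?case using has_dd_const unfolding Ck.simps by blast
qed simp

lemma has_dd_add:
  assumes "has_dd P y f f'" "has_dd P y g g'"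
  shows "has_dd P y (\<lambda>x. f x + g x) (\<lambda>x. f' x + g' x)"
  unfolding has_dd_def
proof (intro conjI ballI)
  fix x assume x: "x \<in> P"
  have "((\<lambda>t. (1 / t) *\<^sub>R (f (x + t *\<^sub>R y) - f x) + (1 / t) *\<^sub>R (g (x + t *\<^sub>R y) - g x)) \<longlongrightarrow> f' x + g' x)
      (at 0 within {t. x + t *\<^sub>R y \<in> P})"
    using assms x by (intro tendsto_add) (auto simp: has_dd_def has_line_deriv_def)
  then show "has_line_deriv P y (\<lambda>x. f x + g x) x (f' x + g' x)"
    unfolding has_line_deriv_def scaleR_add_right[symmetric] by (simp add: algebra_simps)
qed (use assms in \<open>auto simp: has_dd_def intro!: continuous_on_add\<close>)

lemma has_dd_mult:
  fixes f :: "'e::euclidean_space \<Rightarrow> 'y::locally_convex_space" and h :: "'e \<Rightarrow> real"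
  assumes h: "has_dd P y h h'" and f: "has_dd P y f f'"
  shows "has_dd P y (\<lambda>x. h x *\<^sub>R f x) (\<lambda>x. h x *\<^sub>R f' x + h' x *\<^sub>R f x)"
  unfolding has_dd_def
proof (intro conjI ballI)
  fix x assume x: "x \<in> P"
  let ?F = "at 0 within {t. x + t *\<^sub>R y \<in> P}"
  have "((\<lambda>t. x + t *\<^sub>R y) \<longlongrightarrow> x + 0 *\<^sub>R y) ?F" by (intro tendsto_intros)
  then have "((\<lambda>t. h (x + t *\<^sub>R y)) \<longlongrightarrow> h (x + 0 *\<^sub>R y)) ?F"
    by (rule continuous_on_tendsto_compose[of P h, rotated])
      (use h x in \<open>auto simp: has_dd_def eventually_at_filter\<close>)
  then have "((\<lambda>t. h (x + t *\<^sub>R y)) \<longlongrightarrow> h x) ?F" by simp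
  moreover have "((\<lambda>t. (1 / t) *\<^sub>R (f (x + t *\<^sub>R y) - f x)) \<longlongrightarrow> f' x) ?F"
      "((\<lambda>t. (1 / t) *\<^sub>R (h (x + t *\<^sub>R y) - h x)) \<longlongrightarrow> h' x) ?F"
    using f h x by (auto simp: has_dd_def has_line_deriv_def)
  ultimately have "((\<lambda>t. h (x + t *\<^sub>R y) *\<^sub>R ((1 / t) *\<^sub>R (f (x + t *\<^sub>R y) - f x)) +
        ((1 / t) *\<^sub>R (h (x + t *\<^sub>R y) - h x)) *\<^sub>R f x) \<longlongrightarrow> h x *\<^sub>R f' x + h' x *\<^sub>R f x) ?F"
    by (intro tendsto_add tendsto_scaleR_lcs tendsto_const)
  moreover have "h (x + t *\<^sub>R y) *\<^sub>R ((1 / t) *\<^sub>R (f (x + t *\<^sub>R y) - f x)) +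
        ((1 / t) *\<^sub>R (h (x + t *\<^sub>R y) - h x)) *\<^sub>R f x =
      (1 / t) *\<^sub>R (h (x + t *\<^sub>R y) *\<^sub>R f (x + t *\<^sub>R y) - h x *\<^sub>R f x)" for t
    by (simp add: scaleR_diff_left scaleR_diff_right diff_divide_distrib mult.commute)
  ultimately show "has_line_deriv P y (\<lambda>x. h x *\<^sub>R f x) x (h x *\<^sub>R f' x + h' x *\<^sub>R f x)"
    unfolding has_line_deriv_def by simp
qed (use assms in \<open>auto simp: has_dd_def intro!: continuous_on_add continuous_on_scaleR_lcs\<close>)

lemma uniform_conv_add:
  fixes f :: "'e \<Rightarrow> 'y::locally_convex_space"
  assumes "uniform_conv P u f F" "uniform_conv P v g F"
  shows "uniform_conv P (\<lambda>i x. u i x + v i x) (\<lambda>x. f x + g x) F"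
  unfolding uniform_conv_def
proof (intro allI impI)
  fix V :: "'y set" assume V: "open V" "0 \<in> V"
  obtain N where N: "open N" "0 \<in> N" "\<And>x y. x \<in> N \<Longrightarrow> y \<in> N \<Longrightarrow> x + y \<in> V"
    "\<And>x. x \<in> N \<Longrightarrow> - x \<in> N" "convex N"
    by (rule nhd_0_add[OF V]) (rule that)
  have "\<forall>\<^sub>F i in F. \<forall>x\<in>P. u i x - f x \<in> N" "\<forall>\<^sub>F i in F. \<forall>x\<in>P. v i x - g x \<in> N"
    using assms N by (auto simp: uniform_conv_def)
  then show "\<forall>\<^sub>F i in F. \<forall>x\<in>P. u i x + v i x - (f x + g x) \<in> V"
  proof eventually_elim
    case (elim i)
    show ?case
    proof
      fix x assume "x \<in> P"
      then have "(u i x - f x) + (v i x - g x) \<in> V" using elim N(3) by blast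
      then show "u i x + v i x - (f x + g x) \<in> V" by (simp add: algebra_simps)
    qed
  qed
qed

lemma Ck_conv_add:
  assumes "Ck_conv k P u f F" "Ck_conv k P v g F"
  shows "Ck_conv k P (\<lambda>i x. u i x + v i x) (\<lambda>x. f x + g x) F"
  using assms
proof (induction k arbitrary: u f v g)
  case 0
  then show ?case by (auto intro: continuous_on_add uniform_conv_add)
next
  case (Suc k)
  have "\<exists>g' h. has_dd P y (\<lambda>x. f x + g x) h \<and> (\<forall>\<^sub>F i in F. has_dd P y (\<lambda>x. u i x + v i x) (g' i)) \<and> Ck_conv k P g' h F"
    if y: "y \<in> dirs P" for y
  proof -
    obtain u' f' where 1: "has_dd P y f f'" "\<forall>\<^sub>F i in F. has_dd P y (u i) (u' i)" "Ck_conv k P u' f' F"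
      using Suc.prems(1) y by auto
    obtain v' g' where 2: "has_dd P y g g'" "\<forall>\<^sub>F i in F. has_dd P y (v i) (v' i)" "Ck_conv k P v' g' F"
      using Suc.prems(2) y by auto
    have "\<forall>\<^sub>F i in F. has_dd P y (\<lambda>x. u i x + v i x) (\<lambda>x. u' i x + v' i x)"
      using 1(2) 2(2) by eventually_elim (rule has_dd_add)
    then show ?thesis using has_dd_add[OF 1(1) 2(1)] Suc.IH[OF 1(3) 2(3)]
      by (intro exI[of _ "\<lambda>i x. u' i x + v' i x"] exI[of _ "\<lambda>x. f' x + g' x"] conjI)
  qed
  then show ?case using Suc.prems by (auto intro: uniform_conv_add)
qed

text \<open>A continuous factor is bounded on the compact set \<open>P\<close>, and
  \<open>nhd_0_scale\<close> absorbs a bounded factor.\<close>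

lemma uniform_conv_mult:
  fixes h :: "'e::topological_space \<Rightarrow> real" and f :: "'e \<Rightarrow> 'y::locally_convex_space"
  assumes "compact P" "continuous_on P h" "uniform_conv P u f F"
  shows "uniform_conv P (\<lambda>i x. h x *\<^sub>R u i x) (\<lambda>x. h x *\<^sub>R f x) F"
  unfolding uniform_conv_def
proof (intro allI impI)
  fix V :: "'y set" assume V: "open V" "0 \<in> V"
  have "bounded (h ` P)" using assms compact_continuous_image compact_imp_bounded by blast
  then obtain B where B: "\<And>x. x \<in> P \<Longrightarrow> \<bar>h x\<bar> \<le> B" unfolding bounded_iff by auto
  obtain N where N: "open N" "0 \<in> N" "\<And>c x. \<bar>c\<bar> \<le> B \<Longrightarrow> x \<in> N \<Longrightarrow> c *\<^sub>R x \<in> V"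
    by (rule nhd_0_scale[OF V]) (rule that)
  have "\<forall>\<^sub>F i in F. \<forall>x\<in>P. u i x - f x \<in> N" using assms N by (auto simp: uniform_conv_def)
  then show "\<forall>\<^sub>F i in F. \<forall>x\<in>P. h x *\<^sub>R u i x - h x *\<^sub>R f x \<in> V"
    by eventually_elim (use N(3) B in \<open>auto simp: scaleR_diff_right[symmetric]\<close>)
qed

lemma Ck_conv_mult:
  fixes h :: "'e::euclidean_space \<Rightarrow> real"
  assumes "compact P" "Ck k P h" "Ck_conv k P u f F"
  shows "Ck_conv k P (\<lambda>i x. h x *\<^sub>R u i x) (\<lambda>x. h x *\<^sub>R f x) F"
  using assms(2,3)
proof (induction k arbitrary: u f h)
  case 0
  then show ?case using assms(1) by (auto intro: continuous_on_scaleR_lcs uniform_conv_mult)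
next
  case (Suc k)
  have "\<exists>g' f'. has_dd P y (\<lambda>x. h x *\<^sub>R f x) f' \<and> (\<forall>\<^sub>F i in F. has_dd P y (\<lambda>x. h x *\<^sub>R u i x) (g' i)) \<and> Ck_conv k P g' f' F"
    if y: "y \<in> dirs P" for y
  proof -
    obtain u' f' where 1: "has_dd P y f f'" "\<forall>\<^sub>F i in F. has_dd P y (u i) (u' i)" "Ck_conv k P u' f' F"
      using Suc.prems(2) y by auto
    obtain h' where 2: "has_dd P y h h'" "Ck k P h'"
      using Suc.prems(1) y by auto
    have "Ck_conv k P (\<lambda>i x. h x *\<^sub>R u' i x) (\<lambda>x. h x *\<^sub>R f' x) F"
      by (rule Suc.IH[OF Ck_SucD[OF Suc.prems(1)] 1(3)])
    moreover have "Ck_conv k P (\<lambda>i x. h' x *\<^sub>R u i x) (\<lambda>x. h' x *\<^sub>R f x) F"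
      by (rule Suc.IH[OF 2(2) Ck_conv_SucD[OF Suc.prems(2)]])
    ultimately have "Ck_conv k P (\<lambda>i x. h x *\<^sub>R u' i x + h' x *\<^sub>R u i x) (\<lambda>x. h x *\<^sub>R f' x + h' x *\<^sub>R f x) F"
      by (rule Ck_conv_add)
    moreover have "\<forall>\<^sub>F i in F. has_dd P y (\<lambda>x. h x *\<^sub>R u i x) (\<lambda>x. h x *\<^sub>R u' i x + h' x *\<^sub>R u i x)"
      using 1(2) by eventually_elim (rule has_dd_mult[OF 2(1)])
    ultimately show ?thesis using has_dd_mult[OF 2(1) 1(1)]
      by (intro exI[of _ "\<lambda>i x. h x *\<^sub>R u' i x + h' x *\<^sub>R u i x"] exI[of _ "\<lambda>x. h x *\<^sub>R f' x + h' x *\<^sub>R f x"] conjI)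
  qed
  moreover have "uniform_conv P (\<lambda>i x. h x *\<^sub>R u i x) (\<lambda>x. h x *\<^sub>R f x) F"
    using uniform_conv_mult[OF assms(1) Ck_imp_continuous_on[OF Suc.prems(1)]] Suc.prems(2) by auto
  ultimately show ?case by auto
qed

lemma Ck_conv_sum:
  assumes "finite S" "\<And>s. s \<in> S \<Longrightarrow> Ck_conv k P (u s) (f s) F"
  shows "Ck_conv k P (\<lambda>i x. \<Sum>s\<in>S. u s i x) (\<lambda>x. \<Sum>s\<in>S. f s x) F"
  using assms
proof (induction S)
  case empty
  then show ?case using Ck_conv_const[OF Ck_const, of k P 0 F] by simp
next
  case (insert s S)
  then show ?case using Ck_conv_add[of k P "u s" "f s" F] by simp
qed

lemma Ck_add:
  assumes "Ck k P f" "Ck k P g"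
  shows "Ck k P (\<lambda>x. f x + g x)"
  by (rule Ck_conv_imp_Ck[OF Ck_conv_add[OF assms[THEN Ck_conv_const[where F = "bot :: unit filter"]]]])

lemma Ck_mult:
  fixes h :: "'e::euclidean_space \<Rightarrow> real"
  assumes "compact P" "Ck k P h" "Ck k P f"
  shows "Ck k P (\<lambda>x. h x *\<^sub>R f x)"
  by (rule Ck_conv_imp_Ck[OF Ck_conv_mult[OF assms(1,2) assms(3)[THEN Ck_conv_const[where F = "bot :: unit filter"]]]])

lemma Ck_sum:
  assumes "finite S" "\<And>s. s \<in> S \<Longrightarrow> Ck k P (f s)"
  shows "Ck k P (\<lambda>x. \<Sum>s\<in>S. f s x)"
  by (rule Ck_conv_imp_Ck[OF Ck_conv_sum[OF assms(1) assms(2)[THEN Ck_conv_const[where F = "bot :: unit filter"]]]])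

section \<open>Composition with affine maps and restriction\<close>

lemma has_dd_affine_comp:
  assumes L: "linear L" and maps: "(\<lambda>x. a + L x) ` Q \<subseteq> P" and dd: "has_dd P (L y) f g"
  shows "has_dd Q y (\<lambda>x. f (a + L x)) (\<lambda>x. g (a + L x))"
proof -
  have cont: "continuous_on Q (\<lambda>x. a + L x)"
    using linear_continuous_on[of L Q] L linear_conv_bounded_linear by (intro continuous_intros) blast
  have "has_line_deriv Q y (\<lambda>x. f (a + L x)) x (g (a + L x))" if x: "x \<in> Q" for x
  proof -
    have eq: "a + L (x + t *\<^sub>R y) = a + L x + t *\<^sub>R L y" for t
      by (simp add: linear_add[OF L] linear_scale[OF L])
    \<comment> \<open>Points of the line in \<open>Q\<close> are carried to points of the line in
      \<open>P\<close>, so the limit for \<open>Q\<close> runs over a subset of the parameters for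
      \<open>P\<close>, whatever the dimensions of the two sets.\<close>
    have "{t. x + t *\<^sub>R y \<in> Q} \<subseteq> {t. a + L x + t *\<^sub>R L y \<in> P}"
      using maps by (auto simp: eq[symmetric])
    moreover have "has_line_deriv P (L y) f (a + L x) (g (a + L x))"
      using dd maps x by (auto simp: has_dd_def)
    ultimately show ?thesis
      unfolding has_line_deriv_def eq by (rule tendsto_within_subset[rotated])
  qed
  moreover have "continuous_on Q (\<lambda>x. f (a + L x))" "continuous_on Q (\<lambda>x. g (a + L x))"
    using dd maps by (auto simp: has_dd_def intro: continuous_on_compose2[OF _ cont])
  ultimately show ?thesis by (auto simp: has_dd_def)
qed

lemma linear_in_dirs:
  assumes L: "linear L" and maps: "(\<lambda>x. a + L x) ` Q \<subseteq> P" and y: "y \<in> dirs Q"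
  shows "L y \<in> dirs P"
proof -
  have "L y \<in> span (L ` {x - y | x y. x \<in> Q \<and> y \<in> Q})"
    using y unfolding dirs_def span_linear_image[OF L] by blast
  moreover have "L ` {x - y | x y. x \<in> Q \<and> y \<in> Q} \<subseteq> dirs P"
  proof clarify
    fix u v assume "u \<in> Q" "v \<in> Q"
    then have "(a + L u) - (a + L v) \<in> dirs P" using maps by (intro diff_in_dirs) auto
    then show "L (u - v) \<in> dirs P" by (simp add: linear_diff[OF L])
  qed
  ultimately show ?thesis using span_minimal[OF _ subspace_dirs] by blast
qed

lemma uniform_conv_image:
  fixes f :: "'e \<Rightarrow> 'y::locally_convex_space"
  assumes "\<pi> ` Q \<subseteq> P" "uniform_conv P u f F"
  shows "uniform_conv Q (\<lambda>i x. u i (\<pi> x)) (\<lambda>x. f (\<pi> x)) F"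
  unfolding uniform_conv_def
proof (intro allI impI)
  fix V :: "'y set" assume "open V" "0 \<in> V"
  then have "\<forall>\<^sub>F i in F. \<forall>x\<in>P. u i x - f x \<in> V" using assms by (simp add: uniform_conv_def)
  then show "\<forall>\<^sub>F i in F. \<forall>x\<in>Q. u i (\<pi> x) - f (\<pi> x) \<in> V"
    by eventually_elim (use assms(1) in blast)
qed

text \<open>Serves twice: with the identity it restricts maps to faces, with the projection onto a
  face it pulls the data on this face back to a neighbourhood in \<open>M\<close>.\<close>

lemma Ck_conv_affine_comp:
  assumes L: "linear L" and maps: "(\<lambda>x. a + L x) ` Q \<subseteq> P" and conv: "Ck_conv k P u f F"
  shows "Ck_conv k Q (\<lambda>i x. u i (a + L x)) (\<lambda>x. f (a + L x)) F"
  using conv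
proof (induction k arbitrary: u f)
  case 0
  have cont: "continuous_on Q (\<lambda>x. a + L x)"
    using linear_continuous_on[of L Q] L linear_conv_bounded_linear by (intro continuous_intros) blast
  have "uniform_conv Q (\<lambda>i x. u i (a + L x)) (\<lambda>x. f (a + L x)) F"
    using uniform_conv_image[OF maps] 0 by auto
  then show ?case using 0 maps by (auto intro: continuous_on_compose2[OF _ cont])
next
  case (Suc k)
  have "\<exists>g h. has_dd Q y (\<lambda>x. f (a + L x)) h \<and> (\<forall>\<^sub>F i in F. has_dd Q y (\<lambda>x. u i (a + L x)) (g i)) \<and> Ck_conv k Q g h F"
    if y: "y \<in> dirs Q" for y
  proof -
    obtain u' f' where 1: "has_dd P (L y) f f'" "\<forall>\<^sub>F i in F. has_dd P (L y) (u i) (u' i)" "Ck_conv k P u' f' F"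
      using Suc.prems(1) linear_in_dirs[OF L maps y] by auto
    have "\<forall>\<^sub>F i in F. has_dd Q y (\<lambda>x. u i (a + L x)) (\<lambda>x. u' i (a + L x))"
      using 1(2) by eventually_elim (rule has_dd_affine_comp[OF L maps])
    then show ?thesis using has_dd_affine_comp[OF L maps 1(1)] Suc.IH[OF 1(3)]
      by (intro exI[of _ "\<lambda>i x. u' i (a + L x)"] exI[of _ "\<lambda>x. f' (a + L x)"] conjI)
  qed
  moreover have "uniform_conv Q (\<lambda>i x. u i (a + L x)) (\<lambda>x. f (a + L x)) F"
    using uniform_conv_image[OF maps] Suc.prems by auto
  ultimately show ?case by auto
qed

lemma Ck_conv_subset: "Q \<subseteq> P \<Longrightarrow> Ck_conv k P u f F \<Longrightarrow> Ck_conv k Q u f F"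
  using Ck_conv_affine_comp[OF linear_id[unfolded id_def], of 0 Q P] by simp

lemma Ck_subset: "Q \<subseteq> P \<Longrightarrow> Ck k P f \<Longrightarrow> Ck k Q f"
  using Ck_conv_imp_Ck[OF Ck_conv_subset[OF _ Ck_conv_const, of Q P k f "bot :: unit filter"]] .

section \<open>Extension by zero of maps that vanish near the rim of a ball\<close>

definition extend_by_zero :: "'e set \<Rightarrow> ('e \<Rightarrow> 'y::zero) \<Rightarrow> 'e \<Rightarrow> 'y" where
  "extend_by_zero Q f = (\<lambda>x. if x \<in> Q then f x else 0)"

text \<open>Contracting towards \<open>p\<close> brings every point of \<open>P\<close> into the
  ball without changing its direction from \<open>p\<close>.\<close>

lemma dirs_Int_cball:
  assumes "convex P" "p \<in> P" "e > 0"
  shows "dirs (P \<inter> cball p e) = dirs P"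
proof
  show "dirs (P \<inter> cball p e) \<subseteq> dirs P" by (rule dirs_mono) auto
  have *: "x - p \<in> dirs (P \<inter> cball p e)" if x: "x \<in> P" for x
  proof -
    \<comment> \<open>The summand 1 avoids division by zero for \<open>x = p\<close>; the minimum
      keeps the new point on the segment from \<open>p\<close> to \<open>x\<close>.\<close>
    define t where "t = min 1 (e / (norm (x - p) + 1))"
    have t: "0 < t" "t \<le> 1" using assms by (auto simp: t_def add_nonneg_pos)
    have "t * norm (x - p) \<le> e / (norm (x - p) + 1) * norm (x - p)"
      by (intro mult_right_mono) (auto simp: t_def)
    also have "\<dots> \<le> e"
    proof -
      have "norm (x - p) / (norm (x - p) + 1) \<le> 1" by (simp add: add_nonneg_pos)
      then have "e * (norm (x - p) / (norm (x - p) + 1)) \<le> e * 1"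
        using assms(3) by (intro mult_left_mono) auto
      then show ?thesis by simp
    qed
    finally have te: "t * norm (x - p) \<le> e" .
    have "(1 - t) *\<^sub>R p + t *\<^sub>R x \<in> P"
      by (rule convexD[OF assms(1)]) (use assms x t in auto)
    moreover have "(1 - t) *\<^sub>R p + t *\<^sub>R x = p + t *\<^sub>R (x - p)" by (simp add: algebra_simps)
    ultimately have "p + t *\<^sub>R (x - p) \<in> P \<inter> cball p e" using te t by (simp add: dist_norm)
    then have "(p + t *\<^sub>R (x - p)) - p \<in> dirs (P \<inter> cball p e)"
      by (rule diff_in_dirs) (use assms in auto)
    then have "t *\<^sub>R (x - p) \<in> dirs (P \<inter> cball p e)" by simp
    then have "(1 / t) *\<^sub>R (t *\<^sub>R (x - p)) \<in> dirs (P \<inter> cball p e)"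
      by (rule subspace_scale[OF subspace_dirs])
    moreover have "(1 / t) *\<^sub>R (t *\<^sub>R (x - p)) = x - p" using t by simp
    ultimately show ?thesis by simp
  qed
  show "dirs P \<subseteq> dirs (P \<inter> cball p e)"
    unfolding dirs_def[of P]
  proof (rule span_minimal; clarsimp)
    fix x y assume xy: "x \<in> P" "y \<in> P"
    have "(x - p) - (y - p) \<in> dirs (P \<inter> cball p e)"
      by (rule subspace_diff[OF subspace_dirs *[OF xy(1)] *[OF xy(2)]])
    then show "x - y \<in> dirs (P \<inter> cball p e)" by simp
  qed
qed

lemma extend_by_zero_local:
  assumes r: "r < e" and f: "\<And>x. x \<in> P \<inter> cball p e - cball p r \<Longrightarrow> f x = 0"
  shows "x \<in> P \<Longrightarrow> x \<in> - cball p r \<Longrightarrow> extend_by_zero (P \<inter> cball p e) f x = 0"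
    "x \<in> P \<Longrightarrow> x \<in> ball p e \<Longrightarrow> extend_by_zero (P \<inter> cball p e) f x = f x"
  using f by (auto simp: extend_by_zero_def)

lemma continuous_on_extend_by_zero:
  fixes f :: "'e::euclidean_space \<Rightarrow> 'y::locally_convex_space"
  assumes r: "r < e" and f: "\<And>x. x \<in> P \<inter> cball p e - cball p r \<Longrightarrow> f x = 0"
    and cf: "continuous_on (P \<inter> cball p e) f"
  shows "continuous_on P (extend_by_zero (P \<inter> cball p e) f)"
proof -
  have 1: "continuous_on (P \<inter> ball p e) (extend_by_zero (P \<inter> cball p e) f)"
    using continuous_on_subset[OF cf, of "P \<inter> ball p e"]
    by (rule continuous_on_eq) (auto simp: extend_by_zero_def)
  have 2: "continuous_on (P \<inter> - cball p r) (extend_by_zero (P \<inter> cball p e) f)"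
    using continuous_on_const[of "P \<inter> - cball p r" 0]
    by (rule continuous_on_eq) (use extend_by_zero_local(1)[OF r f] in auto)
  have eq: "P = (P \<inter> ball p e) \<union> (P \<inter> - cball p r)" using r by auto
  have "openin (top_of_set P) (P \<inter> ball p e)" "openin (top_of_set P) (P \<inter> - cball p r)"
    by (auto intro!: openin_open_Int)
  then have "continuous_on ((P \<inter> ball p e) \<union> (P \<inter> - cball p r)) (extend_by_zero (P \<inter> cball p e) f)"
    by (intro continuous_on_Un_local_open 1 2) (use eq in auto)
  then show ?thesis using eq by simp
qed

text \<open>Inside \<open>ball p e\<close> the sets \<open>P\<close> and
  \<open>P \<inter> cball p e\<close> agree locally, and off \<open>cball p r\<close> the extended
  map is zero. The second claim feeds the induction on the order: the derivative vanishes off the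
  smaller ball too, by local uniqueness against the zero map.\<close>

lemma has_dd_extend_by_zero:
  fixes f :: "'e::euclidean_space \<Rightarrow> 'y::locally_convex_space"
  assumes P: "convex P" and pe: "p \<in> P" "0 < e" and r: "r < e"
    and y: "y \<in> dirs P"
    and f: "\<And>x. x \<in> P \<inter> cball p e - cball p r \<Longrightarrow> f x = 0"
    and dd: "has_dd (P \<inter> cball p e) y f g"
  shows "has_dd P y (extend_by_zero (P \<inter> cball p e) f) (extend_by_zero (P \<inter> cball p e) g)"
    and "\<And>x. x \<in> P \<inter> cball p e - cball p r \<Longrightarrow> g x = 0"
proof -
  let ?Q = "P \<inter> cball p e"
  let ?z = "extend_by_zero ?Q"
  show g: "g x = 0" if "x \<in> ?Q - cball p r" for x
  proof (rule has_dd_unique_local[OF _ _ dd has_dd_const[of _ y 0], of "- cball p r" x])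
    show "convex ?Q" using P by (intro convex_Int) auto
    show "y \<in> dirs ?Q" using dirs_Int_cball[OF P pe] y by simp
  qed (use that f in auto)
  have "has_line_deriv P y (?z f) x (?z g x)" if x: "x \<in> P" for x
  proof (cases "x \<in> ball p e")
    case True
    then have xQ: "x \<in> ?Q" using x by auto
    have "has_line_deriv ?Q y f x (g x)" using dd xQ by (simp add: has_dd_def)
    then have "((\<lambda>t. (1 / t) *\<^sub>R (f (x + t *\<^sub>R y) - f x)) \<longlongrightarrow> g x) (at 0 within {t. x + t *\<^sub>R y \<in> ?Q})"
      by (simp only: has_line_deriv_def)
    moreover have "at 0 within {t. x + t *\<^sub>R y \<in> ?Q} = at 0 within {t. x + t *\<^sub>R y \<in> P}"
    proof -
      have "continuous_on UNIV (\<lambda>t::real. x + t *\<^sub>R y)" by (intro continuous_intros)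
      then have "open ((\<lambda>t::real. x + t *\<^sub>R y) -` ball p e)" using open_vimage[OF open_ball] by blast
      then show ?thesis using True by (intro at_within_nhd[of _ "(\<lambda>t. x + t *\<^sub>R y) -` ball p e"]) auto
    qed
    ultimately have "has_line_deriv P y f x (g x)" by (simp only: has_line_deriv_def)
    then have "has_line_deriv P y (?z f) x (g x)"
      by (rule has_line_deriv_cong_local[OF _ open_ball True]) (use xQ in \<open>auto simp: extend_by_zero_def\<close>)
    then show ?thesis using xQ by (simp add: extend_by_zero_def)
  next
    case False
    then have x': "x \<in> - cball p r" using r by auto
    have "has_line_deriv P y (\<lambda>_. 0) x (0::'y)" by (simp add: has_line_deriv_def)
    then have "has_line_deriv P y (?z f) x 0"
      by (rule has_line_deriv_cong_local[OF _ _ x'])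
        (use extend_by_zero_local(1)[OF r f] x x' in auto)
    then show ?thesis using extend_by_zero_local(1)[OF r g x x'] by simp
  qed
  moreover have "continuous_on P (?z f)" "continuous_on P (?z g)"
    using dd f g r by (auto simp: has_dd_def intro!: continuous_on_extend_by_zero[OF r])
  ultimately show "has_dd P y (?z f) (?z g)" by (simp add: has_dd_def)
qed

lemma uniform_conv_extend_by_zero:
  fixes f :: "'e::metric_space \<Rightarrow> 'y::locally_convex_space"
  assumes "uniform_conv (P \<inter> Q) u f F"
  shows "uniform_conv P (\<lambda>i. extend_by_zero (P \<inter> Q) (u i)) (extend_by_zero (P \<inter> Q) f) F"
  unfolding uniform_conv_def
proof (intro allI impI)
  fix V :: "'y set" assume "open V" "0 \<in> V"
  then have "\<forall>\<^sub>F i in F. \<forall>x\<in>P \<inter> Q. u i x - f x \<in> V" using assms by (simp add: uniform_conv_def)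
  then show "\<forall>\<^sub>F i in F. \<forall>x\<in>P. extend_by_zero (P \<inter> Q) (u i) x - extend_by_zero (P \<inter> Q) f x \<in> V"
    by eventually_elim (use \<open>0 \<in> V\<close> in \<open>auto simp: extend_by_zero_def\<close>)
qed

lemma Ck_conv_extend_by_zero:
  fixes f :: "'e::euclidean_space \<Rightarrow> 'y::locally_convex_space"
  assumes P: "convex P" and pe: "p \<in> P" "0 < e" and r: "r < e"
    and f: "\<And>x. x \<in> P \<inter> cball p e - cball p r \<Longrightarrow> f x = 0"
    and u: "\<forall>\<^sub>F i in F. \<forall>x\<in>P \<inter> cball p e - cball p r. u i x = 0"
    and conv: "Ck_conv k (P \<inter> cball p e) u f F"
  shows "Ck_conv k P (\<lambda>i. extend_by_zero (P \<inter> cball p e) (u i)) (extend_by_zero (P \<inter> cball p e) f) F"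
  using conv f u
proof (induction k arbitrary: u f)
  case 0
  then show ?case by (auto intro!: continuous_on_extend_by_zero[OF r] uniform_conv_extend_by_zero)
next
  case (Suc k)
  let ?z = "extend_by_zero (P \<inter> cball p e)"
  have "\<exists>g h. has_dd P y (?z f) h \<and> (\<forall>\<^sub>F i in F. has_dd P y (?z (u i)) (g i)) \<and> Ck_conv k P g h F"
    if y: "y \<in> dirs P" for y
  proof -
    have "y \<in> dirs (P \<inter> cball p e)" using dirs_Int_cball[OF P pe] y by simp
    then obtain u' f' where 1: "has_dd (P \<inter> cball p e) y f f'"
      "\<forall>\<^sub>F i in F. has_dd (P \<inter> cball p e) y (u i) (u' i)" "Ck_conv k (P \<inter> cball p e) u' f' F"
      using Suc.prems(1) by auto
    note f' = has_dd_extend_by_zero[OF P pe r y Suc.prems(2) 1(1)]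
    have u': "\<forall>\<^sub>F i in F. has_dd P y (?z (u i)) (?z (u' i)) \<and> (\<forall>x\<in>P \<inter> cball p e - cball p r. u' i x = 0)"
      using 1(2) Suc.prems(3)
    proof eventually_elim
      case (elim i)
      have "\<And>x. x \<in> P \<inter> cball p e - cball p r \<Longrightarrow> u i x = 0" using elim by blast
      from has_dd_extend_by_zero[OF P pe r y this elim(1)] show ?case by blast
    qed
    have "Ck_conv k P (\<lambda>i. ?z (u' i)) (?z f') F"
      by (rule Suc.IH[OF 1(3) f'(2)]) (use u' in \<open>auto elim: eventually_mono\<close>)
    then show ?thesis using f'(1) u'
      by (intro exI[of _ "\<lambda>i. ?z (u' i)"] exI[of _ "?z f'"]) (auto elim: eventually_mono)
  qed
  then show ?case using Suc.prems by (auto intro: uniform_conv_extend_by_zero)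
qed

section \<open>Iterated derivatives\<close>

lemma dual_basis:
  fixes B :: "'e::euclidean_space set"
  assumes "independent B"
  obtains c :: "'e \<Rightarrow> 'e \<Rightarrow> real" where "\<And>b. b \<in> B \<Longrightarrow> linear (c b)"
    "\<And>b b'. b \<in> B \<Longrightarrow> b' \<in> B \<Longrightarrow> c b b' = (if b = b' then 1 else 0)"
    "\<And>y. y \<in> span B \<Longrightarrow> (\<Sum>b\<in>B. c b y *\<^sub>R b) = y"
proof -
  have fin: "finite B" using assms by (rule independent_imp_finite)
  have "\<exists>g. linear g \<and> (\<forall>x\<in>B. g x = (if b = x then 1 else 0 :: real))" for b
    by (rule linear_independent_extend[OF assms])
  then obtain c where c: "\<And>b. linear (c b)" "\<And>b x. x \<in> B \<Longrightarrow> c b x = (if b = x then 1 else 0 :: real)"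
    by metis
  have lin: "linear (\<lambda>y. \<Sum>b\<in>B. c b y *\<^sub>R b)"
    by (rule linearI)
      (simp_all add: linear_add[OF c(1)] linear_scale[OF c(1)] scaleR_add_left sum.distrib scaleR_sum_right)
  have "(\<Sum>b\<in>B. c b y *\<^sub>R b) = y" if "y \<in> span B" for y
  proof (rule linear_eq_on_span[OF lin linear_ident _ that])
    fix x assume x: "x \<in> B"
    have "(\<Sum>b\<in>B. c b x *\<^sub>R b) = (\<Sum>b\<in>B. if b = x then b else 0)"
      using x by (intro sum.cong) (auto simp: c(2))
    then show "(\<Sum>b\<in>B. c b x *\<^sub>R b) = x" using x fin by simp
  qed
  then show ?thesis using that[of c] c by blast
qed

text \<open>A fixed choice, so that derivatives can be iterated as functions. Its values off
  \<open>P\<close> are arbitrary, but \<open>has_dd\<close> sees only values on \<open>P\<close>, so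
  maps agreeing on \<open>P\<close> get the same choice (\<open>pd_cong\<close>).\<close>

definition pd :: "'e::euclidean_space set \<Rightarrow> 'e \<Rightarrow> ('e \<Rightarrow> 'y::locally_convex_space) \<Rightarrow> 'e \<Rightarrow> 'y" where
  "pd P y f = (SOME g. has_dd P y f g)"

lemma has_dd_pd: "has_dd P y f g \<Longrightarrow> has_dd P y f (pd P y f)"
  unfolding pd_def by (rule someI[of "has_dd P y f"])

lemma has_dd_pd_eq:
  assumes "convex P" "y \<in> dirs P" "has_dd P y f g" "x \<in> P"
  shows "pd P y f x = g x"
  using has_dd_unique[OF assms(1,2) has_dd_pd[OF assms(3)] assms(3,4)] .

lemma pd_cong: "(\<And>x. x \<in> P \<Longrightarrow> f x = g x) \<Longrightarrow> pd P y f = pd P y g"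
  unfolding pd_def using has_dd_cong[of P f g] by (intro arg_cong[of _ _ Eps] ext) auto

lemma Ck_Suc_pd:
  assumes "convex P" "Ck (Suc k) P f" "y \<in> dirs P"
  shows "has_dd P y f (pd P y f)" "Ck k P (pd P y f)"
proof -
  obtain g where g: "has_dd P y f g" "Ck k P g" using assms by auto
  show "has_dd P y f (pd P y f)" by (rule has_dd_pd[OF g(1)])
  show "Ck k P (pd P y f)"
    using g(2) Ck_cong[of P "pd P y f" g] has_dd_pd_eq[OF assms(1,3) g(1)] by blast
qed

lemma Ck_conv_pd:
  assumes "convex P" "Ck_conv (Suc k) P u f F" "y \<in> dirs P"
  shows "Ck_conv k P (\<lambda>i. pd P y (u i)) (pd P y f) F"
proof -
  obtain g h where gh: "has_dd P y f h" "\<forall>\<^sub>F i in F. has_dd P y (u i) (g i)" "Ck_conv k P g h F"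
    using assms by auto
  show ?thesis
  proof (rule Ck_conv_cong[OF _ _ gh(3)])
    show "\<forall>\<^sub>F i in F. \<forall>x\<in>P. g i x = pd P y (u i) x"
      using gh(2) by eventually_elim (auto simp: has_dd_pd_eq[OF assms(1,3)])
    show "h x = pd P y f x" if "x \<in> P" for x
      using has_dd_pd_eq[OF assms(1,3) gh(1) that] by simp
  qed
qed

primrec iter_pd ::
  "nat \<Rightarrow> 'e::euclidean_space set \<Rightarrow> (nat \<Rightarrow> 'e) \<Rightarrow> ('e \<Rightarrow> 'y::locally_convex_space) \<Rightarrow> 'e \<Rightarrow> 'y" where
  "iter_pd 0 P zs f = f"
| "iter_pd (Suc k) P zs f = iter_pd k P (\<lambda>i. zs (Suc i)) (pd P (zs 0) f)"

text \<open>The recursion of \<open>iter_pd\<close> splits off the innermost derivative, as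
  \<open>Ck\<close> does, whereas \<open>iter_deriv\<close> splits off the outermost one; this
  equation mediates.\<close>

lemma iter_pd_Suc: "iter_pd (Suc k) P zs f = pd P (zs k) (iter_pd k P zs f)"
proof (induction k arbitrary: zs f)
  case (Suc k)
  show ?case using Suc.IH[of "\<lambda>i. zs (Suc i)" "pd P (zs 0) f"] by simp
qed simp

lemma iter_pd_cong_dirs:
  "(\<And>j. j < k \<Longrightarrow> zs j = zs' j) \<Longrightarrow> iter_pd k P zs f = iter_pd k P zs' f"
proof (induction k)
  case (Suc k)
  then have "iter_pd k P zs f = iter_pd k P zs' f" by simp
  then show ?case using Suc.prems unfolding iter_pd_Suc by simp
qed simp

lemma iter_pd_cong: "(\<And>x. x \<in> P \<Longrightarrow> f x = g x) \<Longrightarrow> x \<in> P \<Longrightarrow> iter_pd k P zs f x = iter_pd k P zs g x"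
  by (cases k) (auto simp: pd_cong[of P f g])

lemma Ck_iter_pd:
  assumes "convex P" "Ck (k + j) P f" "\<And>i. i < k \<Longrightarrow> zs i \<in> dirs P"
  shows "Ck j P (iter_pd k P zs f)"
  using assms(2,3)
proof (induction k arbitrary: zs f)
  case (Suc k)
  have "Ck (Suc (k + j)) P f" using Suc.prems(1) by simp
  from Ck_Suc_pd(2)[OF assms(1) this Suc.prems(2)[of 0]] show ?case
    using Suc.IH[of "pd P (zs 0) f" "\<lambda>i. zs (Suc i)"] Suc.prems(2) by simp
qed simp

text \<open>The choice \<open>pd\<close> supplies the derivatives that \<open>Ck_conv\<close> asks
  for, and uniform convergence for each fixed tuple of directions is enough.\<close>

lemma Ck_convI_iter_pd:
  assumes "convex P" "Ck k P f" "\<forall>\<^sub>F i in F. Ck k P (u i)"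
    "\<And>j zs. j \<le> k \<Longrightarrow> (\<And>i. zs i \<in> dirs P) \<Longrightarrow>
      uniform_conv P (\<lambda>i. iter_pd j P zs (u i)) (iter_pd j P zs f) F"
  shows "Ck_conv k P u f F"
  using assms(2-4)
proof (induction k arbitrary: u f)
  case 0
  show ?case using 0(1) 0(3)[of 0 "\<lambda>_. 0"] zero_in_dirs[of P] by simp
next
  case (Suc k)
  have "\<exists>g h. has_dd P y f h \<and> (\<forall>\<^sub>F i in F. has_dd P y (u i) (g i)) \<and> Ck_conv k P g h F" if y: "y \<in> dirs P" for y
  proof (intro exI conjI)
    show "has_dd P y f (pd P y f)" by (rule Ck_Suc_pd(1)[OF assms(1) Suc.prems(1) y])
    show "\<forall>\<^sub>F i in F. has_dd P y (u i) (pd P y (u i))"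
      using Suc.prems(2) by eventually_elim (rule Ck_Suc_pd(1)[OF assms(1) _ y])
    show "Ck_conv k P (\<lambda>i. pd P y (u i)) (pd P y f) F"
    proof (rule Suc.IH)
      show "Ck k P (pd P y f)" by (rule Ck_Suc_pd(2)[OF assms(1) Suc.prems(1) y])
      show "\<forall>\<^sub>F i in F. Ck k P (pd P y (u i))"
        using Suc.prems(2) by eventually_elim (rule Ck_Suc_pd(2)[OF assms(1) _ y])
      fix j and zs :: "nat \<Rightarrow> 'a" assume j: "j \<le> k" and zs: "\<And>i. zs i \<in> dirs P"
      \<comment> \<open>A derivative of order \<open>j\<close> of \<open>pd P y f\<close> is one of
        order \<open>Suc j\<close> of \<open>f\<close>, with \<open>y\<close> put in front of the
        directions.\<close>
      have "uniform_conv P (\<lambda>i. iter_pd (Suc j) P (case_nat y zs) (u i)) (iter_pd (Suc j) P (case_nat y zs) f) F"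
        by (rule Suc.prems(3)) (use j zs y in \<open>auto split: nat.split\<close>)
      then show "uniform_conv P (\<lambda>i. iter_pd j P zs (pd P y (u i))) (iter_pd j P zs (pd P y f)) F"
        by simp
    qed
  qed
  moreover have "uniform_conv P u f F" using Suc.prems(3)[of 0 "\<lambda>_. 0"] zero_in_dirs[of P] by simp
  ultimately show ?case by simp
qed

section \<open>Multilinearity in the directions and its consequences\<close>

lemma has_dd_scale_direction:
  assumes "has_dd P y f g"
  shows "has_dd P (c *\<^sub>R y) f (\<lambda>x. c *\<^sub>R g x)"
  unfolding has_dd_def
proof (intro conjI ballI)
  fix x assume x: "x \<in> P"
  show "has_line_deriv P (c *\<^sub>R y) f x (c *\<^sub>R g x)"
  proof (cases "c = 0")
    case True
    then show ?thesis by (simp add: has_line_deriv_def)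
  next
    case False
    have "((\<lambda>t. t * c) \<longlongrightarrow> 0 * c) (at 0 within {t. x + t *\<^sub>R c *\<^sub>R y \<in> P})"
      by (intro tendsto_intros)
    then have "LIM t at 0 within {t. x + t *\<^sub>R c *\<^sub>R y \<in> P}. t * c :> at 0 within {t. x + t *\<^sub>R y \<in> P}"
      unfolding filterlim_at using False by (auto simp: eventually_at_filter)
    from filterlim_compose[OF _ this, of "\<lambda>t. (1 / t) *\<^sub>R (f (x + t *\<^sub>R y) - f x)" "nhds (g x)"]
    have "((\<lambda>t. (1 / (t * c)) *\<^sub>R (f (x + (t * c) *\<^sub>R y) - f x)) \<longlongrightarrow> g x) (at 0 within {t. x + t *\<^sub>R c *\<^sub>R y \<in> P})"
      using assms x by (simp add: has_dd_def has_line_deriv_def)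
    from tendsto_scaleR_lcs[OF tendsto_const[of c] this]
    show ?thesis using False by (simp add: has_line_deriv_def)
  qed
qed (use assms in \<open>auto simp: has_dd_def intro!: continuous_on_scaleR_lcs\<close>)

lemma has_dd_zero_direction: "continuous_on P f \<Longrightarrow> has_dd P 0 f (\<lambda>_. 0)"
  by (auto simp: has_dd_def has_line_deriv_def)

lemma pd_sum_direction:
  assumes P: "convex P" and f: "Ck (Suc 0) P f" and "finite B" "B \<subseteq> dirs P" and x: "x \<in> P"
  shows "pd P (\<Sum>b\<in>B. c b *\<^sub>R b) f x = (\<Sum>b\<in>B. c b *\<^sub>R pd P b f x)"
  using assms(3,4)
proof (induction B)
  case empty
  then show ?case
    using has_dd_pd_eq[OF P zero_in_dirs has_dd_zero_direction[OF Ck_imp_continuous_on[OF f]] x] by simp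
next
  case (insert b B)
  have mem: "c b *\<^sub>R b \<in> dirs P" "(\<Sum>b\<in>B. c b *\<^sub>R b) \<in> dirs P"
    using insert.prems by (auto intro!: subspace_scale[OF subspace_dirs] subspace_sum[OF subspace_dirs])
  then have mem': "c b *\<^sub>R b + (\<Sum>b\<in>B. c b *\<^sub>R b) \<in> dirs P"
    by (rule subspace_add[OF subspace_dirs])
  have b: "b \<in> dirs P" using insert.prems by auto
  note dd = Ck_Suc_pd(1)[OF P f]
  have "pd P (c b *\<^sub>R b + (\<Sum>b\<in>B. c b *\<^sub>R b)) f x = pd P (c b *\<^sub>R b) f x + pd P (\<Sum>b\<in>B. c b *\<^sub>R b) f x"
    by (rule has_dd_add_direction[OF P mem dd[OF mem(1)] dd[OF mem(2)] dd[OF mem'] x])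
  moreover have "pd P (c b *\<^sub>R b) f x = c b *\<^sub>R pd P b f x"
    by (rule has_dd_pd_eq[OF P mem(1) has_dd_scale_direction[OF dd[OF b]] x])
  ultimately show ?case using insert by simp
qed

lemma has_dd_scale: "has_dd P y f g \<Longrightarrow> has_dd P y (\<lambda>x. c *\<^sub>R f x) (\<lambda>x. c *\<^sub>R g x)"
  using has_dd_mult[OF has_dd_const, of P y f g c] by simp

lemma has_dd_sum:
  assumes "finite B" "\<And>b. b \<in> B \<Longrightarrow> has_dd P y (f b) (g b)"
  shows "has_dd P y (\<lambda>x. \<Sum>b\<in>B. f b x) (\<lambda>x. \<Sum>b\<in>B. g b x)"
  using assms
proof (induction B)
  case empty
  then show ?case using has_dd_const[of P y 0] by simp
next
  case (insert b B)
  then show ?case using has_dd_add[of P y "f b" "g b"] by simp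
qed

lemma iter_pd_lincomb:
  assumes P: "convex P" and fin: "finite B" and f: "\<And>b. b \<in> B \<Longrightarrow> Ck k P (f b)"
    and zs: "\<And>j. j < k \<Longrightarrow> zs j \<in> dirs P" and x: "x \<in> P"
  shows "iter_pd k P zs (\<lambda>x. \<Sum>b\<in>B. c b *\<^sub>R f b x) x = (\<Sum>b\<in>B. c b *\<^sub>R iter_pd k P zs (f b) x)"
  using f zs
proof (induction k arbitrary: f zs)
  case (Suc k)
  have z0: "zs 0 \<in> dirs P" using Suc.prems by simp
  have dd: "has_dd P (zs 0) (\<lambda>x. \<Sum>b\<in>B. c b *\<^sub>R f b x) (\<lambda>x. \<Sum>b\<in>B. c b *\<^sub>R pd P (zs 0) (f b) x)"
    by (rule has_dd_sum[OF fin has_dd_scale[OF Ck_Suc_pd(1)[OF P Suc.prems(1) z0]]])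
  have "iter_pd (Suc k) P zs (\<lambda>x. \<Sum>b\<in>B. c b *\<^sub>R f b x) x =
      iter_pd k P (\<lambda>i. zs (Suc i)) (\<lambda>x. \<Sum>b\<in>B. c b *\<^sub>R pd P (zs 0) (f b) x) x"
    using iter_pd_cong[OF has_dd_pd_eq[OF P z0 dd] x] by simp
  also have "\<dots> = (\<Sum>b\<in>B. c b *\<^sub>R iter_pd k P (\<lambda>i. zs (Suc i)) (pd P (zs 0) (f b)) x)"
    by (rule Suc.IH[OF Ck_Suc_pd(2)[OF P Suc.prems(1) z0]]) (use Suc.prems in auto)
  finally show ?case by simp
qed simp

text \<open>Expanding the first direction confines its influence to scalar coefficients, while the
  derivatives that replace it are taken in the finitely many fixed directions \<open>b\<close>.
  Joint continuity and the uniform estimate over bounded directions both rest on this.\<close>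

lemma iter_pd_expand:
  assumes P: "convex P" and B: "finite B" "B \<subseteq> dirs P" and f: "Ck (Suc k) P f"
    and zs: "\<And>j. j < Suc k \<Longrightarrow> zs j \<in> dirs P" and z0: "(\<Sum>b\<in>B. c b *\<^sub>R b) = zs 0" and x: "x \<in> P"
  shows "iter_pd (Suc k) P zs f x = (\<Sum>b\<in>B. c b *\<^sub>R iter_pd k P (\<lambda>i. zs (Suc i)) (pd P b f) x)"
proof -
  have "Ck (Suc 0) P f" using Ck_le[OF _ f, of "Suc 0"] by simp
  note eq = pd_sum_direction[OF P this B, of _ c, unfolded z0]
  have "iter_pd (Suc k) P zs f x = iter_pd k P (\<lambda>i. zs (Suc i)) (\<lambda>x. \<Sum>b\<in>B. c b *\<^sub>R pd P b f x) x"
    using iter_pd_cong[OF eq x] by simp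
  also have "\<dots> = (\<Sum>b\<in>B. c b *\<^sub>R iter_pd k P (\<lambda>i. zs (Suc i)) (pd P b f) x)"
    by (rule iter_pd_lincomb[OF P B(1) Ck_Suc_pd(2)[OF P f] _ x]) (use zs B in auto)
  finally show ?thesis .
qed

lemma continuous_map_scaleR_lcs:
  fixes g :: "'a \<Rightarrow> 'y::locally_convex_space"
  assumes "continuous_map X euclidean f" "continuous_map X euclidean g"
  shows "continuous_map X euclidean (\<lambda>x. f x *\<^sub>R g x)"
  using assms by (auto simp: continuous_map_atin intro!: tendsto_scaleR_lcs)

lemma continuous_map_sum_lcs:
  fixes g :: "'b \<Rightarrow> 'a \<Rightarrow> 'y::locally_convex_space"
  assumes "\<And>b. b \<in> B \<Longrightarrow> continuous_map X euclidean (g b)"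
  shows "continuous_map X euclidean (\<lambda>x. \<Sum>b\<in>B. g b x)"
  using assms by (auto simp: continuous_map_atin intro!: tendsto_sum)

lemma dirs_basis:
  fixes P :: "'e::euclidean_space set"
  obtains B and c :: "'e \<Rightarrow> 'e \<Rightarrow> real" where "finite B" "B \<subseteq> dirs P" "\<And>b. b \<in> B \<Longrightarrow> bounded_linear (c b)"
    "\<And>y. y \<in> dirs P \<Longrightarrow> (\<Sum>b\<in>B. c b y *\<^sub>R b) = y"
proof -
  obtain B where B: "B \<subseteq> dirs P" "independent B" "dirs P \<subseteq> span B"
    by (rule maximal_independent_subset)
  obtain c :: "'e \<Rightarrow> 'e \<Rightarrow> real" where c: "\<And>b. b \<in> B \<Longrightarrow> linear (c b)"
    "\<And>b b'. b \<in> B \<Longrightarrow> b' \<in> B \<Longrightarrow> c b b' = (if b = b' then 1 else 0)"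
    "\<And>y. y \<in> span B \<Longrightarrow> (\<Sum>b\<in>B. c b y *\<^sub>R b) = y"
    by (rule dual_basis[OF B(2)]) (rule that)
  show ?thesis
    using that[of B c] B c independent_imp_finite[OF B(2)] linear_conv_bounded_linear by blast
qed

text \<open>By \<open>iter_pd_expand\<close>, the first direction enters through continuous
  coordinates, and induction on the order applies to \<open>pd P b f\<close> with \<open>b\<close>
  fixed. Point and directions are maps on a parameter space \<open>X\<close>, later a
  \<open>deriv_domain\<close>.\<close>

lemma continuous_map_iter_pd:
  fixes P :: "'e::euclidean_space set" and f :: "'e \<Rightarrow> 'y::locally_convex_space"
  assumes P: "convex P" and f: "Ck k P f" and p: "continuous_map X (top_of_set P) p"
    and z: "\<And>j. j < k \<Longrightarrow> continuous_map X (top_of_set (dirs P)) (\<lambda>s. z s j)"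
  shows "continuous_map X euclidean (\<lambda>s. iter_pd k P (z s) f (p s))"
proof -
  obtain B c where B: "finite B" "B \<subseteq> dirs P" "\<And>b. b \<in> B \<Longrightarrow> bounded_linear (c b)"
    "\<And>y. y \<in> dirs P \<Longrightarrow> (\<Sum>b\<in>B. c b y *\<^sub>R b) = y"
    by (rule dirs_basis[of P]) (rule that)
  have pP: "p s \<in> P" if "s \<in> topspace X" for s
    using continuous_map_image_subset_topspace[OF p] that by auto
  show ?thesis
    using f z
  proof (induction k arbitrary: f z)
    case 0
    have "continuous_map (top_of_set P) euclidean f" using 0 by simp
    from continuous_map_compose[OF p this] show ?case by (simp add: o_def)
  next
    case (Suc k)
    have zP: "z s j \<in> dirs P" if "s \<in> topspace X" "j < Suc k" for s j
      using continuous_map_image_subset_topspace[OF Suc.prems(2)[OF that(2)]] that(1) by auto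
    have "continuous_map X euclidean (\<lambda>s. \<Sum>b\<in>B. c b (z s 0) *\<^sub>R iter_pd k P (\<lambda>i. z s (Suc i)) (pd P b f) (p s))"
    proof (intro continuous_map_sum_lcs continuous_map_scaleR_lcs)
      fix b assume b: "b \<in> B"
      have "continuous_map X euclidean (\<lambda>s. z s 0)"
        using Suc.prems(2)[of 0] by (simp add: continuous_map_in_subtopology)
      moreover have "continuous_map euclidean euclidean (c b)"
        using B(3)[OF b] by (simp add: linear_continuous_on)
      ultimately show "continuous_map X euclidean (\<lambda>s. c b (z s 0))"
        using continuous_map_compose[of X euclidean "\<lambda>s. z s 0" euclidean "c b"] by (simp add: o_def)
      show "continuous_map X euclidean (\<lambda>s. iter_pd k P (\<lambda>i. z s (Suc i)) (pd P b f) (p s))"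
        by (rule Suc.IH[OF Ck_Suc_pd(2)[OF P Suc.prems(1)]]) (use b B Suc.prems(2) in auto)
    qed
    then show ?case
    proof (rule continuous_map_eq)
      fix s assume s: "s \<in> topspace X"
      show "(\<Sum>b\<in>B. c b (z s 0) *\<^sub>R iter_pd k P (\<lambda>i. z s (Suc i)) (pd P b f) (p s)) = iter_pd (Suc k) P (z s) f (p s)"
        by (rule iter_pd_expand[OF P B(1,2) Suc.prems(1) zP[OF s] _ pP[OF s], symmetric])
          (auto intro: B(4) zP[OF s])
    qed
  qed
qed

lemma nhd_0_sum:
  fixes V :: "'y::locally_convex_space set"
  assumes "finite B" "open V" "0 \<in> V"
  shows "\<exists>N. open N \<and> 0 \<in> N \<and> (\<forall>v. (\<forall>b\<in>B. v b \<in> N) \<longrightarrow> (\<Sum>b\<in>B. v b) \<in> V)"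
  using assms
proof (induction B arbitrary: V)
  case empty
  then show ?case by auto
next
  case (insert b B)
  obtain N where N: "open N" "0 \<in> N" "\<And>x y. x \<in> N \<Longrightarrow> y \<in> N \<Longrightarrow> x + y \<in> V"
    "\<And>x. x \<in> N \<Longrightarrow> - x \<in> N" "convex N"
    by (rule nhd_0_add[OF insert.prems]) (rule that)
  obtain N' where N': "open N'" "0 \<in> N'" "\<And>v. (\<forall>b\<in>B. v b \<in> N') \<Longrightarrow> (\<Sum>b\<in>B. v b) \<in> N"
    using insert.IH[OF N(1,2)] by blast
  show ?case
  proof (intro exI[of _ "N \<inter> N'"] conjI allI impI)
    fix v assume "\<forall>a\<in>insert b B. v a \<in> N \<inter> N'"
    then have "v b \<in> N" "(\<Sum>b\<in>B. v b) \<in> N" using N'(3)[of v] by auto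
    then show "(\<Sum>a\<in>insert b B. v a) \<in> V" using N(3) insert.hyps by simp
  qed (use N N' in auto)
qed

text \<open>After \<open>iter_pd_expand\<close> the coefficients are bounded by \<open>K'\<close>
  and finitely many convergent terms remain. In this way uniformity in the point becomes uniformity
  over bounded directions as well.\<close>

lemma iter_pd_uniform_bounded:
  fixes P :: "'e::euclidean_space set" and f :: "'e \<Rightarrow> 'y::locally_convex_space"
  assumes P: "convex P" and f: "Ck k P f" and u: "\<forall>\<^sub>F i in F. Ck k P (u i)"
    and conv: "Ck_conv k P u f F" and V: "open V" "0 \<in> V"
  shows "\<forall>\<^sub>F i in F. \<forall>x\<in>P. \<forall>zs. (\<forall>j<k. zs j \<in> dirs P \<and> norm (zs j) \<le> R) \<longrightarrow>
     iter_pd k P zs (u i) x - iter_pd k P zs f x \<in> V"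
proof -
  obtain B c where B: "finite B" "B \<subseteq> dirs P" "\<And>b. b \<in> B \<Longrightarrow> bounded_linear (c b)"
    "\<And>y. y \<in> dirs P \<Longrightarrow> (\<Sum>b\<in>B. c b y *\<^sub>R b) = y"
    by (rule dirs_basis[of P]) (rule that)
  have "\<exists>K. \<forall>y. norm y \<le> R \<longrightarrow> \<bar>c b y\<bar> \<le> K" if b: "b \<in> B" for b
  proof -
    obtain K where K: "K \<ge> 0" "\<And>y. norm (c b y) \<le> norm y * K"
      using bounded_linear.nonneg_bounded[OF B(3)[OF b]] by blast
    have "\<bar>c b y\<bar> \<le> R * K" if "norm y \<le> R" for y
      using K(2)[of y] mult_right_mono[OF that K(1)] by simp
    then show ?thesis by blast
  qed
  then obtain K where K: "\<And>b y. b \<in> B \<Longrightarrow> norm y \<le> R \<Longrightarrow> \<bar>c b y\<bar> \<le> K b" by metis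
  \<comment> \<open>One bound for all \<open>b\<close>; absolute values, because a chosen
    \<open>K b\<close> may be negative.\<close>
  define K' where "K' = (\<Sum>b\<in>B. \<bar>K b\<bar>)"
  have K': "\<bar>c b y\<bar> \<le> K'" if "b \<in> B" "norm y \<le> R" for b y
  proof -
    have "\<bar>c b y\<bar> \<le> \<bar>K b\<bar>" using K[OF that] by linarith
    also have "\<dots> \<le> K'" unfolding K'_def using that B by (intro member_le_sum) auto
    finally show ?thesis .
  qed
  show ?thesis
    using f u conv V
  proof (induction k arbitrary: f u V)
    case 0
    then show ?case by (simp add: uniform_conv_def)
  next
    case (Suc k)
    obtain N where N: "open N" "0 \<in> N" "\<And>v. (\<forall>b\<in>B. v b \<in> N) \<Longrightarrow> (\<Sum>b\<in>B. v b) \<in> V"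
      using nhd_0_sum[OF B(1) Suc.prems(4,5)] by blast
    obtain N' where N': "open N'" "0 \<in> N'" "\<And>c x. \<bar>c\<bar> \<le> K' \<Longrightarrow> x \<in> N' \<Longrightarrow> c *\<^sub>R x \<in> N"
      by (rule nhd_0_scale[OF N(1,2)]) (rule that)
    have "\<forall>\<^sub>F i in F. \<forall>b\<in>B. \<forall>x\<in>P. \<forall>zs. (\<forall>j<k. zs j \<in> dirs P \<and> norm (zs j) \<le> R) \<longrightarrow>
        iter_pd k P zs (pd P b (u i)) x - iter_pd k P zs (pd P b f) x \<in> N'"
    proof (intro eventually_ball_finite[OF B(1)] ballI)
      fix b assume b: "b \<in> B"
      then have b': "b \<in> dirs P" using B by auto
      have "\<forall>\<^sub>F i in F. Ck k P (pd P b (u i))"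
        using Suc.prems(2) by eventually_elim (rule Ck_Suc_pd(2)[OF P _ b'])
      then show "\<forall>\<^sub>F i in F. \<forall>x\<in>P. \<forall>zs. (\<forall>j<k. zs j \<in> dirs P \<and> norm (zs j) \<le> R) \<longrightarrow>
          iter_pd k P zs (pd P b (u i)) x - iter_pd k P zs (pd P b f) x \<in> N'"
        by (rule Suc.IH[OF Ck_Suc_pd(2)[OF P Suc.prems(1) b'] _ Ck_conv_pd[OF P Suc.prems(3) b'] N'(1,2)])
    qed
    with Suc.prems(2) show ?case
    proof eventually_elim
      case (elim i)
      show ?case
      proof (intro ballI allI impI)
        fix x zs assume x: "x \<in> P" and zs: "\<forall>j<Suc k. zs j \<in> dirs P \<and> norm (zs j) \<le> R"
        let ?d = "\<lambda>b. iter_pd k P (\<lambda>i. zs (Suc i)) (pd P b (u i)) x - iter_pd k P (\<lambda>i. zs (Suc i)) (pd P b f) x"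
        have zs': "\<And>j. j < Suc k \<Longrightarrow> zs j \<in> dirs P" "(\<Sum>b\<in>B. c b (zs 0) *\<^sub>R b) = zs 0"
          using zs B(4) by auto
        have "iter_pd (Suc k) P zs (u i) x - iter_pd (Suc k) P zs f x = (\<Sum>b\<in>B. c b (zs 0) *\<^sub>R ?d b)"
          using iter_pd_expand[where zs = zs and c = "\<lambda>b. c b (zs 0)", OF P B(1,2) Suc.prems(1) zs' x]
            iter_pd_expand[where zs = zs and c = "\<lambda>b. c b (zs 0)", OF P B(1,2) elim(1) zs' x]
          by (simp only: scaleR_diff_right sum_subtractf)
        moreover have "c b (zs 0) *\<^sub>R ?d b \<in> N" if b: "b \<in> B" for b
        proof (rule N'(3)[OF K'[OF b]])
          show "norm (zs 0) \<le> R" using zs by auto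
          have "\<forall>j<k. zs (Suc j) \<in> dirs P \<and> norm (zs (Suc j)) \<le> R" using zs by auto
          then show "?d b \<in> N'" using elim(2)[rule_format, OF b x, of "\<lambda>i. zs (Suc i)"] by simp
        qed
        ultimately show "iter_pd (Suc k) P zs (u i) x - iter_pd (Suc k) P zs f x \<in> V"
          using N(3) by simp
      qed
    qed
  qed
qed

section \<open>Convergence in the function space topologies\<close>

text \<open>Eventual membership passes to finite intersections and to unions, so a subbasis
  suffices. That \<open>l\<close> lies in the union of the subbasis is membership in the
  space.\<close>

lemma limitin_topology_generated_by:
  "limitin (topology_generated_by \<S>) u l F \<longleftrightarrow>
     l \<in> \<Union>\<S> \<and> (\<forall>U\<in>\<S>. l \<in> U \<longrightarrow> (\<forall>\<^sub>F i in F. u i \<in> U))"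
proof safe
  assume lim: "limitin (topology_generated_by \<S>) u l F"
  then show "l \<in> \<Union>\<S>" using limitin_topspace[OF lim] by simp
  fix U assume "U \<in> \<S>" "l \<in> U"
  then show "\<forall>\<^sub>F i in F. u i \<in> U"
    using lim topology_generated_by_Basis[of U \<S>] by (auto simp: limitin_def)
next
  fix X assume *: "\<forall>U\<in>\<S>. l \<in> U \<longrightarrow> (\<forall>\<^sub>F i in F. u i \<in> U)" and X: "l \<in> X" "X \<in> \<S>"
  have "\<forall>\<^sub>F i in F. u i \<in> U" if "generate_topology_on \<S> U" "l \<in> U" for U
    using that
  proof (induction rule: generate_topology_on.induct)
    case (Int a b)
    then show ?case by (auto intro: eventually_conj)
  next
    case (UN K)
    then obtain k where k: "k \<in> K" "l \<in> k" by blast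
    then have "\<forall>\<^sub>F i in F. u i \<in> k" using UN by blast
    then show ?case by eventually_elim (use k in blast)
  next
    case (Basis s)
    then show ?case using * by blast
  qed simp
  then show "limitin (topology_generated_by \<S>) u l F"
    unfolding limitin_def openin_topology_generated_by_iff using X by auto
qed

lemma limitin_pullback_topology:
  assumes "t ` A \<subseteq> topspace T"
  shows "limitin (pullback_topology A t T) u l F \<longleftrightarrow>
    l \<in> A \<and> (\<forall>\<^sub>F i in F. u i \<in> A) \<and> limitin T (\<lambda>i. t (u i)) (t l) F"
proof -
  have top: "topspace (pullback_topology A t T) = A"
    using assms by (auto simp: topspace_pullback_topology)
  show ?thesis
  proof (intro iffI conjI)
    assume lim: "limitin (pullback_topology A t T) u l F"
    show l: "l \<in> A" using limitin_topspace[OF lim] top by simp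
    show ev: "\<forall>\<^sub>F i in F. u i \<in> A"
      using lim l openin_topspace[of "pullback_topology A t T"] unfolding top by (auto simp: limitin_def)
    show "limitin T (\<lambda>i. t (u i)) (t l) F"
      unfolding limitin_def
    proof (intro conjI allI impI)
      show "t l \<in> topspace T" using l assms by auto
      fix U assume "openin T U \<and> t l \<in> U"
      then have "openin (pullback_topology A t T) (t -` U \<inter> A)" "l \<in> t -` U \<inter> A"
        using l by (auto simp: openin_pullback_topology)
      then have "\<forall>\<^sub>F i in F. u i \<in> t -` U \<inter> A" using lim unfolding limitin_def by blast
      then show "\<forall>\<^sub>F i in F. t (u i) \<in> U" by eventually_elim auto
    qed
  next
    assume *: "l \<in> A \<and> (\<forall>\<^sub>F i in F. u i \<in> A) \<and> limitin T (\<lambda>i. t (u i)) (t l) F"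
    show "limitin (pullback_topology A t T) u l F"
      unfolding limitin_def top openin_pullback_topology
    proof (intro conjI allI impI)
      show "l \<in> A" using * by blast
      fix U assume U: "(\<exists>V. openin T V \<and> U = t -` V \<inter> A) \<and> l \<in> U"
      then obtain V where V: "openin T V" "U = t -` V \<inter> A" by blast
      then have "\<forall>\<^sub>F i in F. t (u i) \<in> V" using * U by (auto simp: limitin_def)
      with * have "\<forall>\<^sub>F i in F. u i \<in> A \<and> t (u i) \<in> V" by (auto intro: eventually_conj)
      then show "\<forall>\<^sub>F i in F. u i \<in> U" by eventually_elim (use V in auto)
    qed
  qed
qed

section \<open>Convergence in the compact-open topology\<close>

lemma topspace_compact_open [simp]: "topspace (compact_open_topology X) = continuous_maps X"
proof -
  have "continuous_maps X = {h \<in> continuous_maps X. h ` {} \<subseteq> UNIV}" by auto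
  then have "continuous_maps X \<in> {{h \<in> continuous_maps X. h ` K \<subseteq> V} | K V. compactin X K \<and> open V}"
    using compactin_empty[of X] open_UNIV by blast
  then show ?thesis unfolding compact_open_topology_def topology_generated_by_topspace by blast
qed

text \<open>Translates of neighbourhoods of zero make \<open>'y\<close> a uniform space. Covering
  the compact image of \<open>K\<close> by finitely many such translates passes between finitely
  many conditions that a compact set be mapped into an open one and a single uniform
  estimate.\<close>

lemma limitin_compact_open:
  fixes h :: "'a \<Rightarrow> 'y::locally_convex_space"
  assumes u: "\<forall>\<^sub>F i in F. u i \<in> continuous_maps X" and h: "h \<in> continuous_maps X"
  shows "limitin (compact_open_topology X) u h F \<longleftrightarrow> (\<forall>K. compactin X K \<longrightarrow> uniform_conv K u h F)"
proof
  assume lim: "limitin (compact_open_topology X) u h F"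
  have ev: "\<forall>\<^sub>F i in F. u i ` K \<subseteq> V" if "compactin X K" "open V" "h ` K \<subseteq> V" for K V
  proof -
    have "{h \<in> continuous_maps X. h ` K \<subseteq> V} \<in> {{h \<in> continuous_maps X. h ` K \<subseteq> V} | K V. compactin X K \<and> open V}"
      using that by blast
    moreover have "h \<in> {h \<in> continuous_maps X. h ` K \<subseteq> V}" using h that by blast
    ultimately have "\<forall>\<^sub>F i in F. u i \<in> {h \<in> continuous_maps X. h ` K \<subseteq> V}"
      using lim unfolding compact_open_topology_def limitin_topology_generated_by by blast
    then show ?thesis by eventually_elim auto
  qed
  have cm: "continuous_map X euclidean h" using h by (simp add: continuous_maps_def)
  show "\<forall>K. compactin X K \<longrightarrow> uniform_conv K u h F"
    unfolding uniform_conv_def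
  proof (intro allI impI)
    fix K and V :: "'y set" assume K: "compactin X K" and V: "open V" "0 \<in> V"
    obtain N where N: "open N" "0 \<in> N" "\<And>x y. x \<in> N \<Longrightarrow> y \<in> N \<Longrightarrow> x + y \<in> V"
      "\<And>x. x \<in> N \<Longrightarrow> - x \<in> N" "convex N"
      by (rule nhd_0_add[OF V]) (rule that)
    obtain N2 where N2: "open N2" "0 \<in> N2" "\<And>x y. x \<in> N2 \<Longrightarrow> y \<in> N2 \<Longrightarrow> x + y \<in> N"
      "\<And>x. x \<in> N2 \<Longrightarrow> - x \<in> N2" "convex N2"
      by (rule nhd_0_add[OF N(1,2)]) (rule that)
    \<comment> \<open>The sets satisfy \<open>A a \<subseteq> C a \<subseteq> B a\<close> with
      \<open>C a\<close> closed. The open sets \<open>A a\<close> provide the finite cover; the part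
      of \<open>K\<close> that \<open>h\<close> maps into \<open>C a\<close> is compact, as a
      subbasic condition requires, and its image lies in the open set \<open>B a\<close>.\<close>
    define A where "A a = {v. v - a \<in> N2}" for a :: 'y
    define B where "B a = {v. v - a \<in> N}" for a :: 'y
    define C where "C a = - (\<Union>v\<in>- B a. A v)" for a :: 'y
    have oA: "open (A a)" and oB: "open (B a)" for a
      unfolding A_def B_def by (rule open_translation_lcs(2)[OF N2(1)] open_translation_lcs(2)[OF N(1)])+
    have cC: "closed (C a)" for a unfolding C_def closed_def using oA by auto
    have CB: "C a \<subseteq> B a" for a
    proof
      fix v assume "v \<in> C a"
      moreover have "v \<in> A v" using N2(2) by (simp add: A_def)
      ultimately show "v \<in> B a" unfolding C_def by blast
    qed
    have AC: "A a \<subseteq> C a" for a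
    proof
      fix v assume v: "v \<in> A a"
      have "w \<in> B a" if "v \<in> A w" for w
      proof -
        have "v - a \<in> N2" using v by (simp add: A_def)
        moreover have "- (v - w) \<in> N2" using that by (intro N2(4)) (simp add: A_def)
        ultimately have "(v - a) + - (v - w) \<in> N" by (rule N2(3))
        then show ?thesis by (simp add: B_def)
      qed
      then show "v \<in> C a" by (auto simp: C_def)
    qed
    have Ksub: "K \<subseteq> topspace X" using K by (rule compactin_subset_topspace)
    have "compact (h ` K)" using image_compactin[OF K cm] by simp
    then obtain S where S: "S \<subseteq> h ` K" "finite S" "h ` K \<subseteq> (\<Union>a\<in>S. A a)"
    proof (rule compactE_image)
      show "h ` K \<subseteq> (\<Union>a\<in>h ` K. A a)" using N2(2) by (auto simp: A_def)
    qed (rule oA)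
    have "\<forall>\<^sub>F i in F. \<forall>a\<in>S. u i ` ({z \<in> topspace X. h z \<in> C a} \<inter> K) \<subseteq> B a"
    proof (intro eventually_ball_finite[OF S(2)] ballI ev oB)
      fix a
      have "closedin X {z \<in> topspace X. h z \<in> C a}"
        by (rule closedin_continuous_map_preimage[OF cm]) (use cC in simp)
      then show "compactin X ({z \<in> topspace X. h z \<in> C a} \<inter> K)"
        using K by (rule closed_Int_compactin)
      show "h ` ({z \<in> topspace X. h z \<in> C a} \<inter> K) \<subseteq> B a" using CB by auto
    qed
    then show "\<forall>\<^sub>F i in F. \<forall>z\<in>K. u i z - h z \<in> V"
    proof eventually_elim
      case (elim i)
      show ?case
      proof
        fix z assume z: "z \<in> K"
        then obtain a where a: "a \<in> S" "h z \<in> A a" using S(3) by blast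
        then have "z \<in> {z \<in> topspace X. h z \<in> C a} \<inter> K" using z Ksub AC by auto
        then have "u i z \<in> B a" using elim a(1) by blast
        then have "u i z - a \<in> N" by (simp add: B_def)
        moreover have "h z \<in> B a" using a(2) AC CB by blast
        then have "- (h z - a) \<in> N" by (intro N(4)) (simp add: B_def)
        ultimately have "(u i z - a) + - (h z - a) \<in> V" by (rule N(3))
        then show "u i z - h z \<in> V" by simp
      qed
    qed
  qed
next
  assume conv: "\<forall>K. compactin X K \<longrightarrow> uniform_conv K u h F"
  have "\<forall>\<^sub>F i in F. u i \<in> {h \<in> continuous_maps X. h ` K \<subseteq> V}"
    if K: "compactin X K" and V: "open V" "h ` K \<subseteq> V" for K V
  proof -
    have cK: "compact (h ` K)"
      using image_compactin[OF K, of euclidean h] h by (simp add: continuous_maps_def)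
    \<comment> \<open>Two increments: from the centre \<open>a\<close> of a patch to
      \<open>h x\<close>, and from \<open>h x\<close> to \<open>u i x\<close>.\<close>
    have "\<exists>N. open N \<and> 0 \<in> N \<and> (\<forall>v w. v \<in> N \<longrightarrow> w \<in> N \<longrightarrow> a + v + w \<in> V)" if "a \<in> h ` K" for a
    proof -
      have 0: "0 \<in> {v. v + a \<in> V}" using that V by auto
      obtain N where N: "open N" "0 \<in> N" "\<And>x y. x \<in> N \<Longrightarrow> y \<in> N \<Longrightarrow> x + y \<in> {v. v + a \<in> V}"
        "\<And>x. x \<in> N \<Longrightarrow> - x \<in> N" "convex N"
        by (rule nhd_0_add[OF open_translation_lcs(1)[OF V(1)] 0]) (rule that)
      have "a + v + w \<in> V" if "v \<in> N" "w \<in> N" for v w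
        using N(3)[OF that] by (simp add: algebra_simps)
      then show ?thesis using N by blast
    qed
    then obtain N where N: "\<And>a. a \<in> h ` K \<Longrightarrow> open (N a)" "\<And>a. a \<in> h ` K \<Longrightarrow> 0 \<in> N a"
      "\<And>a v w. a \<in> h ` K \<Longrightarrow> v \<in> N a \<Longrightarrow> w \<in> N a \<Longrightarrow> a + v + w \<in> V" by metis
    obtain S where S: "S \<subseteq> h ` K" "finite S" "h ` K \<subseteq> (\<Union>a\<in>S. {v. v - a \<in> N a})"
    proof (rule compactE_image[OF cK])
      show "h ` K \<subseteq> (\<Union>a\<in>h ` K. {v. v - a \<in> N a})" using N(2) by auto
    qed (rule open_translation_lcs(2)[OF N(1)])
    define M where "M = (\<Inter>a\<in>S. N a)"
    have "open M" "0 \<in> M" unfolding M_def using S N(1,2) by (auto intro!: open_INT)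
    then have "\<forall>\<^sub>F i in F. \<forall>x\<in>K. u i x - h x \<in> M" using conv K unfolding uniform_conv_def by blast
    with u show ?thesis
    proof eventually_elim
      case (elim i)
      have "u i x \<in> V" if x: "x \<in> K" for x
      proof -
        obtain a where a: "a \<in> S" "h x - a \<in> N a" using S(3) x by blast
        have "u i x - h x \<in> N a" using elim x a by (auto simp: M_def)
        then have "a + (h x - a) + (u i x - h x) \<in> V" using N(3) a S(1) by blast
        then show ?thesis by simp
      qed
      then show ?case using elim by auto
    qed
  qed
  then have "\<forall>U\<in>{{h \<in> continuous_maps X. h ` K \<subseteq> V} | K V. compactin X K \<and> open V}.
      h \<in> U \<longrightarrow> (\<forall>\<^sub>F i in F. u i \<in> U)"
    by auto
  moreover have "h \<in> \<Union>{{h \<in> continuous_maps X. h ` K \<subseteq> V} | K V. compactin X K \<and> open V}"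
  proof -
    have "h \<in> topspace (compact_open_topology X)" using h by simp
    then show ?thesis unfolding compact_open_topology_def topology_generated_by_topspace .
  qed
  ultimately show "limitin (compact_open_topology X) u h F"
    unfolding compact_open_topology_def limitin_topology_generated_by by blast
qed

lemma limitin_Cm_on_topology:
  fixes g :: "(nat \<Rightarrow> real) \<Rightarrow> 'y::locally_convex_space"
  assumes g: "g \<in> Cm_on d m U" and u: "\<forall>\<^sub>F i in F. u i \<in> Cm_on d m U"
    and cont: "\<And>k g. enat k \<le> m \<Longrightarrow> g \<in> Cm_on d m U \<Longrightarrow>
      deriv_ext d U k (g :: (nat \<Rightarrow> real) \<Rightarrow> 'y) \<in> continuous_maps (deriv_domain d U k)"
  shows "limitin (Cm_on_topology d m U) u g F \<longleftrightarrow>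
    (\<forall>k. enat k \<le> m \<longrightarrow> limitin (compact_open_topology (deriv_domain d U k)) (\<lambda>i. deriv_ext d U k (u i)) (deriv_ext d U k g) F)"
proof -
  let ?S = "{{g :: (nat \<Rightarrow> real) \<Rightarrow> 'y. g \<in> Cm_on d m U \<and> deriv_ext d U k g \<in> W} | k W.
        enat k \<le> m \<and> openin (compact_open_topology (deriv_domain d U k)) W}"
  have 0: "enat 0 \<le> m" by (simp add: zero_enat_def[symmetric])
  have "openin (compact_open_topology (deriv_domain d U 0)) (continuous_maps (deriv_domain d U 0) :: (_ \<Rightarrow> 'y) set)"
    by (metis openin_topspace topspace_compact_open)
  \<comment> \<open>The space of a generated topology is the union of its subbasis. This subbasic
    set for order 0, an order allowed by every \<open>m\<close>, is all of
    \<open>Cm_on d m U\<close>.\<close>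
  then have "{g \<in> Cm_on d m U. deriv_ext d U 0 g \<in> continuous_maps (deriv_domain d U 0)} \<in> ?S"
    using 0 by blast
  then have inS: "g \<in> \<Union>?S" using g cont[OF 0] by blast
  show ?thesis
    unfolding Cm_on_topology_def limitin_topology_generated_by
  proof (intro iffI conjI allI impI)
    fix k assume 1: "g \<in> \<Union>?S \<and> (\<forall>U'\<in>?S. g \<in> U' \<longrightarrow> (\<forall>\<^sub>F i in F. u i \<in> U'))" and k: "enat k \<le> m"
    note * = conjunct2[OF 1]
    show "limitin (compact_open_topology (deriv_domain d U k)) (\<lambda>i. deriv_ext d U k (u i)) (deriv_ext d U k g) F"
      unfolding limitin_def
    proof (intro conjI allI impI)
      show "deriv_ext d U k g \<in> topspace (compact_open_topology (deriv_domain d U k))"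
        using cont[OF k g] by simp
      fix W assume W: "openin (compact_open_topology (deriv_domain d U k)) W \<and> deriv_ext d U k g \<in> W"
      have "{g \<in> Cm_on d m U. deriv_ext d U k g \<in> W} \<in> ?S" using k W by blast
      then have "\<forall>\<^sub>F i in F. u i \<in> {g \<in> Cm_on d m U. deriv_ext d U k g \<in> W}"
        by (rule *[rule_format]) (use W g in simp)
      then show "\<forall>\<^sub>F i in F. deriv_ext d U k (u i) \<in> W" by eventually_elim auto
    qed
  next
    show "g \<in> \<Union>?S" by (rule inS)
  next
    assume *: "\<forall>k. enat k \<le> m \<longrightarrow> limitin (compact_open_topology (deriv_domain d U k)) (\<lambda>i. deriv_ext d U k (u i)) (deriv_ext d U k g) F"
    show "\<forall>U'\<in>?S. g \<in> U' \<longrightarrow> (\<forall>\<^sub>F i in F. u i \<in> U')"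
    proof clarify
      fix k W assume k: "enat k \<le> m" and W: "openin (compact_open_topology (deriv_domain d U k)) W" "deriv_ext d U k g \<in> W"
      have "\<forall>\<^sub>F i in F. deriv_ext d U k (u i) \<in> W" using *[rule_format, OF k] W unfolding limitin_def by simp
      with u show "\<forall>\<^sub>F i in F. u i \<in> {g \<in> Cm_on d m U. deriv_ext d U k g \<in> W}" by eventually_elim simp
    qed
  qed
qed

section \<open>Charts\<close>

lemma iter_deriv_cong_dirs:
  "(\<And>j. j < k \<Longrightarrow> ys j = ys' j) \<Longrightarrow> iter_deriv k g ys = iter_deriv k g ys'"
  by (induction k) auto

lemma has_dir_deriv_unique: "has_dir_deriv g x y v \<Longrightarrow> has_dir_deriv g x y w \<Longrightarrow> v = w"
  unfolding has_dir_deriv_def by (rule tendsto_unique[OF trivial_limit_at])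

lemma dir_deriv_eq: "has_dir_deriv g x y v \<Longrightarrow> dir_deriv g x y = v"
  unfolding dir_deriv_def using has_dir_deriv_unique by blast

lemma topspace_directions: "topspace (directions d k) = (\<Pi>\<^sub>E j\<in>{..<k}. topspace (Euclidean_space d))"
  by (simp add: directions_def)

lemma topspace_deriv_domain:
  "topspace (deriv_domain d U k) = (topspace (Euclidean_space d) \<inter> U) \<times> topspace (directions d k)"
  by (simp add: deriv_domain_def)

lemma continuous_map_Euclidean_space_coord: "continuous_map (Euclidean_space d) euclideanreal (\<lambda>x. x i)"
  unfolding Euclidean_space_def
  by (rule continuous_map_from_subtopology) (rule continuous_map_product_projection, simp)

lemma continuous_map_into_Euclidean_space:
  assumes "\<And>i. i < d \<Longrightarrow> continuous_map X euclideanreal (\<lambda>s. f s i)"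
    "\<And>s i. s \<in> topspace X \<Longrightarrow> d \<le> i \<Longrightarrow> f s i = 0"
  shows "continuous_map X (Euclidean_space d) f"
proof -
  have "continuous_map X (Euclidean_space d) (\<lambda>s i. if i < d then f s i else 0)"
    using assms(1) by (simp add: continuous_map_componentwise_Euclidean_space)
  then show ?thesis
    by (rule continuous_map_eq) (use assms(2) in \<open>auto simp: fun_eq_iff not_less\<close>)
qed

text \<open>An affine chart in coordinates: the \<open>e i\<close> are the images of the unit
  vectors under the linear part, and the \<open>c i\<close> are the dual coordinates on
  \<open>dirs P\<close>. They make the inverse of the chart an explicit continuous map.\<close>

locale convex_chart =
  fixes P :: "'e::euclidean_space set" and d :: nat and \<phi> :: "(nat \<Rightarrow> real) \<Rightarrow> 'e"
    and e :: "nat \<Rightarrow> 'e" and c :: "nat \<Rightarrow> 'e \<Rightarrow> real"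
  assumes convex: "convex P"
    and chart_eq: "x \<in> topspace (Euclidean_space d) \<Longrightarrow> \<phi> x = \<phi> (\<lambda>_. 0) + (\<Sum>i<d. x i *\<^sub>R e i)"
    and base: "\<phi> (\<lambda>_. 0) \<in> affine hull P"
    and e_dirs: "i < d \<Longrightarrow> e i \<in> dirs P"
    and linear_c: "i < d \<Longrightarrow> linear (c i)"
    and c_e: "i < d \<Longrightarrow> j < d \<Longrightarrow> c i (e j) = (if i = j then 1 else 0)"
    and expand: "y \<in> dirs P \<Longrightarrow> (\<Sum>i<d. c i y *\<^sub>R e i) = y"
begin

abbreviation "E \<equiv> topspace (Euclidean_space d)"

definition "U = {x \<in> E. \<phi> x \<in> P}"
definition "lin y = (\<Sum>i<d. y i *\<^sub>R e i)"
definition "lin_inv y = (\<lambda>i. if i < d then c i y else 0)"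
text \<open>Total, and inverse to \<phi> on the affine hull of \<open>P\<close>.\<close>

definition "\<psi> p = lin_inv (p - \<phi> (\<lambda>_. 0))"

lemma lin_inv_in_E: "lin_inv y \<in> E"
  by (simp add: lin_inv_def topspace_Euclidean_space)

lemma \<psi>_in_E: "\<psi> p \<in> E"
  by (simp add: \<psi>_def lin_inv_in_E)

lemma lin_in_dirs: "lin y \<in> dirs P"
  unfolding lin_def by (intro subspace_sum[OF subspace_dirs] subspace_scale[OF subspace_dirs] e_dirs) auto

lemma lin_lin_inv: "y \<in> dirs P \<Longrightarrow> lin (lin_inv y) = y"
  using expand[of y] by (simp add: lin_def lin_inv_def)

lemma lin_inv_lin:
  assumes "y \<in> E"
  shows "lin_inv (lin y) = y"
proof
  fix i
  show "lin_inv (lin y) i = y i"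
  proof (cases "i < d")
    case True
    have "c i (lin y) = (\<Sum>j<d. y j * c i (e j))"
      by (simp add: lin_def linear_sum[OF linear_c[OF True]] linear_scale[OF linear_c[OF True]])
    also have "\<dots> = (\<Sum>j<d. if j = i then y j else 0)"
      by (intro sum.cong) (auto simp: c_e[OF True])
    also have "\<dots> = y i" using True by simp
    finally show ?thesis using True by (simp add: lin_inv_def)
  next
    case False
    then show ?thesis using assms by (simp add: lin_inv_def topspace_Euclidean_space)
  qed
qed

lemma chart_eq_lin: "x \<in> E \<Longrightarrow> \<phi> x = \<phi> (\<lambda>_. 0) + lin x"
  using chart_eq by (simp add: lin_def)

lemma line_in_E: "x \<in> E \<Longrightarrow> y \<in> E \<Longrightarrow> (\<lambda>i. x i + t * y i) \<in> E"
  by (simp add: topspace_Euclidean_space)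

lemma chart_line:
  assumes "x \<in> E" "y \<in> E"
  shows "\<phi> (\<lambda>i. x i + t * y i) = \<phi> x + t *\<^sub>R lin y"
  unfolding chart_eq_lin[OF line_in_E[OF assms]] chart_eq_lin[OF assms(1)]
  by (simp add: lin_def scaleR_add_left sum.distrib scaleR_sum_right)

lemma chart_in_affine_hull: "x \<in> E \<Longrightarrow> \<phi> x \<in> affine hull P"
  using affine_hull_add_dirs[OF base lin_in_dirs] by (simp add: chart_eq_lin)

lemma \<phi>_\<psi>: "p \<in> affine hull P \<Longrightarrow> \<phi> (\<psi> p) = p"
  using chart_eq_lin[OF \<psi>_in_E, of p] lin_lin_inv[OF affine_hull_diff_in_dirs[OF _ base], of p]
  by (simp add: \<psi>_def)

lemma \<psi>_\<phi>: "x \<in> E \<Longrightarrow> \<psi> (\<phi> x) = x"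
  by (simp add: \<psi>_def chart_eq_lin lin_inv_lin)

lemma \<phi>_\<psi>_P: "p \<in> P \<Longrightarrow> \<phi> (\<psi> p) = p"
  by (rule \<phi>_\<psi>) (rule hull_inc)

lemma \<psi>_in_U: "p \<in> P \<Longrightarrow> \<psi> p \<in> U"
  by (simp add: U_def \<psi>_in_E \<phi>_\<psi>_P)

lemma \<psi>_line: "\<psi> (p + t *\<^sub>R y) = (\<lambda>i. \<psi> p i + t * lin_inv y i)"
proof
  fix i
  show "\<psi> (p + t *\<^sub>R y) i = \<psi> p i + t * lin_inv y i"
  proof (cases "i < d")
    case True
    have "p + t *\<^sub>R y - \<phi> (\<lambda>_. 0) = (p - \<phi> (\<lambda>_. 0)) + t *\<^sub>R y" by simp
    then have "c i (p + t *\<^sub>R y - \<phi> (\<lambda>_. 0)) = c i ((p - \<phi> (\<lambda>_. 0)) + t *\<^sub>R y)" by (rule arg_cong)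
    also have "\<dots> = c i (p - \<phi> (\<lambda>_. 0)) + t * c i y"
      unfolding linear_add[OF linear_c[OF True]] linear_scale[OF linear_c[OF True]] by simp
    finally have "c i (p + t *\<^sub>R y - \<phi> (\<lambda>_. 0)) = c i (p - \<phi> (\<lambda>_. 0)) + t * c i y" .
    then show ?thesis using True by (simp add: \<psi>_def lin_inv_def)
  qed (simp add: \<psi>_def lin_inv_def)
qed

lemma continuous_map_lin: "continuous_map (Euclidean_space d) euclidean lin"
  unfolding lin_def[abs_def]
  by (intro continuous_map_sum continuous_map_scaleR_lcs continuous_map_Euclidean_space_coord) auto

lemma continuous_map_\<phi>: "continuous_map (Euclidean_space d) euclidean \<phi>"
proof -
  have "continuous_map (Euclidean_space d) euclidean (\<lambda>x. \<phi> (\<lambda>_. 0) + lin x)"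
    by (intro continuous_map_add continuous_map_lin) auto
  then show ?thesis by (rule continuous_map_eq) (simp add: chart_eq_lin)
qed

lemma continuous_map_lin_inv: "continuous_map euclidean (Euclidean_space d) lin_inv"
proof (rule continuous_map_into_Euclidean_space)
  fix i assume i: "i < d"
  have "continuous_on UNIV (c i)"
    using linear_c[OF i] by (simp add: linear_continuous_on linear_conv_bounded_linear)
  then show "continuous_map euclidean euclideanreal (\<lambda>s. lin_inv s i)" using i by (simp add: lin_inv_def)
qed (simp add: lin_inv_def)

lemma continuous_map_\<psi>: "continuous_map euclidean (Euclidean_space d) \<psi>"
proof -
  have "continuous_map euclidean euclidean (\<lambda>p. p - \<phi> (\<lambda>_. 0))" by (simp add: continuous_intros)
  from continuous_map_compose[OF this continuous_map_lin_inv] show ?thesis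
    by (simp add: o_def \<psi>_def[abs_def])
qed

lemma U_subset: "U \<subseteq> E" "E \<inter> U = U"
  by (auto simp: U_def)

lemma interior_subset: "interior_in d U \<subseteq> U"
  by (rule interior_of_subset)

lemma rel_interior_imp_interior:
  assumes "x \<in> E" "\<phi> x \<in> rel_interior P"
  shows "x \<in> interior_in d U"
proof -
  let ?S = "{x \<in> E. \<phi> x \<in> rel_interior P}"
  have "continuous_map (Euclidean_space d) (top_of_set (affine hull P)) \<phi>"
    using continuous_map_\<phi> chart_in_affine_hull by (auto simp: continuous_map_in_subtopology)
  then have "openin (Euclidean_space d) ?S"
    by (rule openin_continuous_map_preimage) (rule openin_rel_interior)
  moreover have "?S \<subseteq> U" using rel_interior_subset by (auto simp: U_def)
  ultimately show ?thesis using assms by (auto simp: interior_of_def)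
qed

lemma \<psi>_interior: "p \<in> rel_interior P \<Longrightarrow> \<psi> p \<in> interior_in d U"
  using rel_interior_subset[of P] by (intro rel_interior_imp_interior \<psi>_in_E) (auto simp: \<phi>_\<psi>_P)

lemma eventually_interior_line:
  assumes "x \<in> interior_in d U" "y \<in> E"
  shows "\<forall>\<^sub>F t in nhds (0::real). (\<lambda>i. x i + t * y i) \<in> interior_in d U"
proof -
  have xE: "x \<in> E" using assms interior_subset U_subset by blast
  have "continuous_map euclideanreal (Euclidean_space d) (\<lambda>t i. x i + t * y i)"
  proof (rule continuous_map_into_Euclidean_space)
    fix i
    have "continuous_on UNIV (\<lambda>t. x i + t * y i)" by (intro continuous_intros)
    then show "continuous_map euclideanreal euclideanreal (\<lambda>t. x i + t * y i)" by simp
  qed (use xE assms in \<open>auto simp: topspace_Euclidean_space\<close>)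
  then have "openin euclideanreal {t \<in> topspace euclideanreal. (\<lambda>i. x i + t * y i) \<in> interior_in d U}"
    by (rule openin_continuous_map_preimage) (rule openin_interior_of)
  then have "open {t. (\<lambda>i. x i + t * y i) \<in> interior_in d U}" by simp
  moreover have "0 \<in> {t. (\<lambda>i. x i + t * y i) \<in> interior_in d U}" using assms by simp
  ultimately show ?thesis unfolding eventually_nhds by blast
qed

abbreviation "pull f \<equiv> restrict (f \<circ> \<phi>) U"

text \<open>Isolated because two facts are drawn from it: existence of the directional derivative
  and, \<open>dir_deriv\<close> being a definite description, its value. The equation for order
  \<open>k\<close> is assumed on the whole interior, since the quotient compares neighbouring
  points.\<close>

lemma iter_deriv_pull_step:
  fixes f :: "'e \<Rightarrow> 'y::locally_convex_space"
  assumes f: "Ck (Suc k) P f" and ys: "\<And>j. j < Suc k \<Longrightarrow> ys j \<in> E" and x: "x \<in> interior_in d U"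
    and eq: "\<And>x. x \<in> interior_in d U \<Longrightarrow> iter_deriv k (pull f) ys x = iter_pd k P (\<lambda>j. lin (ys j)) f (\<phi> x)"
  shows "has_dir_deriv (iter_deriv k (pull f) ys) x (ys k) (iter_pd (Suc k) P (\<lambda>j. lin (ys j)) f (\<phi> x))"
proof -
  let ?K = "iter_pd k P (\<lambda>j. lin (ys j)) f"
  have xU: "x \<in> U" "x \<in> E" "\<phi> x \<in> P" using x interior_subset by (auto simp: U_def)
  have yk: "ys k \<in> E" using ys by simp
  have "Ck (Suc 0) P ?K" by (rule Ck_iter_pd[OF convex]) (use f lin_in_dirs in simp_all)
  from Ck_Suc_pd(1)[OF convex this lin_in_dirs[of "ys k"]]
  have "has_line_deriv P (lin (ys k)) ?K (\<phi> x) (iter_pd (Suc k) P (\<lambda>j. lin (ys j)) f (\<phi> x))"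
    using xU unfolding has_dd_def iter_pd_Suc by simp
  then have lim: "((\<lambda>t. (1 / t) *\<^sub>R (?K (\<phi> x + t *\<^sub>R lin (ys k)) - ?K (\<phi> x))) \<longlongrightarrow>
      iter_pd (Suc k) P (\<lambda>j. lin (ys j)) f (\<phi> x)) (at 0 within {t. \<phi> x + t *\<^sub>R lin (ys k) \<in> P})"
    by (simp only: has_line_deriv_def)
  have ev: "\<forall>\<^sub>F t in nhds 0. (\<lambda>i. x i + t * ys k i) \<in> interior_in d U"
    by (rule eventually_interior_line[OF x yk])
  then obtain T where T: "open T" "(0::real) \<in> T" "\<And>t. t \<in> T \<Longrightarrow> (\<lambda>i. x i + t * ys k i) \<in> interior_in d U"
    unfolding eventually_nhds by blast
  have "\<phi> x + t *\<^sub>R lin (ys k) \<in> P" if "t \<in> T" for t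
    using T(3)[OF that] interior_subset chart_line[OF xU(2) yk, of t] by (auto simp: U_def)
  then have "at 0 within {t. \<phi> x + t *\<^sub>R lin (ys k) \<in> P} = at (0::real)"
    by (intro at_within_nhd[OF T(2,1)]) auto
  with lim have lim: "((\<lambda>t. (1 / t) *\<^sub>R (?K (\<phi> x + t *\<^sub>R lin (ys k)) - ?K (\<phi> x))) \<longlongrightarrow>
      iter_pd (Suc k) P (\<lambda>j. lin (ys j)) f (\<phi> x)) (at 0)" by simp
  have "\<forall>\<^sub>F t in at 0. (\<lambda>i. x i + t * ys k i) \<in> interior_in d U"
    using ev eventually_nhds_x_imp_x[OF ev] unfolding eventually_at_filter by (auto elim: eventually_mono)
  then have "\<forall>\<^sub>F t in at 0. (1 / t) *\<^sub>R (?K (\<phi> x + t *\<^sub>R lin (ys k)) - ?K (\<phi> x)) =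
      (1 / t) *\<^sub>R (iter_deriv k (pull f) ys (\<lambda>i. x i + t * ys k i) - iter_deriv k (pull f) ys x)"
    by eventually_elim (simp add: eq x chart_line[OF xU(2) yk])
  then show ?thesis
    unfolding has_dir_deriv_def by (rule Lim_transform_eventually[OF lim])
qed

lemma iter_deriv_pull:
  fixes f :: "'e \<Rightarrow> 'y::locally_convex_space"
  assumes "Ck k P f" "\<And>j. j < k \<Longrightarrow> ys j \<in> E" "x \<in> interior_in d U"
  shows "iter_deriv k (pull f) ys x = iter_pd k P (\<lambda>j. lin (ys j)) f (\<phi> x)"
  using assms
proof (induction k arbitrary: x)
  case 0
  then show ?case using interior_subset by auto
next
  case (Suc k)
  have "has_dir_deriv (iter_deriv k (pull f) ys) x (ys k) (iter_pd (Suc k) P (\<lambda>j. lin (ys j)) f (\<phi> x))"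
    by (rule iter_deriv_pull_step[OF Suc.prems], assumption, rule Suc.IH[OF Ck_SucD[OF Suc.prems(1)]])
      (auto intro: Suc.prems(2))
  then show ?case unfolding iter_deriv.simps by (rule dir_deriv_eq)
qed

lemma has_dir_deriv_pull:
  fixes f :: "'e \<Rightarrow> 'y::locally_convex_space"
  assumes "Ck (Suc k) P f" "\<And>j. j < Suc k \<Longrightarrow> ys j \<in> E" "x \<in> interior_in d U"
  shows "has_dir_deriv (iter_deriv k (pull f) ys) x (ys k) (iter_pd (Suc k) P (\<lambda>j. lin (ys j)) f (\<phi> x))"
  by (rule iter_deriv_pull_step[OF assms], assumption, rule iter_deriv_pull[OF Ck_SucD[OF assms(1)]])
    (auto intro: assms(2))

lemma directions_in_E: "ys \<in> topspace (directions d k) \<Longrightarrow> j < k \<Longrightarrow> ys j \<in> E"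
  by (auto simp: topspace_directions PiE_iff)

lemma continuous_map_direction:
  assumes "j < k"
  shows "continuous_map (deriv_domain d W k) (Euclidean_space d) ((\<lambda>ys. ys j) \<circ> snd)"
  unfolding deriv_domain_def directions_def
  by (rule continuous_map_compose[OF continuous_map_snd continuous_map_product_projection]) (use assms in simp)

lemma continuous_map_deriv_pull:
  fixes f :: "'e \<Rightarrow> 'y::locally_convex_space"
  assumes f: "Ck k P f" and W: "W \<subseteq> U"
  shows "continuous_map (deriv_domain d W k) euclidean (\<lambda>(x, ys). iter_pd k P (\<lambda>j. lin (ys j)) f (\<phi> x))"
proof -
  let ?X = "deriv_domain d W k"
  have fst: "continuous_map ?X (Euclidean_space d) fst"
    unfolding deriv_domain_def
    using continuous_map_fst[of "subtopology (Euclidean_space d) W" "directions d k"]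
    by (simp add: continuous_map_in_subtopology)
  have "continuous_map ?X euclidean (\<lambda>s. iter_pd k P (\<lambda>j. lin (snd s j)) f (\<phi> (fst s)))"
  proof (rule continuous_map_iter_pd[OF convex f])
    have "continuous_map ?X euclidean (\<lambda>s. \<phi> (fst s))"
      using continuous_map_compose[OF fst continuous_map_\<phi>] by (simp add: o_def)
    moreover have "\<phi> (fst s) \<in> P" if "s \<in> topspace ?X" for s
      using that W by (auto simp: topspace_deriv_domain U_def)
    ultimately show "continuous_map ?X (top_of_set P) (\<lambda>s. \<phi> (fst s))"
      by (auto simp: continuous_map_in_subtopology)
    fix j assume j: "j < k"
    from continuous_map_compose[OF continuous_map_direction[OF j] continuous_map_lin]
    show "continuous_map ?X (top_of_set (dirs P)) (\<lambda>s. lin (snd s j))"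
      by (auto simp: continuous_map_in_subtopology o_def lin_in_dirs)
  qed
  then show ?thesis by (simp add: case_prod_unfold)
qed

text \<open>The explicit form of \<open>deriv_ext\<close>: chart-free derivatives already make sense
  up to the boundary.\<close>

definition deriv_pull :: "nat \<Rightarrow> ('e \<Rightarrow> 'y::locally_convex_space) \<Rightarrow> (nat \<Rightarrow> real) \<times> (nat \<Rightarrow> nat \<Rightarrow> real) \<Rightarrow> 'y" where
  "deriv_pull k f = restrict (\<lambda>(x, ys). iter_pd k P (\<lambda>j. lin (ys j)) f (\<phi> x)) (topspace (deriv_domain d U k))"

lemma extends_deriv_pull:
  fixes f :: "'e \<Rightarrow> 'y::locally_convex_space"
  assumes f: "Ck k P f"
  shows "extends_deriv d U k (pull f) (deriv_pull k f)"
  unfolding extends_deriv_def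
proof (intro conjI ballI)
  show "deriv_pull k f \<in> continuous_maps (deriv_domain d U k)"
    unfolding continuous_maps_def deriv_pull_def
    using continuous_map_deriv_pull[OF f order_refl]
    by (auto intro: continuous_map_eq)
  fix x ys assume x: "x \<in> interior_in d U" and ys: "ys \<in> topspace (directions d k)"
  then have "(x, ys) \<in> topspace (deriv_domain d U k)"
    using interior_subset U_subset by (auto simp: topspace_deriv_domain)
  then show "deriv_pull k f (x, ys) = iter_deriv k (pull f) ys x"
    using iter_deriv_pull[OF f directions_in_E[OF ys] x] by (simp add: deriv_pull_def)
qed

lemma Cm_on_pull:
  fixes f :: "'e \<Rightarrow> 'y::locally_convex_space"
  assumes f: "\<And>k. enat k \<le> m \<Longrightarrow> Ck k P f"
  shows "pull f \<in> Cm_on d m U"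
  unfolding Cm_on_def
proof (intro CollectI conjI allI impI)
  have f0: "continuous_on P f" using f[of 0] by (simp add: zero_enat_def[symmetric])
  have "continuous_map (subtopology (Euclidean_space d) U) (top_of_set P) \<phi>"
    using continuous_map_from_subtopology[OF continuous_map_\<phi>] by (auto simp: continuous_map_in_subtopology U_def)
  then have "continuous_map (subtopology (Euclidean_space d) U) euclidean (f \<circ> \<phi>)"
    by (rule continuous_map_compose) (use f0 in simp)
  then show "pull f \<in> continuous_maps (subtopology (Euclidean_space d) U)"
    unfolding continuous_maps_def using U_subset by (auto intro: continuous_map_eq)
  show "Cm_open d m (interior_in d U) (pull f)"
    unfolding Cm_open_def
  proof (intro conjI allI impI ballI)
    fix k x ys assume *: "enat (Suc k) \<le> m" "x \<in> interior_in d U" "ys \<in> topspace (directions d (Suc k))"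
    show "\<exists>v. has_dir_deriv (iter_deriv k (pull f) ys) x (ys k) v"
      using has_dir_deriv_pull[where ys = ys, OF f[OF *(1)] directions_in_E[OF *(3)] *(2)] by blast
  next
    fix k assume k: "enat k \<le> m"
    show "continuous_map (deriv_domain d (interior_in d U) k) euclidean (\<lambda>(x, ys). iter_deriv k (pull f) ys x)"
    proof (rule continuous_map_eq[OF continuous_map_deriv_pull[OF f[OF k] interior_subset]])
      fix s assume "s \<in> topspace (deriv_domain d (interior_in d U) k)"
      then obtain x ys where xy: "s = (x, ys)" "x \<in> interior_in d U" "ys \<in> topspace (directions d k)"
        by (auto simp: topspace_deriv_domain)
      show "(case s of (x, ys) \<Rightarrow> iter_pd k P (\<lambda>j. lin (ys j)) f (\<phi> x)) = (case s of (x, ys) \<Rightarrow> iter_deriv k (pull f) ys x)"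
        using iter_deriv_pull[where ys = ys, OF f[OF k] directions_in_E[OF xy(3)] xy(2)] xy(1) by simp
    qed
  qed
  fix k assume "enat k \<le> m"
  then show "\<exists>h. extends_deriv d U k (pull f) h" using extends_deriv_pull[OF f] by blast
qed

lemma continuous_map_\<psi>_U: "continuous_map (top_of_set P) (subtopology (Euclidean_space d) U) \<psi>"
  using continuous_map_from_subtopology[OF continuous_map_\<psi>] \<psi>_in_U by (auto simp: continuous_map_in_subtopology)

lemma continuous_map_slice:
  "ys \<in> topspace (directions d k) \<Longrightarrow> continuous_map (top_of_set P) (deriv_domain d U k) (\<lambda>p. (\<psi> p, ys))"
  unfolding deriv_domain_def using continuous_map_\<psi>_U by (simp add: continuous_map_pairwise o_def)

lemma continuous_on_slice:
  fixes h :: "_ \<Rightarrow> 'y::locally_convex_space"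
  assumes h: "h \<in> continuous_maps (deriv_domain d U k)" and ys: "ys \<in> topspace (directions d k)"
  shows "continuous_on P (\<lambda>p. h (\<psi> p, ys))"
proof -
  from continuous_map_compose[OF continuous_map_slice[OF ys], of euclidean h] h show ?thesis
    by (simp add: continuous_maps_def o_def)
qed

text \<open>For fixed directions both extensions agree with the iterated derivative over the
  relative interior, hence over \<open>P\<close> by density. This makes the description in
  \<open>deriv_ext\<close> proper.\<close>

lemma extends_deriv_unique:
  fixes g :: "_ \<Rightarrow> 'y::locally_convex_space"
  assumes h: "extends_deriv d U k g h" and h': "extends_deriv d U k g h'"
  shows "h = h'"
proof (rule extensionalityI)
  show "h \<in> extensional (topspace (deriv_domain d U k))" "h' \<in> extensional (topspace (deriv_domain d U k))"
    using h h' by (auto simp: extends_deriv_def continuous_maps_def)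
  fix s assume s: "s \<in> topspace (deriv_domain d U k)"
  then obtain x ys where xy: "s = (x, ys)" "x \<in> U" "x \<in> E" "ys \<in> topspace (directions d k)"
    by (auto simp: topspace_deriv_domain)
  have "h (\<psi> (\<phi> x), ys) = h' (\<psi> (\<phi> x), ys)"
  proof (rule continuous_eq_from_rel_interior[OF convex _ _ open_UNIV _ _ UNIV_I, of "\<lambda>p. h (\<psi> p, ys)" "\<lambda>p. h' (\<psi> p, ys)"])
    show "continuous_on P (\<lambda>p. h (\<psi> p, ys))" "continuous_on P (\<lambda>p. h' (\<psi> p, ys))"
      using h h' by (auto intro!: continuous_on_slice xy(4) simp: extends_deriv_def)
    show "\<phi> x \<in> P" using xy by (simp add: U_def)
    fix p assume "p \<in> rel_interior P"
    then show "h (\<psi> p, ys) = h' (\<psi> p, ys)"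
      using \<psi>_interior h h' xy(4) by (auto simp: extends_deriv_def)
  qed
  then show "h s = h' s" using xy by (simp add: \<psi>_\<phi>)
qed

lemma deriv_ext_pull:
  fixes f :: "'e \<Rightarrow> 'y::locally_convex_space"
  assumes "Ck k P f"
  shows "deriv_ext d U k (pull f) = deriv_pull k f"
  unfolding deriv_ext_def using extends_deriv_pull[OF assms] extends_deriv_unique by blast

text \<open>With fixed directions, the continuous extensions of the differentials are pulled back to
  \<open>P\<close> by \<psi>. In the relative interior each is a derivative of the preceding one,
  hence on all of \<open>P\<close> by \<open>has_dd_from_rel_interior\<close>; order 0 gives back
  \<open>f\<close>.\<close>

lemma Ck_of_Cm_on:
  fixes f :: "'e \<Rightarrow> 'y::locally_convex_space"
  assumes g: "pull f \<in> Cm_on d m U" and m: "enat k \<le> m"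
  shows "Ck k P f"
proof -
  let ?g = "pull f"
  have "\<forall>k. \<exists>h. enat k \<le> m \<longrightarrow> extends_deriv d U k ?g h" using g by (auto simp: Cm_on_def)
  then obtain h where h: "\<And>k. enat k \<le> m \<Longrightarrow> extends_deriv d U k ?g (h k)" by metis
  have der: "\<exists>v. has_dir_deriv (iter_deriv k ?g ys) x (ys k) v"
    if "enat (Suc k) \<le> m" "x \<in> interior_in d U" "ys \<in> topspace (directions d (Suc k))" for k x ys
    using g that by (auto simp: Cm_on_def Cm_open_def)
  \<comment> \<open>Directions in coordinates, cut off at \<open>k\<close> because the points of
    \<open>directions d k\<close> are extensional.\<close>
  define dl where "dl k zs = (\<lambda>j\<in>{..<k}. lin_inv (zs j))" for k :: nat and zs :: "nat \<Rightarrow> 'e"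
  define D where "D k zs p = h k (\<psi> p, dl k zs)" for k and zs :: "nat \<Rightarrow> 'e" and p
  have dl: "dl k zs \<in> topspace (directions d k)" for k zs
    using lin_inv_in_E by (auto simp: dl_def topspace_directions)
  have D_cont: "continuous_on P (D k zs)" if "enat k \<le> m" for k zs
    unfolding D_def[abs_def] using h[OF that] by (auto intro!: continuous_on_slice dl simp: extends_deriv_def)
  have D_int: "D k zs p = iter_deriv k ?g (dl k zs) (\<psi> p)" if "enat k \<le> m" "p \<in> rel_interior P" for k zs p
    using h[OF that(1)] \<psi>_interior[OF that(2)] dl by (auto simp: D_def extends_deriv_def)
  have D_cong: "D k zs = D k zs'" if "\<And>j. j < k \<Longrightarrow> zs j = zs' j" for k zs zs'
  proof -
    have "dl k zs = dl k zs'" using that by (auto simp: dl_def)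
    then show ?thesis by (simp add: D_def[abs_def])
  qed
  have D_dd: "has_dd P (zs k) (D k zs) (D (Suc k) zs)" if k: "enat (Suc k) \<le> m" for k zs
  proof -
    have k': "enat k \<le> m" using k by (metis Suc_ile_eq order_less_imp_le)
    show ?thesis
    proof (rule has_dd_from_rel_interior[OF convex D_cont[OF k'] D_cont[OF k]])
      fix p assume p: "p \<in> rel_interior P"
      let ?ys = "dl (Suc k) zs"
      have ysk: "?ys k = lin_inv (zs k)" by (simp add: dl_def)
      have eqk: "iter_deriv k ?g (dl k zs) = iter_deriv k ?g ?ys"
        by (rule iter_deriv_cong_dirs) (simp add: dl_def)
      obtain v where v: "has_dir_deriv (iter_deriv k ?g ?ys) (\<psi> p) (?ys k) v"
        using der[OF k \<psi>_interior[OF p] dl] by blast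
      then have "D (Suc k) zs p = v" using D_int[OF k p] dir_deriv_eq by simp
      with v have "((\<lambda>t. (1 / t) *\<^sub>R (iter_deriv k ?g ?ys (\<lambda>i. \<psi> p i + t * lin_inv (zs k) i) -
          iter_deriv k ?g ?ys (\<psi> p))) \<longlongrightarrow> D (Suc k) zs p) (at 0)"
        by (simp add: has_dir_deriv_def ysk)
      then have lim: "((\<lambda>t. (1 / t) *\<^sub>R (iter_deriv k ?g ?ys (\<psi> (p + t *\<^sub>R zs k)) -
          iter_deriv k ?g ?ys (\<psi> p))) \<longlongrightarrow> D (Suc k) zs p) (at 0 within {t. p + t *\<^sub>R zs k \<in> rel_interior P})"
        unfolding \<psi>_line by (rule tendsto_within_subset) simp
      have "\<forall>\<^sub>F t in at 0 within {t. p + t *\<^sub>R zs k \<in> rel_interior P}.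
          (1 / t) *\<^sub>R (iter_deriv k ?g ?ys (\<psi> (p + t *\<^sub>R zs k)) - iter_deriv k ?g ?ys (\<psi> p)) =
          (1 / t) *\<^sub>R (D k zs (p + t *\<^sub>R zs k) - D k zs p)"
        unfolding eventually_at_filter using p by (simp add: D_int[OF k'] eqk)
      from Lim_transform_eventually[OF lim this]
      show "has_line_deriv (rel_interior P) (zs k) (D k zs) p (D (Suc k) zs p)"
        unfolding has_line_deriv_def .
    qed
  qed
  have "Ck j P (D k zs)" if "enat (k + j) \<le> m" for j k zs
    using that
  proof (induction j arbitrary: k zs)
    case 0
    then show ?case using D_cont by simp
  next
    case (Suc j)
    have k: "enat (Suc k) \<le> m" using Suc.prems by (rule order_trans[rotated]) simp
    show ?case
      unfolding Ck.simps
    proof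
      fix y assume "y \<in> dirs P"
      \<comment> \<open>Directions from index \<open>k\<close> on do not affect \<open>D k\<close>,
        so the next one may be taken to be \<open>y\<close>.\<close>
      have "D k zs = D k (zs(k := y))" by (rule D_cong) simp
      then have "has_dd P y (D k zs) (D (Suc k) (zs(k := y)))" using D_dd[OF k, of "zs(k := y)"] by simp
      moreover have "Ck j P (D (Suc k) (zs(k := y)))" by (rule Suc.IH) (use Suc.prems in simp)
      ultimately show "\<exists>g. has_dd P y (D k zs) g \<and> Ck j P g" by blast
    qed
  qed
  from this[of 0 k "\<lambda>_. 0"] m have "Ck k P (D 0 (\<lambda>_. 0))" by simp
  moreover have "D 0 (\<lambda>_. 0) p = f p" if p: "p \<in> P" for p
  proof (rule continuous_eq_from_rel_interior[OF convex _ _ open_UNIV _ p UNIV_I])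
    have 0: "enat 0 \<le> m" by (simp add: zero_enat_def[symmetric])
    show "continuous_on P (D 0 (\<lambda>_. 0))" by (rule D_cont[OF 0])
    have "continuous_map (subtopology (Euclidean_space d) U) euclidean ?g"
      using g by (simp add: Cm_on_def continuous_maps_def)
    with continuous_map_\<psi>_U have "continuous_map (top_of_set P) euclidean (?g \<circ> \<psi>)" by (rule continuous_map_compose)
    then have "continuous_map (top_of_set P) euclidean f"
      by (rule continuous_map_eq) (simp add: \<psi>_in_U \<phi>_\<psi>_P)
    then show "continuous_on P f" by simp
    fix q assume q: "q \<in> rel_interior P"
    then have "q \<in> P" using rel_interior_subset by blast
    then show "D 0 (\<lambda>_. 0) q = f q" using D_int[OF 0 q] by (simp add: \<psi>_in_U \<phi>_\<psi>_P)
  qed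
  ultimately show ?thesis using Ck_cong[of P "D 0 (\<lambda>_. 0)" f] by blast
qed

lemma pull_in_Cm_on_iff:
  fixes f :: "'e \<Rightarrow> 'y::locally_convex_space"
  shows "pull f \<in> Cm_on d m U \<longleftrightarrow> (\<forall>k. enat k \<le> m \<longrightarrow> Ck k P f)"
  using Ck_of_Cm_on Cm_on_pull by blast

text \<open>Compactness of \<open>K\<close> bounds the directions that occur, and
  \<open>iter_pd_uniform_bounded\<close> handles bounded directions.\<close>

lemma uniform_conv_deriv_pull:
  fixes f :: "'e \<Rightarrow> 'y::locally_convex_space"
  assumes P: "compact P" and f: "Ck k P f" and u: "\<forall>\<^sub>F i in F. Ck k P (u i)"
    and conv: "Ck_conv k P u f F" and K: "compactin (deriv_domain d U k) K"
  shows "uniform_conv K (\<lambda>i. deriv_pull k (u i)) (deriv_pull k f) F"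
proof -
  have Ksub: "K \<subseteq> topspace (deriv_domain d U k)" using K by (rule compactin_subset_topspace)
  have "\<exists>R. \<forall>s\<in>K. norm (lin (snd s j)) \<le> R" if j: "j < k" for j
  proof -
    from continuous_map_compose[OF continuous_map_direction[OF j] continuous_map_lin]
    have "compactin euclidean ((lin \<circ> ((\<lambda>ys. ys j) \<circ> snd)) ` K)" by (rule image_compactin[OF K])
    then have "bounded ((lin \<circ> ((\<lambda>ys. ys j) \<circ> snd)) ` K)" by (simp add: compact_imp_bounded)
    then show ?thesis by (auto simp: bounded_iff)
  qed
  then obtain R where R: "\<And>j s. j < k \<Longrightarrow> s \<in> K \<Longrightarrow> norm (lin (snd s j)) \<le> R j" by metis
  define R' where "R' = (\<Sum>j<k. \<bar>R j\<bar>)"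
  have R': "norm (lin (snd s j)) \<le> R'" if "j < k" "s \<in> K" for j s
  proof -
    have "\<bar>R j\<bar> \<le> R'" unfolding R'_def using that by (intro member_le_sum) auto
    then show ?thesis using R[OF that] by linarith
  qed
  show ?thesis
    unfolding uniform_conv_def
  proof (intro allI impI)
    fix V :: "'y set" assume V: "open V" "0 \<in> V"
    from iter_pd_uniform_bounded[OF convex f u conv V, of R']
    show "\<forall>\<^sub>F i in F. \<forall>s\<in>K. deriv_pull k (u i) s - deriv_pull k f s \<in> V"
    proof eventually_elim
      case (elim i)
      show ?case
      proof
        fix s assume s: "s \<in> K"
        obtain x ys where xy: "s = (x, ys)" by force
        have sX: "(x, ys) \<in> topspace (deriv_domain d U k)" using s Ksub xy by blast
        then have "\<phi> x \<in> P" by (auto simp: topspace_deriv_domain U_def)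
        moreover have "\<forall>j<k. lin (ys j) \<in> dirs P \<and> norm (lin (ys j)) \<le> R'"
          using R'[OF _ s] xy lin_in_dirs by auto
        ultimately have "iter_pd k P (\<lambda>j. lin (ys j)) (u i) (\<phi> x) - iter_pd k P (\<lambda>j. lin (ys j)) f (\<phi> x) \<in> V"
          using elim[rule_format, of "\<phi> x" "\<lambda>j. lin (ys j)"] by simp
        then show "deriv_pull k (u i) s - deriv_pull k f s \<in> V" using sX by (simp add: deriv_pull_def xy)
      qed
    qed
  qed
qed

text \<open>For fixed directions \<open>P\<close> embeds as a slice of the
  \<open>deriv_domain\<close>, and the slice is compact because \<open>P\<close> is.\<close>

lemma uniform_conv_of_deriv_pull:
  fixes f :: "'e \<Rightarrow> 'y::locally_convex_space"
  assumes P: "compact P" and zs: "\<And>j. zs j \<in> dirs P"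
    and conv: "\<And>K. compactin (deriv_domain d U k) K \<Longrightarrow> uniform_conv K (\<lambda>i. deriv_pull k (u i)) (deriv_pull k f) F"
  shows "uniform_conv P (\<lambda>i. iter_pd k P zs (u i)) (iter_pd k P zs f) F"
proof -
  define ys where "ys = (\<lambda>j\<in>{..<k}. lin_inv (zs j))"
  have ys: "ys \<in> topspace (directions d k)"
    using lin_inv_in_E by (auto simp: ys_def topspace_directions)
  have "compactin (deriv_domain d U k) ((\<lambda>p. (\<psi> p, ys)) ` P)"
    by (rule image_compactin[OF _ continuous_map_slice[OF ys]]) (use P in simp)
  from uniform_conv_image[OF order_refl conv[OF this]]
  have conv': "uniform_conv P (\<lambda>i p. deriv_pull k (u i) (\<psi> p, ys)) (\<lambda>p. deriv_pull k f (\<psi> p, ys)) F" .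
  have "deriv_pull k v (\<psi> p, ys) = iter_pd k P zs v p" if p: "p \<in> P" for v :: "'e \<Rightarrow> 'y" and p
  proof -
    have "(\<psi> p, ys) \<in> topspace (deriv_domain d U k)"
      using p ys \<psi>_in_U \<psi>_in_E by (auto simp: topspace_deriv_domain)
    then have "deriv_pull k v (\<psi> p, ys) = iter_pd k P (\<lambda>j. lin (ys j)) v p"
      by (simp add: deriv_pull_def \<phi>_\<psi>_P[OF p])
    also have "iter_pd k P (\<lambda>j. lin (ys j)) v = iter_pd k P zs v"
      by (rule iter_pd_cong_dirs) (simp add: ys_def lin_lin_inv zs)
    finally show ?thesis .
  qed
  note eq = this
  show ?thesis by (rule uniform_conv_cong[OF _ _ conv']) (simp_all add: eq)
qed

lemma limitin_Cm_on_pull: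
  fixes f :: "'e \<Rightarrow> 'y::locally_convex_space"
  assumes P: "compact P" and f: "pull f \<in> Cm_on d m U" and u: "\<forall>\<^sub>F i in F. pull (u i) \<in> Cm_on d m U"
  shows "limitin (Cm_on_topology d m U) (\<lambda>i. pull (u i)) (pull f) F \<longleftrightarrow>
    (\<forall>k. enat k \<le> m \<longrightarrow> Ck_conv k P u f F)"
proof -
  have de: "deriv_ext d U k g \<in> continuous_maps (deriv_domain d U k)" if g: "enat k \<le> m" "g \<in> Cm_on d m U" for k and g :: "_ \<Rightarrow> 'y"
  proof -
    obtain h where h: "extends_deriv d U k g h" using g by (auto simp: Cm_on_def)
    then have "deriv_ext d U k g = h" unfolding deriv_ext_def using extends_deriv_unique by blast
    then show ?thesis using h by (simp add: extends_deriv_def)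
  qed
  have fk: "Ck k P f" if "enat k \<le> m" for k using Ck_of_Cm_on[OF f that] .
  have uk: "\<forall>\<^sub>F i in F. Ck k P (u i)" if "enat k \<le> m" for k
    using u by eventually_elim (rule Ck_of_Cm_on[OF _ that])
  have "limitin (compact_open_topology (deriv_domain d U k)) (\<lambda>i. deriv_ext d U k (pull (u i))) (deriv_ext d U k (pull f)) F
      \<longleftrightarrow> (\<forall>K. compactin (deriv_domain d U k) K \<longrightarrow> uniform_conv K (\<lambda>i. deriv_pull k (u i)) (deriv_pull k f) F)"
    (is "?L k = ?R k") if k: "enat k \<le> m" for k
  proof -
    have "\<forall>\<^sub>F i in F. deriv_ext d U k (pull (u i)) \<in> continuous_maps (deriv_domain d U k)"
      using u by eventually_elim (rule de[OF k])
    then have "?L k \<longleftrightarrow> (\<forall>K. compactin (deriv_domain d U k) K \<longrightarrow>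
        uniform_conv K (\<lambda>i. deriv_ext d U k (pull (u i))) (deriv_ext d U k (pull f)) F)"
      by (rule limitin_compact_open[OF _ de[OF k f]])
    moreover have "uniform_conv K (\<lambda>i. deriv_ext d U k (pull (u i))) (deriv_ext d U k (pull f)) F \<longleftrightarrow>
        uniform_conv K (\<lambda>i. deriv_pull k (u i)) (deriv_pull k f) F" for K
    proof -
      have ev: "\<forall>\<^sub>F i in F. deriv_ext d U k (pull (u i)) = deriv_pull k (u i)"
        using uk[OF k] by eventually_elim (rule deriv_ext_pull)
      show ?thesis
        unfolding deriv_ext_pull[OF fk[OF k]]
      proof
        show "uniform_conv K (\<lambda>i. deriv_ext d U k (pull (u i))) (deriv_pull k f) F \<Longrightarrow>
          uniform_conv K (\<lambda>i. deriv_pull k (u i)) (deriv_pull k f) F"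
          by (rule uniform_conv_cong[rotated 2]) (use ev in \<open>auto elim: eventually_mono\<close>)
        show "uniform_conv K (\<lambda>i. deriv_pull k (u i)) (deriv_pull k f) F \<Longrightarrow>
          uniform_conv K (\<lambda>i. deriv_ext d U k (pull (u i))) (deriv_pull k f) F"
          by (rule uniform_conv_cong[rotated 2]) (use ev in \<open>auto elim: eventually_mono\<close>)
      qed
    qed
    ultimately show ?thesis by (simp only:)
  qed
  then have "limitin (Cm_on_topology d m U) (\<lambda>i. pull (u i)) (pull f) F \<longleftrightarrow> (\<forall>k. enat k \<le> m \<longrightarrow>
      (\<forall>K. compactin (deriv_domain d U k) K \<longrightarrow> uniform_conv K (\<lambda>i. deriv_pull k (u i)) (deriv_pull k f) F))"
    using limitin_Cm_on_topology[OF f u de] by simp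
  also have "\<dots> \<longleftrightarrow> (\<forall>k. enat k \<le> m \<longrightarrow> Ck_conv k P u f F)"
  proof
    assume *: "\<forall>k. enat k \<le> m \<longrightarrow>
      (\<forall>K. compactin (deriv_domain d U k) K \<longrightarrow> uniform_conv K (\<lambda>i. deriv_pull k (u i)) (deriv_pull k f) F)"
    show "\<forall>k. enat k \<le> m \<longrightarrow> Ck_conv k P u f F"
    proof (intro allI impI)
      fix k assume k: "enat k \<le> m"
      show "Ck_conv k P u f F"
      proof (rule Ck_convI_iter_pd[OF convex fk[OF k] uk[OF k]])
        fix j and zs :: "nat \<Rightarrow> 'e" assume j: "j \<le> k" and zs: "\<And>i. zs i \<in> dirs P"
        have "enat j \<le> m" using j k by (meson enat_ord_simps(1) order_trans)
        then show "uniform_conv P (\<lambda>i. iter_pd j P zs (u i)) (iter_pd j P zs f) F"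
          using * by (intro uniform_conv_of_deriv_pull[OF P zs]) auto
      qed
    qed
  next
    assume "\<forall>k. enat k \<le> m \<longrightarrow> Ck_conv k P u f F"
    then show "\<forall>k. enat k \<le> m \<longrightarrow>
      (\<forall>K. compactin (deriv_domain d U k) K \<longrightarrow> uniform_conv K (\<lambda>i. deriv_pull k (u i)) (deriv_pull k f) F)"
      using uniform_conv_deriv_pull[OF P fk uk] by blast
  qed
  finally show ?thesis .
qed

end

text \<open>Compatibility with lines makes the chart minus its value at 0 linear. Injectivity then
  gives independence of the images of the unit vectors, and surjectivity makes them span
  \<open>dirs P\<close>.\<close>

lemma convex_chart_of_affine_chart:
  fixes P :: "'e::euclidean_space set"
  assumes P: "convex P" and ch: "affine_chart d (affine hull P) \<phi>"
  shows "\<exists>e c. convex_chart P d \<phi> e c"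
proof -
  let ?E = "topspace (Euclidean_space d)"
  let ?z = "\<lambda>_::nat. 0::real"
  have bij: "bij_betw \<phi> ?E (affine hull P)"
    and aff: "\<And>x y t. x \<in> ?E \<Longrightarrow> y \<in> ?E \<Longrightarrow> \<phi> (\<lambda>i. (1 - t) * x i + t * y i) = (1 - t) *\<^sub>R \<phi> x + t *\<^sub>R \<phi> y"
    using ch by (auto simp: affine_chart_def)
  have E: "x \<in> ?E \<longleftrightarrow> (\<forall>i\<ge>d. x i = 0)" for x by (simp add: topspace_Euclidean_space)
  have zE: "?z \<in> ?E" by (simp add: E)
  define \<delta> where "\<delta> i = (\<lambda>j. if j = i then 1 else 0 :: real)" for i :: nat
  have \<delta>E: "\<delta> i \<in> ?E" if "i < d" for i using that by (auto simp: E \<delta>_def)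
  define \<phi>' where "\<phi>' x = \<phi> x - \<phi> ?z" for x
  have scale: "\<phi>' (\<lambda>i. t * x i) = t *\<^sub>R \<phi>' x" if "x \<in> ?E" for t x
    using aff[OF zE that, of t] by (simp add: \<phi>'_def algebra_simps)
  have add: "\<phi>' (\<lambda>i. x i + y i) = \<phi>' x + \<phi>' y" if "x \<in> ?E" "y \<in> ?E" for x y
  proof -
    \<comment> \<open>The sum of \<open>x\<close> and \<open>y\<close> is the midpoint of their
      doubles, which brings it onto a line.\<close>
    have "(\<lambda>i. 2 * x i) \<in> ?E" "(\<lambda>i. 2 * y i) \<in> ?E" using that by (auto simp: E)
    from aff[OF this, of "1/2"] have "\<phi> (\<lambda>i. x i + y i) = (1/2) *\<^sub>R \<phi> (\<lambda>i. 2 * x i) + (1/2) *\<^sub>R \<phi> (\<lambda>i. 2 * y i)"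
      by simp
    moreover have "\<phi> (\<lambda>i. 2 * x i) = \<phi> ?z + 2 *\<^sub>R \<phi>' x" "\<phi> (\<lambda>i. 2 * y i) = \<phi> ?z + 2 *\<^sub>R \<phi>' y"
      using scale[of x 2] scale[of y 2] that by (simp_all add: \<phi>'_def algebra_simps)
    ultimately have "\<phi> (\<lambda>i. x i + y i) = ((1/2) *\<^sub>R \<phi> ?z + (1/2) *\<^sub>R \<phi> ?z) + (\<phi>' x + \<phi>' y)"
      by (simp add: scaleR_add_right)
    then show ?thesis unfolding scaleR_left_distrib[symmetric] by (simp add: \<phi>'_def)
  qed
  define e where "e i = \<phi>' (\<delta> i)" for i
  have sum: "\<phi>' (\<lambda>i. if i < k then x i else 0) = (\<Sum>i<k. x i *\<^sub>R e i)" if "k \<le> d" for k x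
    using that
  proof (induction k)
    case 0
    then show ?case by (simp add: \<phi>'_def)
  next
    case (Suc k)
    have eq: "(\<lambda>i. if i < Suc k then x i else 0) = (\<lambda>i. (if i < k then x i else 0) + x k * \<delta> k i)"
      by (auto simp: \<delta>_def fun_eq_iff less_Suc_eq)
    have mem: "(\<lambda>i. if i < k then x i else 0) \<in> ?E" "(\<lambda>i. x k * \<delta> k i) \<in> ?E"
      using Suc.prems by (auto simp: E \<delta>_def)
    show ?case unfolding eq add[OF mem]
      using Suc scale[OF \<delta>E, of k "x k"] by (simp add: e_def)
  qed
  have sum': "\<phi>' x = (\<Sum>i<d. x i *\<^sub>R e i)" if "x \<in> ?E" for x
  proof -
    have "(\<lambda>i. if i < d then x i else 0) = x" using that by (auto simp: E fun_eq_iff)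
    then show ?thesis using sum[of d x] by simp
  qed
  have inj: "x = y" if "x \<in> ?E" "y \<in> ?E" "\<phi>' x = \<phi>' y" for x y
    using that bij by (auto simp: \<phi>'_def bij_betw_def dest: inj_onD)
  have inj_e: "inj_on e {..<d}"
  proof (rule inj_onI)
    fix i j assume "i \<in> {..<d}" "j \<in> {..<d}" "e i = e j"
    then have "\<delta> i = \<delta> j" using inj \<delta>E by (auto simp: e_def)
    then have "\<delta> i i = \<delta> j i" by simp
    then show "i = j" by (auto simp: \<delta>_def split: if_splits)
  qed
  have ind: "independent (e ` {..<d})"
  proof (rule independent_if_scalars_zero)
    fix f x assume s: "(\<Sum>x\<in>e ` {..<d}. f x *\<^sub>R x) = 0" and x: "x \<in> e ` {..<d}"
    let ?x = "\<lambda>i. if i < d then f (e i) else 0"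
    have xE: "?x \<in> ?E" by (simp add: E)
    have "(\<Sum>i<d. f (e i) *\<^sub>R e i) = 0" using s by (simp add: sum.reindex[OF inj_e])
    then have "\<phi>' ?x = 0" by (simp add: sum'[OF xE])
    then have "?x = ?z" by (intro inj xE zE) (simp add: \<phi>'_def)
    moreover obtain i where "i < d" "x = e i" using x by auto
    ultimately show "f x = 0" by (metis (full_types))
  qed simp
  obtain c where c: "\<And>b. b \<in> e ` {..<d} \<Longrightarrow> linear (c b)"
    "\<And>b b'. b \<in> e ` {..<d} \<Longrightarrow> b' \<in> e ` {..<d} \<Longrightarrow> c b b' = (if b = b' then 1 else 0)"
    "\<And>y. y \<in> span (e ` {..<d}) \<Longrightarrow> (\<Sum>b\<in>e ` {..<d}. c b y *\<^sub>R b) = y"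
    by (rule dual_basis[OF ind]) (rule that)
  have \<phi>_mem: "\<phi> x \<in> affine hull P" if "x \<in> ?E" for x
    using bij that by (auto simp: bij_betw_def)
  have "convex_chart P d \<phi> e (\<lambda>i. c (e i))"
  proof (rule convex_chart.intro)
    show "convex P" by fact
    show "\<phi> x = \<phi> ?z + (\<Sum>i<d. x i *\<^sub>R e i)" if "x \<in> ?E" for x
      using sum'[OF that] by (simp add: \<phi>'_def algebra_simps)
    show "\<phi> ?z \<in> affine hull P" using \<phi>_mem zE by blast
    show "e i \<in> dirs P" if "i < d" for i
      unfolding e_def \<phi>'_def by (rule affine_hull_diff_in_dirs[OF \<phi>_mem[OF \<delta>E[OF that]] \<phi>_mem[OF zE]])
    show "linear (c (e i))" if "i < d" for i using that by (intro c(1)) auto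
    show "c (e i) (e j) = (if i = j then 1 else 0)" if "i < d" "j < d" for i j
      using c(2)[of "e i" "e j"] that inj_onD[OF inj_e, of i j] by auto
    show "(\<Sum>i<d. c (e i) y *\<^sub>R e i) = y" if y: "y \<in> dirs P" for y
    proof -
      have "\<phi> ?z + y \<in> affine hull P" by (rule affine_hull_add_dirs[OF \<phi>_mem[OF zE] y])
      then have "\<phi> ?z + y \<in> \<phi> ` ?E" using bij by (simp only: bij_betw_def)
      then obtain x where x: "x \<in> ?E" "\<phi> x = \<phi> ?z + y" by (metis imageE)
      then have "y = (\<Sum>i<d. x i *\<^sub>R e i)" using sum'[OF x(1)] by (simp add: \<phi>'_def)
      moreover have "(\<Sum>i<d. x i *\<^sub>R e i) \<in> span (e ` {..<d})"
        by (intro span_sum span_scale span_base) auto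
      ultimately have "y \<in> span (e ` {..<d})" by (simp only:)
      from c(3)[OF this] show ?thesis by (simp add: sum.reindex[OF inj_e])
    qed
  qed
  then show ?thesis by blast
qed

section \<open>Existence of charts\<close>

lemma span_translate_eq_dirs:
  assumes "a \<in> P"
  shows "span ((\<lambda>x. - a + x) ` P) = dirs P"
proof
  show "span ((\<lambda>x. - a + x) ` P) \<subseteq> dirs P"
    by (rule span_minimal) (use assms diff_in_dirs in \<open>force+\<close>)
  show "dirs P \<subseteq> span ((\<lambda>x. - a + x) ` P)"
    unfolding dirs_def
  proof (rule span_minimal[OF _ subspace_span], rule subsetI)
    fix z assume "z \<in> {x - y | x y. x \<in> P \<and> y \<in> P}"
    then obtain x y where z: "z = (- a + x) - (- a + y)" "x \<in> P" "y \<in> P" by auto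
    show "z \<in> span ((\<lambda>x. - a + x) ` P)"
      unfolding z(1) by (intro span_diff span_base) (use z in auto)
  qed
qed

lemma aff_dim_eq_dim_dirs:
  assumes "P \<noteq> {}"
  shows "aff_dim P = int (dim (dirs P))"
proof -
  obtain a where a: "a \<in> P" using assms by blast
  then have "aff_dim P = int (dim ((\<lambda>x. - a + x) ` P))" by (intro aff_dim_eq_dim hull_inc)
  then show ?thesis by (metis dim_span span_translate_eq_dirs[OF a])
qed

text \<open>Gives meaning to the choice in \<open>chart\<close>: a point of \<open>P\<close> as
  origin and a basis of \<open>dirs P\<close>, of length \<open>pdim P\<close>, define a
  chart.\<close>

lemma affine_chart_exists:
  fixes P :: "'e::euclidean_space set"
  assumes P: "convex P" "P \<noteq> {}"
  shows "\<exists>\<phi>. affine_chart (pdim P) (affine hull P) \<phi>"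
proof -
  obtain a where a: "a \<in> P" using P by blast
  obtain B where B: "B \<subseteq> dirs P" "independent B" "dirs P \<subseteq> span B" "card B = dim (dirs P)"
    by (rule basis_exists)
  have fin: "finite B" by (rule independent_imp_finite[OF B(2)])
  have card: "card B = pdim P" using aff_dim_eq_dim_dirs[OF P(2)] B(4) by (simp add: pdim_def)
  obtain e where e: "bij_betw e {0..<card B} B" using ex_bij_betw_nat_finite[OF fin] by blast
  then have e: "inj_on e {..<pdim P}" "e ` {..<pdim P} = B"
    by (auto simp: bij_betw_def card lessThan_atLeast0)
  obtain c where c: "\<And>b. b \<in> B \<Longrightarrow> linear (c b)"
    "\<And>b b'. b \<in> B \<Longrightarrow> b' \<in> B \<Longrightarrow> c b b' = (if b = b' then 1 else 0)"
    "\<And>y. y \<in> span B \<Longrightarrow> (\<Sum>b\<in>B. c b y *\<^sub>R b) = y"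
    by (rule dual_basis[OF B(2)]) (rule that)
  define \<phi> where "\<phi> x = a + (\<Sum>i<pdim P. x i *\<^sub>R e i)" for x :: "nat \<Rightarrow> real"
  have eB: "e i \<in> B" if "i < pdim P" for i using e(2) that by auto
  interpret convex_chart P "pdim P" \<phi> e "\<lambda>i. c (e i)"
  proof (rule convex_chart.intro)
    show "convex P" by fact
    show "\<phi> x = \<phi> (\<lambda>_. 0) + (\<Sum>i<pdim P. x i *\<^sub>R e i)" for x by (simp add: \<phi>_def)
    show "\<phi> (\<lambda>_. 0) \<in> affine hull P" using a by (simp add: \<phi>_def hull_inc)
    show "e i \<in> dirs P" if "i < pdim P" for i using eB[OF that] B(1) by auto
    show "linear (c (e i))" if "i < pdim P" for i using c(1)[OF eB[OF that]] .
    show "c (e i) (e j) = (if i = j then 1 else 0)" if "i < pdim P" "j < pdim P" for i j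
      using c(2)[OF eB[OF that(1)] eB[OF that(2)]] that inj_onD[OF e(1), of i j] by auto
    show "(\<Sum>i<pdim P. c (e i) y *\<^sub>R e i) = y" if "y \<in> dirs P" for y
      using c(3)[of y] that B(3) sum.reindex[OF e(1), of "\<lambda>b. c b y *\<^sub>R b"] by (auto simp: e(2))
  qed
  have "bij_betw \<phi> E (affine hull P)"
    by (rule bij_betw_byWitness[of _ \<psi>]) (auto simp: \<psi>_\<phi> \<phi>_\<psi> \<psi>_in_E chart_in_affine_hull)
  moreover have "\<phi> (\<lambda>i. (1 - t) * x i + t * y i) = (1 - t) *\<^sub>R \<phi> x + t *\<^sub>R \<phi> y" for x y t
    by (simp add: \<phi>_def scaleR_sum_right algebra_simps sum.distrib sum_subtractf)
  ultimately show ?thesis unfolding affine_chart_def by blast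
qed

lemma convex_chart_chart:
  fixes P :: "'e::euclidean_space set"
  assumes "convex P" "P \<noteq> {}"
  shows "\<exists>e c. convex_chart P (pdim P) (chart P) e c"
  using convex_chart_of_affine_chart[OF assms(1)] someI_ex[OF affine_chart_exists[OF assms]]
  unfolding chart_def by blast

section \<open>\<open>Cm\<close> and its topology without charts\<close>

lemma Cm_iff:
  fixes f :: "'e::euclidean_space \<Rightarrow> 'y::locally_convex_space"
  assumes P: "convex P" "P \<noteq> {}"
  shows "f \<in> Cm m P \<longleftrightarrow> f \<in> extensional P \<and> (\<forall>k. enat k \<le> m \<longrightarrow> Ck k P f)"
proof -
  obtain e c where "convex_chart P (pdim P) (chart P) e c" using convex_chart_chart[OF P] by blast
  then interpret convex_chart P "pdim P" "chart P" e c .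
  show ?thesis using pull_in_Cm_on_iff[of f m]
    by (simp add: Cm_def transport_def chart_domain_def U_def)
qed

text \<open>Ensures that the pullback topology lives on all of \<open>Cm m P\<close>: the space of
  \<open>Cm_on_topology\<close> is a union of subbasic sets, and the one for order 0 is large
  enough.\<close>

lemma transport_Cm_subset_topspace:
  fixes P :: "'e::euclidean_space set"
  assumes P: "convex P" "P \<noteq> {}"
  shows "transport P ` (Cm m P :: ('e \<Rightarrow> 'y::locally_convex_space) set)
    \<subseteq> topspace (Cm_on_topology (pdim P) m (chart_domain P))"
proof safe
  fix f :: "'e \<Rightarrow> 'y" assume f: "f \<in> Cm m P"
  obtain e c where "convex_chart P (pdim P) (chart P) e c" using convex_chart_chart[OF P] by blast
  then interpret convex_chart P "pdim P" "chart P" e c .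
  have U: "chart_domain P = U" by (simp add: chart_domain_def U_def)
  have f': "transport P f \<in> Cm_on (pdim P) m U" using f by (simp add: Cm_def U)
  then have "pull f \<in> Cm_on (pdim P) m U" by (simp add: transport_def U)
  then have "Ck 0 P f" by (rule Ck_of_Cm_on) (simp add: zero_enat_def[symmetric])
  then have "deriv_ext (pdim P) U 0 (transport P f) \<in> continuous_maps (deriv_domain (pdim P) U 0)"
    using deriv_ext_pull[of 0 f] extends_deriv_pull[of 0 f] by (simp add: transport_def U extends_deriv_def)
  moreover have "openin (compact_open_topology (deriv_domain (pdim P) U 0))
      (continuous_maps (deriv_domain (pdim P) U 0) :: (_ \<Rightarrow> 'y) set)"
    by (metis openin_topspace topspace_compact_open)
  moreover have "enat 0 \<le> m" by (simp add: zero_enat_def[symmetric])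
  ultimately show "transport P f \<in> topspace (Cm_on_topology (pdim P) m (chart_domain P))"
    unfolding Cm_on_topology_def topology_generated_by_topspace U using f' by blast
qed

lemma topspace_Cm_topology:
  fixes P :: "'e::euclidean_space set"
  assumes P: "convex P" "P \<noteq> {}"
  shows "topspace (Cm_topology m P :: ('e \<Rightarrow> 'y::locally_convex_space) topology) = Cm m P"
  using transport_Cm_subset_topspace[OF P, where m = m and 'y = 'y]
  by (auto simp: Cm_topology_def topspace_pullback_topology)

text \<open>Charts end here: continuity of maps between these spaces is checked by
  \<open>continuous_map_atin\<close>, with limits expressed by \<open>Ck_conv\<close>.\<close>

lemma limitin_Cm_topology:
  fixes f :: "'e::euclidean_space \<Rightarrow> 'y::locally_convex_space"
  assumes P: "convex P" "P \<noteq> {}" "compact P"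
  shows "limitin (Cm_topology m P) u f F \<longleftrightarrow> f \<in> Cm m P \<and> (\<forall>\<^sub>F i in F. u i \<in> Cm m P) \<and>
    (\<forall>k. enat k \<le> m \<longrightarrow> Ck_conv k P u f F)"
proof -
  obtain e c where "convex_chart P (pdim P) (chart P) e c" using convex_chart_chart[OF P(1,2)] by blast
  then interpret convex_chart P "pdim P" "chart P" e c .
  have U: "chart_domain P = U" by (simp add: chart_domain_def U_def)
  have "limitin (Cm_on_topology (pdim P) m (chart_domain P)) (\<lambda>i. transport P (u i)) (transport P f) F \<longleftrightarrow>
      (\<forall>k. enat k \<le> m \<longrightarrow> Ck_conv k P u f F)"
    if "f \<in> Cm m P" and u: "\<forall>\<^sub>F i in F. u i \<in> Cm m P"
    unfolding transport_def U
  proof (rule limitin_Cm_on_pull[OF P(3)])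
    show "pull f \<in> Cm_on (pdim P) m U" using that by (simp add: Cm_def transport_def U)
    show "\<forall>\<^sub>F i in F. pull (u i) \<in> Cm_on (pdim P) m U"
      using u by eventually_elim (simp add: Cm_def transport_def U)
  qed
  then show ?thesis
    unfolding Cm_topology_def limitin_pullback_topology[OF transport_Cm_subset_topspace[OF P(1,2)]] by blast
qed

section \<open>Simple polytopes near a point\<close>

lemma affine_subspace_translate:
  assumes "subspace S"
  shows "affine {x. x - v \<in> S}"
  unfolding affine_def
proof (intro ballI allI impI CollectI)
  fix x y and a b :: real assume *: "x \<in> {x. x - v \<in> S}" "y \<in> {x. x - v \<in> S}" "a + b = 1"
  have "a *\<^sub>R x + b *\<^sub>R y - v = a *\<^sub>R x + b *\<^sub>R y - (a + b) *\<^sub>R v" using * by simp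
  also have "\<dots> = a *\<^sub>R (x - v) + b *\<^sub>R (y - v)" by (simp add: algebra_simps)
  also have "\<dots> \<in> S"
    using * by (intro subspace_add[OF assms] subspace_scale[OF assms]) auto
  finally show "a *\<^sub>R x + b *\<^sub>R y - v \<in> S" .
qed

definition edge_dirs :: "'e::euclidean_space set \<Rightarrow> 'e \<Rightarrow> 'e set" where
  "edge_dirs P v = {w - v | w e. e edge_of P \<and> v \<in> e \<and> w \<in> e}"

lemma edge_dirs_face_subset:
  assumes F: "F face_of P"
  shows "edge_dirs F v \<subseteq> edge_dirs P v"
proof
  fix x assume "x \<in> edge_dirs F v"
  then obtain w e where "x = w - v" "e edge_of F" "v \<in> e" "w \<in> e" by (auto simp: edge_dirs_def)
  moreover from this have "e edge_of P" using face_of_trans[OF _ F] by (simp add: edge_of_def)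
  ultimately show "x \<in> edge_dirs P v" by (auto simp: edge_dirs_def)
qed

lemma subset_face_of_aff_dim_eq:
  assumes "convex P" "G face_of P" "F face_of P" "F \<subseteq> G" "aff_dim F = aff_dim G"
  shows "F = G"
proof (rule ccontr)
  assume "F \<noteq> G"
  moreover have "F face_of G" using face_of_subset[OF assms(3,4) face_of_imp_subset[OF assms(2)]] .
  ultimately show False
    using face_of_aff_dim_lt[OF face_of_imp_convex[OF assms(2)]] assms(5) by force
qed

text \<open>In dimension at least 2, two distinct facets through \<open>v\<close> already span the affine hull.\<close>

lemma polytope_subset_span_edge_dirs:
  fixes P :: "'e::euclidean_space set"
  assumes "polytope P" "v extreme_point_of P"
  shows "P \<subseteq> {x. x - v \<in> span (edge_dirs P v)}"
  using assms
proof (induction "nat (aff_dim P)" arbitrary: P rule: less_induct)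
  case less
  note P = \<open>polytope P\<close> and v = \<open>v extreme_point_of P\<close>
  have vP: "v \<in> P" using v by (simp add: extreme_point_of_def)
  have conv: "convex P" and poly: "polyhedron P"
    using P by (auto intro: polytope_imp_convex polytope_imp_polyhedron)
  have vface: "{v} face_of P" using v by (simp add: face_of_singleton)
  have dim0: "aff_dim P \<ge> 0" using vP aff_dim_negative_iff[of P] by (metis empty_iff not_less)
  consider "aff_dim P = 0" | "aff_dim P = 1" | "aff_dim P \<ge> 2" using dim0 by linarith
  then show ?case
  proof cases
    case 1
    then obtain a where "P = {a}" using aff_dim_eq_0 by blast
    then show ?thesis using vP by (auto intro: span_zero)
  next
    case 2
    then have "P edge_of P" using conv by (simp add: edge_of_def face_of_refl)
    then show ?thesis using vP unfolding edge_dirs_def by (auto intro!: span_base)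
  next
    case 3
    let ?\<Phi> = "{h. h facet_of P \<and> {v} \<subseteq> h}"
    have "P \<noteq> {v}" using 3 by auto
    then have inter: "{v} = \<Inter>?\<Phi>" by (intro face_of_polyhedron[OF poly vface]) auto
    have dim_facet: "aff_dim h = aff_dim P - 1" if "h facet_of P" for h
      using that by (simp add: facet_of_def)
    have "?\<Phi> \<noteq> {}"
    proof
      assume "?\<Phi> = {}"
      \<comment> \<open>The intersection of no facets is the whole type.\<close>
      with inter have "{v} = UNIV" by (metis Inter_empty)
      then have "P = {v}" using vP by blast
      then show False using \<open>P \<noteq> {v}\<close> by simp
    qed
    then obtain h where h: "h facet_of P" "v \<in> h" by auto
    \<comment> \<open>The facet \<open>h\<close> has dimension at least 1, while the facets through
      \<open>v\<close> meet only in \<open>v\<close>; so one of them does not contain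
      \<open>h\<close>.\<close>
    have "h \<noteq> {v}" using dim_facet[OF h(1)] 3 by auto
    then have "\<not> h \<subseteq> \<Inter>?\<Phi>" using inter h(2) by auto
    then obtain h' where h': "h' facet_of P" "v \<in> h'" "\<not> h \<subseteq> h'" by auto
    have hf: "h face_of P" "h' face_of P" using h h' by (auto simp: facet_of_def)
    have "h \<noteq> h'" using h' by auto
    then have "\<not> h' \<subseteq> h"
      using subset_face_of_aff_dim_eq[OF conv hf] dim_facet[OF h(1)] dim_facet[OF h'(1)] by auto
    then obtain w where w: "w \<in> h'" "w \<notin> h" by blast
    have wP: "w \<in> P" using w h' facet_of_imp_subset by blast
    \<comment> \<open>A face is the trace of its affine hull on \<open>P\<close>, so adding
      \<open>w\<close> to \<open>h\<close> raises the dimension to that of \<open>P\<close>.\<close>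
    have w_aff: "w \<notin> affine hull h" using face_of_imp_eq_affine_Int[OF conv hf(1)] w wP by blast
    have sub: "g \<subseteq> {x. x - v \<in> span (edge_dirs P v)}" if g: "g facet_of P" "v \<in> g" for g
    proof -
      have gf: "g face_of P" using g by (simp add: facet_of_def)
      have "g \<subseteq> {x. x - v \<in> span (edge_dirs g v)}"
      proof (rule less.hyps)
        show "nat (aff_dim g) < nat (aff_dim P)" using dim_facet[OF g(1)] 3 by linarith
        show "polytope g" by (rule face_of_polytope_polytope[OF P gf])
        show "v extreme_point_of g" using extreme_point_of_face[OF gf] v g by blast
      qed
      then show ?thesis using span_mono[OF edge_dirs_face_subset[OF gf, of v]] by blast
    qed
    let ?T = "{x. x - v \<in> span (edge_dirs P v)}"
    have affT: "affine ?T" by (rule affine_subspace_translate) simp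
    have "insert w h \<subseteq> ?T" using sub[OF h] sub[OF h'(1,2)] w by blast
    then have "affine hull (insert w h) \<subseteq> ?T" using affT by (rule hull_minimal)
    moreover have "affine hull (insert w h) = affine hull P"
    proof (rule affine_dim_equal)
      show "affine hull insert w h \<subseteq> affine hull P"
        using wP facet_of_imp_subset[OF h(1)] by (intro hull_mono) auto
      show "aff_dim (affine hull insert w h) = aff_dim (affine hull P)"
        using w_aff dim_facet[OF h(1)] by (simp add: aff_dim_insert)
    qed auto
    ultimately show ?thesis using hull_subset[of P affine] by blast
  qed
qed

lemma dirs_subset_span:
  assumes "\<And>x. x \<in> P \<Longrightarrow> x - v \<in> span D"
  shows "dirs P \<subseteq> span D"
  unfolding dirs_def
proof (rule span_minimal[OF _ subspace_span], rule subsetI)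
  fix z assume "z \<in> {x - y | x y. x \<in> P \<and> y \<in> P}"
  then obtain x y where z: "z = (x - v) - (y - v)" "x \<in> P" "y \<in> P" by auto
  show "z \<in> span D" unfolding z(1) by (intro span_diff assms z)
qed

lemma edge_subset_line:
  assumes "e edge_of P" "v \<in> e"
  obtains w where "w \<in> e" "\<And>x. x \<in> e \<Longrightarrow> \<exists>u. x = v + u *\<^sub>R (w - v)"
proof -
  have dim: "aff_dim e = 1" using assms by (simp add: edge_of_def)
  then have "e \<noteq> {v}" by auto
  then obtain w where w: "w \<in> e" "w \<noteq> v" using assms by blast
  have "affine hull {v, w} = affine hull e"
  proof (rule affine_dim_equal)
    show "affine hull {v, w} \<subseteq> affine hull e" using assms w by (intro hull_mono) auto
    show "aff_dim (affine hull {v, w}) = aff_dim (affine hull e)" using dim w by (simp add: aff_dim_2)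
  qed auto
  then have "e \<subseteq> range (\<lambda>u. v + u *\<^sub>R (w - v))"
    using hull_subset[of e affine] by (simp add: affine_hull_2_alt)
  then show ?thesis using that[of w] w by blast
qed

text \<open>At a simple vertex every facet misses exactly one edge, and distinct facets miss distinct edges;
  the missed edges give the dual basis of the facet normals.\<close>

lemma simple_vertex_dual:
  fixes M :: "'e::euclidean_space set"
  assumes M: "simple_polytope M" and v: "v extreme_point_of M"
    and ab: "\<And>c. c facet_of M \<Longrightarrow> M \<subseteq> {x. a c \<bullet> x \<le> b c} \<and> c = M \<inter> {x. a c \<bullet> x = b c}"
  obtains q where "\<And>c. c facet_of M \<Longrightarrow> v \<in> c \<Longrightarrow> q c \<in> dirs M \<and> a c \<bullet> q c = 1"
    "\<And>c c'. c facet_of M \<Longrightarrow> v \<in> c \<Longrightarrow> c' facet_of M \<Longrightarrow> v \<in> c' \<Longrightarrow> c \<noteq> c' \<Longrightarrow> a c' \<bullet> q c = 0"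
proof -
  have P: "polytope M" and ne: "M \<noteq> {}" using M by (auto simp: simple_polytope_def)
  have vM: "v \<in> M" using v by (simp add: extreme_point_of_def)
  define \<E> where "\<E> = {e. e edge_of M \<and> v \<in> e}"
  have "finite {e. e face_of M}" by (rule finite_polytope_faces[OF P])
  then have fin: "finite \<E>" by (rule rev_finite_subset) (auto simp: \<E>_def edge_of_def)
  have "{v} face_of M" using v by (simp add: face_of_singleton)
  then have card: "int (card \<E>) = aff_dim M"
    using M unfolding simple_polytope_def \<E>_def by (metis (no_types, lifting) Collect_cong aff_dim_sing insert_subset empty_subsetI)
  have "\<exists>w. w \<in> e \<and> (\<forall>x\<in>e. \<exists>u. x = v + u *\<^sub>R (w - v))" if "e \<in> \<E>" for e
  proof -
    have e: "e edge_of M" "v \<in> e" using that by (auto simp: \<E>_def)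
    obtain w where "w \<in> e" "\<And>x. x \<in> e \<Longrightarrow> \<exists>u. x = v + u *\<^sub>R (w - v)"
      by (rule edge_subset_line[OF e]) (rule that)
    then show ?thesis by blast
  qed
  then obtain w where w: "\<And>e. e \<in> \<E> \<Longrightarrow> w e \<in> e"
    "\<And>e x. e \<in> \<E> \<Longrightarrow> x \<in> e \<Longrightarrow> \<exists>u. x = v + u *\<^sub>R (w e - v)" by metis
  define d where "d e = w e - v" for e
  have eM: "e \<subseteq> M" if "e \<in> \<E>" for e using that edge_of_imp_subset by (auto simp: \<E>_def)
  have d_dirs: "d e \<in> dirs M" if "e \<in> \<E>" for e
    unfolding d_def using w(1)[OF that] eM[OF that] vM by (intro diff_in_dirs) auto
  have av: "a c \<bullet> v = b c" if "c facet_of M" "v \<in> c" for c using ab[OF that(1)] that(2) by blast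
  define \<E>' where "\<E>' c = {e \<in> \<E>. e \<subseteq> c}" for c
  \<comment> \<open>Turns incidence into linear algebra: the facet normal decides whether the edge
    lies in the facet.\<close>
  have sub_iff: "e \<subseteq> c \<longleftrightarrow> a c \<bullet> d e = 0" if c: "c facet_of M" "v \<in> c" and e: "e \<in> \<E>" for e c
  proof
    assume "e \<subseteq> c"
    then have "a c \<bullet> w e = b c" using w(1)[OF e] ab[OF c(1)] by blast
    then show "a c \<bullet> d e = 0" using av[OF c] by (simp add: d_def inner_diff_right)
  next
    assume 0: "a c \<bullet> d e = 0"
    show "e \<subseteq> c"
    proof
      fix x assume x: "x \<in> e"
      then obtain u where "x = v + u *\<^sub>R d e" using w(2)[OF e] by (auto simp: d_def)
      then have "a c \<bullet> x = b c" using 0 av[OF c] by (simp add: inner_add_right)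
      then show "x \<in> c" using ab[OF c(1)] x eM[OF e] by blast
    qed
  qed
  \<comment> \<open>Used for facets and for \<open>M\<close> itself; edges of a face are edges of
    \<open>M\<close>.\<close>
  have span_F: "x - v \<in> span (d ` {e \<in> \<E>. e \<subseteq> F})" if F: "F face_of M" "v \<in> F" and x: "x \<in> F" for F x
  proof -
    have "x - v \<in> span (edge_dirs F v)"
      using polytope_subset_span_edge_dirs[OF face_of_polytope_polytope[OF P F(1)], of v]
        extreme_point_of_face[OF F(1)] v F(2) x by blast
    moreover have "edge_dirs F v \<subseteq> span (d ` {e \<in> \<E>. e \<subseteq> F})"
    proof
      fix y assume "y \<in> edge_dirs F v"
      then obtain z e where z: "y = z - v" "e edge_of F" "v \<in> e" "z \<in> e" by (auto simp: edge_dirs_def)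
      then have e: "e \<in> \<E>" "e \<subseteq> F"
        using face_of_trans[OF _ F(1)] edge_of_imp_subset by (auto simp: \<E>_def edge_of_def)
      obtain u where "z = v + u *\<^sub>R d e" using w(2)[OF e(1) z(4)] by (auto simp: d_def)
      then have "y = u *\<^sub>R d e" using z by simp
      moreover have "u *\<^sub>R d e \<in> span (d ` {e \<in> \<E>. e \<subseteq> F})" using e by (intro span_scale span_base) auto
      ultimately show "y \<in> span (d ` {e \<in> \<E>. e \<subseteq> F})" by simp
    qed
    then have "span (edge_dirs F v) \<subseteq> span (d ` {e \<in> \<E>. e \<subseteq> F})" by (rule span_minimal) simp
    ultimately show ?thesis by blast
  qed
  have inM: "x \<in> c" if c: "c facet_of M" "v \<in> c" and x: "x \<in> M" "x - v \<in> span (d ` \<E>' c)" for c x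
  proof -
    have "span (d ` \<E>' c) \<subseteq> {y. a c \<bullet> y = 0}"
      by (rule span_minimal) (use sub_iff[OF c] in \<open>auto simp: \<E>'_def subspace_hyperplane\<close>)
    then have "a c \<bullet> (x - v) = 0" using x by blast
    then have "a c \<bullet> x = b c" using av[OF c] by (simp add: inner_diff_right)
    then show ?thesis using ab[OF c(1)] x by blast
  qed
  \<comment> \<open>The edges at \<open>v\<close> are as many as the dimension of \<open>M\<close>.
    Those inside the facet span its directions, so at most one is missing; if none were,
    \<open>M\<close> would lie in the facet.\<close>
  have "\<exists>e. \<E> - \<E>' c = {e}" if c: "c facet_of M" "v \<in> c" for c
  proof -
    have cf: "c face_of M" "c \<noteq> {}" and dimc: "aff_dim c = aff_dim M - 1"
      using c by (auto simp: facet_of_def)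
    have "dirs c \<subseteq> span (d ` \<E>' c)"
      unfolding \<E>'_def by (rule dirs_subset_span) (rule span_F[OF cf(1) c(2)])
    then have "dim (dirs c) \<le> card (d ` \<E>' c)" using fin by (intro dim_le_card) (auto simp: \<E>'_def)
    also have "\<dots> \<le> card (\<E>' c)" using fin by (intro card_image_le) (auto simp: \<E>'_def)
    finally have "int (card \<E>) - 1 \<le> int (card (\<E>' c))"
      using aff_dim_eq_dim_dirs[OF cf(2)] dimc card by simp
    moreover have "\<E>' c \<noteq> \<E>"
    proof
      assume eq: "\<E>' c = \<E>"
      have "{e \<in> \<E>. e \<subseteq> M} = \<E>" using eM by auto
      then have "x \<in> c" if "x \<in> M" for x
        using inM[OF c that] span_F[OF face_of_refl[OF polytope_imp_convex[OF P]] vM that] eq by simp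
      then have "c = M" using facet_of_imp_subset[OF c(1)] by blast
      then show False using c by simp
    qed
    then have "\<E>' c \<subset> \<E>" by (auto simp: \<E>'_def)
    then have "card (\<E>' c) < card \<E>" using fin psubset_card_mono by blast
    moreover have "card (\<E> - \<E>' c) = card \<E> - card (\<E>' c)"
      using fin by (intro card_Diff_subset) (auto simp: \<E>'_def)
    ultimately have "card (\<E> - \<E>' c) = 1" by linarith
    then show ?thesis by (rule card_1_singletonE) blast
  qed
  then obtain \<epsilon> where \<epsilon>: "\<And>c. c facet_of M \<Longrightarrow> v \<in> c \<Longrightarrow> \<E> - \<E>' c = {\<epsilon> c}" by metis
  \<comment> \<open>The direction of the missed edge, scaled so that the facet normal takes the
    value 1 on it.\<close>
  define q where "q c = (1 / (a c \<bullet> d (\<epsilon> c))) *\<^sub>R d (\<epsilon> c)" for c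
  have 1: "q c \<in> dirs M \<and> a c \<bullet> q c = 1" if c: "c facet_of M" "v \<in> c" for c
  proof -
    have e: "\<epsilon> c \<in> \<E>" "\<not> \<epsilon> c \<subseteq> c" using \<epsilon>[OF c] by (auto simp: \<E>'_def)
    then have "a c \<bullet> d (\<epsilon> c) \<noteq> 0" using sub_iff[OF c e(1)] by blast
    then show ?thesis using d_dirs[OF e(1)] by (auto simp: q_def intro: subspace_scale[OF subspace_dirs])
  qed
  have 2: "a c' \<bullet> q c = 0" if c: "c facet_of M" "v \<in> c" and c': "c' facet_of M" "v \<in> c'" and ne: "c \<noteq> c'" for c c'
  proof -
    have e: "\<epsilon> c \<in> \<E>" using \<epsilon>[OF c] by auto
    have "\<epsilon> c \<noteq> \<epsilon> c'"
    proof
      assume "\<epsilon> c = \<epsilon> c'"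
      then have "\<E> - \<E>' c = \<E> - \<E>' c'" using \<epsilon>[OF c] \<epsilon>[OF c'] by simp
      then have eq: "\<E>' c = \<E>' c'" by (auto simp: \<E>'_def)
      \<comment> \<open>Facets with the same edges at \<open>v\<close> contain each other, since
        these edges span both.\<close>
      have sub: "x \<in> h'" if h: "h facet_of M" "v \<in> h" and h': "h' facet_of M" "v \<in> h'"
        and eq: "\<E>' h = \<E>' h'" and x: "x \<in> h" for h h' x
      proof (rule inM[OF h'])
        show "x \<in> M" using x facet_of_imp_subset[OF h(1)] by blast
        have "h face_of M" using h by (simp add: facet_of_def)
        from span_F[OF this h(2) x] have "x - v \<in> span (d ` \<E>' h)" by (simp add: \<E>'_def)
        then show "x - v \<in> span (d ` \<E>' h')" by (simp only: eq)
      qed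
      show False using sub[OF c c' eq] sub[OF c' c eq[symmetric]] ne by blast
    qed
    then have "\<epsilon> c \<in> \<E>' c'" using \<epsilon>[OF c'] e by blast
    then have "a c' \<bullet> d (\<epsilon> c) = 0" using sub_iff[OF c' e] by (simp add: \<E>'_def)
    then show ?thesis by (simp add: q_def)
  qed
  show ?thesis using that 1 2 by blast
qed

text \<open>If \<open>x\<close> were outside, the segment from a relative interior point
  \<open>z\<close> to \<open>x\<close> would leave \<open>M\<close> through a facet
  \<open>c\<close>. The functional \<open>a c\<close> is below \<open>b c\<close> at
  \<open>z\<close> and equal to \<open>b c\<close> at the exit point, hence above \<open>b c\<close>
  at \<open>x\<close>.\<close>

lemma polytope_eq_facet_halfspaces:
  fixes M :: "'e::euclidean_space set"
  assumes M: "polytope M" "M \<noteq> {}"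
    and ab: "\<And>c. c facet_of M \<Longrightarrow> M \<subseteq> {x. a c \<bullet> x \<le> b c} \<and> c = M \<inter> {x. a c \<bullet> x = b c}"
    and x: "x \<in> affine hull M" "\<And>c. c facet_of M \<Longrightarrow> a c \<bullet> x \<le> b c"
  shows "x \<in> M"
proof (rule ccontr)
  assume xM: "x \<notin> M"
  have poly: "polyhedron M" by (rule polytope_imp_polyhedron[OF M(1)])
  obtain z where z: "z \<in> rel_interior M"
    using rel_interior_eq_empty[OF polytope_imp_convex[OF M(1)]] M(2) by blast
  have zM: "z \<in> M" using z rel_interior_subset by blast
  have "z + (x - z) \<in> affine hull M" "x - z \<noteq> 0" using x(1) zM xM by auto
  from ray_to_rel_frontier[OF polytope_imp_bounded[OF M(1)] z this]
  obtain t where t: "0 < t" "z + t *\<^sub>R (x - z) \<in> rel_frontier M"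
    "\<And>e. 0 \<le> e \<Longrightarrow> e < t \<Longrightarrow> z + e *\<^sub>R (x - z) \<in> rel_interior M" by blast
  have "t \<le> 1"
  proof (rule ccontr)
    assume "\<not> t \<le> 1"
    then have "x \<in> rel_interior M" using t(3)[of 1] by simp
    then show False using xM rel_interior_subset by blast
  qed
  obtain c where c: "c facet_of M" "z + t *\<^sub>R (x - z) \<in> c"
    using t(2) rel_frontier_of_polyhedron[OF poly] by auto
  have t1: "t \<noteq> 1" using c xM facet_of_imp_subset[OF c(1)] by auto
  have "z \<notin> c" using z rel_interior_of_polyhedron[OF poly] c(1) by blast
  then have az: "a c \<bullet> z < b c" using ab[OF c(1)] zM by force
  have "a c \<bullet> (z + t *\<^sub>R (x - z)) = b c" using c ab[OF c(1)] by blast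
  then have eq: "(1 - t) * (a c \<bullet> z) + t * (a c \<bullet> x) = b c"
    by (simp add: inner_add_right inner_diff_right algebra_simps)
  have "(1 - t) * (a c \<bullet> z) < (1 - t) * b c" using az t1 \<open>t \<le> 1\<close> by simp
  moreover have "t * (a c \<bullet> x) \<le> t * b c" using x(2)[OF c(1)] t(1) by simp
  ultimately show False using eq by (simp add: algebra_simps)
qed

text \<open>The projection \<pi> moves a point along the dual vectors \<open>q c\<close> until all
  facets containing \<open>F\<close> are tight. The other facets through \<open>v\<close> keep their
  value, as their normals vanish on these vectors; the facets missing \<open>v\<close> also miss
  \<open>p\<close> and stay inactive near \<open>p\<close>. A proper face through \<open>p\<close>
  is cut out by facets of the first two kinds, so it is preserved.\<close>

lemma local_face_projection:
  fixes M :: "'e::euclidean_space set"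
  assumes M: "simple_polytope M" and F: "F face_of M" "F \<noteq> M" and p: "p \<in> F"
  obtains L k \<delta> where "linear L" "0 < \<delta>"
    "\<And>x. x \<in> M \<inter> cball p \<delta> \<Longrightarrow> k + L x \<in> F" "\<And>x. x \<in> F \<Longrightarrow> k + L x = x"
    "\<And>G x. G face_of M \<Longrightarrow> p \<in> G \<Longrightarrow> x \<in> G \<inter> cball p \<delta> \<Longrightarrow> k + L x \<in> G"
proof -
  have P: "polytope M" and ne: "M \<noteq> {}" using M by (auto simp: simple_polytope_def)
  have poly: "polyhedron M" and conv: "convex M" and comp: "compact M"
    using P by (auto intro: polytope_imp_polyhedron polytope_imp_convex polytope_imp_compact)
  have "\<exists>a b. M \<subseteq> {x. a \<bullet> x \<le> b} \<and> c = M \<inter> {x. a \<bullet> x = b}" if "c facet_of M" for c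
    using facet_of_polyhedron[OF poly that] by metis
  then obtain a b where ab: "\<And>c. c facet_of M \<Longrightarrow> M \<subseteq> {x. a c \<bullet> x \<le> b c} \<and> c = M \<inter> {x. a c \<bullet> x = b c}"
    by metis
  have face_Int: "G = \<Inter>{c. c facet_of M \<and> G \<subseteq> c}" if "G face_of M" "G \<noteq> {}" "G \<noteq> M" for G
    by (rule face_of_polyhedron[OF poly that])
  define A where "A = {c. c facet_of M \<and> F \<subseteq> c}"
  have Fne: "F \<noteq> {}" using p by auto
  have F_eq: "F = \<Inter>A" unfolding A_def by (rule face_Int[OF F(1) Fne F(2)])
  have A_ne: "A \<noteq> {}"
  proof
    assume "A = {}"
    then have "F = UNIV" using F_eq by simp
    then show False using F(2) face_of_imp_subset[OF F(1)] by auto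
  qed
  have fin: "finite {c. c facet_of M}" by (rule finite_polytope_facets[OF P])
  have finA: "finite A" by (rule finite_subset[OF _ fin]) (auto simp: A_def)
  \<comment> \<open>The facets through \<open>p\<close> meet in a nonempty compact face; an extreme
    point of it is a vertex of \<open>M\<close> on all these facets, and at a vertex simplicity is
    available.\<close>
  obtain v where v: "v extreme_point_of M" "\<And>c. c facet_of M \<Longrightarrow> p \<in> c \<Longrightarrow> v \<in> c"
  proof -
    let ?G = "\<Inter>{c. c facet_of M \<and> p \<in> c}"
    have "{c. c facet_of M \<and> p \<in> c} \<noteq> {}" using A_ne p by (auto simp: A_def)
    then have G: "?G face_of M" by (rule face_of_Inter) (auto simp: facet_of_def)
    have "compact ?G" "convex ?G"
      using face_of_imp_compact[OF conv comp G] face_of_imp_convex[OF G] by auto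
    moreover have "?G \<noteq> {}" by auto
    ultimately obtain v where "v extreme_point_of ?G" using extreme_point_exists_convex by blast
    then have "v extreme_point_of M" "v \<in> ?G" using extreme_point_of_face[OF G] by auto
    then show ?thesis using that[of v] by blast
  qed
  obtain q where q: "\<And>c. c facet_of M \<Longrightarrow> v \<in> c \<Longrightarrow> q c \<in> dirs M \<and> a c \<bullet> q c = 1"
    "\<And>c c'. c facet_of M \<Longrightarrow> v \<in> c \<Longrightarrow> c' facet_of M \<Longrightarrow> v \<in> c' \<Longrightarrow> c \<noteq> c' \<Longrightarrow> a c' \<bullet> q c = 0"
    by (rule simple_vertex_dual[OF M v(1) ab]) (assumption | rule that)+
  have A: "c facet_of M" "v \<in> c" if "c \<in> A" for c using that v(2) p by (auto simp: A_def)
  define \<pi> where "\<pi> x = x - (\<Sum>c\<in>A. (a c \<bullet> x - b c) *\<^sub>R q c)" for x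
  define L where "L x = x - (\<Sum>c\<in>A. (a c \<bullet> x) *\<^sub>R q c)" for x
  define k where "k = (\<Sum>c\<in>A. b c *\<^sub>R q c)"
  have \<pi>_eq: "\<pi> x = k + L x" for x
    by (simp add: \<pi>_def k_def L_def scaleR_diff_left sum_subtractf)
  have lin: "linear L"
    unfolding L_def
    by (rule linearI) (simp_all add: inner_add_right scaleR_add_left sum.distrib scaleR_diff_right scaleR_sum_right)
  have a_\<pi>: "a c \<bullet> \<pi> x = a c \<bullet> x - (\<Sum>c'\<in>A. (a c' \<bullet> x - b c') * (a c \<bullet> q c'))" for c x
    by (simp add: \<pi>_def inner_diff_right inner_sum_right)
  have a_in: "a c \<bullet> \<pi> x = b c" if c: "c \<in> A" for c x
  proof -
    have "(\<Sum>c'\<in>A. (a c' \<bullet> x - b c') * (a c \<bullet> q c')) = (\<Sum>c'\<in>A. if c' = c then a c' \<bullet> x - b c' else 0)"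
      using q A c by (intro sum.cong) auto
    also have "\<dots> = a c \<bullet> x - b c" using finA c by simp
    finally show ?thesis by (simp add: a_\<pi>)
  qed
  have a_out: "a c \<bullet> \<pi> x = a c \<bullet> x" if c: "c facet_of M" "v \<in> c" "c \<notin> A" for c x
  proof -
    have "(\<Sum>c'\<in>A. (a c' \<bullet> x - b c') * (a c \<bullet> q c')) = 0"
      using q(2)[OF A _ _] c by (intro sum.neutral) auto
    then show ?thesis by (simp add: a_\<pi>)
  qed
  have F\<pi>: "\<pi> x = x" if "x \<in> F" for x
  proof -
    have "a c \<bullet> x = b c" if "c \<in> A" for c using \<open>x \<in> F\<close> that ab by (auto simp: A_def)
    then show ?thesis by (simp add: \<pi>_def)
  qed
  \<comment> \<open>A facet missing \<open>v\<close> misses \<open>p\<close>, so its inequality is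
    strict at \<open>\<pi> p = p\<close> and, by continuity, nearby.\<close>
  have ev: "\<forall>\<^sub>F x in nhds p. \<forall>c\<in>{c. c facet_of M \<and> v \<notin> c}. a c \<bullet> \<pi> x < b c"
  proof (rule eventually_ball_finite)
    show "finite {c. c facet_of M \<and> v \<notin> c}" by (rule finite_subset[OF _ fin]) auto
    show "\<forall>c\<in>{c. c facet_of M \<and> v \<notin> c}. \<forall>\<^sub>F x in nhds p. a c \<bullet> \<pi> x < b c"
    proof
      fix c assume c: "c \<in> {c. c facet_of M \<and> v \<notin> c}"
      then have "p \<notin> c" using v(2) by auto
      moreover have "p \<in> M" using p face_of_imp_subset[OF F(1)] by blast
      ultimately have "a c \<bullet> p < b c" using ab[of c] c by force
      moreover have "((\<lambda>x. a c \<bullet> \<pi> x) \<longlongrightarrow> a c \<bullet> \<pi> p) (nhds p)"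
        unfolding \<pi>_def by (intro tendsto_intros filterlim_ident)
      ultimately show "\<forall>\<^sub>F x in nhds p. a c \<bullet> \<pi> x < b c"
        using F\<pi>[OF p] by (intro order_tendstoD(2)) auto
    qed
  qed
  then obtain \<delta>' where \<delta>': "\<delta>' > 0" "\<And>x c. dist x p < \<delta>' \<Longrightarrow> c facet_of M \<Longrightarrow> v \<notin> c \<Longrightarrow> a c \<bullet> \<pi> x < b c"
    unfolding eventually_nhds_metric by auto
  define \<delta> where "\<delta> = \<delta>' / 2"
  have \<delta>: "\<delta> > 0" "\<And>x c. x \<in> cball p \<delta> \<Longrightarrow> c facet_of M \<Longrightarrow> v \<notin> c \<Longrightarrow> a c \<bullet> \<pi> x < b c"
    using \<delta>' by (auto simp: \<delta>_def dist_commute)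
  have \<pi>M: "\<pi> x \<in> M" if x: "x \<in> M \<inter> cball p \<delta>" for x
  proof (rule polytope_eq_facet_halfspaces[OF P ne ab])
    have "- (\<Sum>c\<in>A. (a c \<bullet> x - b c) *\<^sub>R q c) \<in> dirs M"
      using q(1) A by (intro subspace_neg[OF subspace_dirs] subspace_sum[OF subspace_dirs] subspace_scale[OF subspace_dirs]) auto
    then have "x + - (\<Sum>c\<in>A. (a c \<bullet> x - b c) *\<^sub>R q c) \<in> affine hull M"
      using x by (intro affine_hull_add_dirs) (auto intro: hull_inc)
    then show "\<pi> x \<in> affine hull M" by (simp add: \<pi>_def)
    fix c assume c: "c facet_of M"
    consider "v \<notin> c" | "c \<in> A" | "v \<in> c" "c \<notin> A" by blast
    then show "a c \<bullet> \<pi> x \<le> b c"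
    proof cases
      case 1 then show ?thesis using \<delta>(2)[of x c] c x by force
    next
      case 2 then show ?thesis using a_in by simp
    next
      case 3 then show ?thesis using a_out[OF c] ab[OF c] x by auto
    qed
  qed
  have G\<pi>: "\<pi> x \<in> G" if G: "G face_of M" "p \<in> G" and x: "x \<in> G \<inter> cball p \<delta>" for G x
  proof (cases "G = M")
    case True
    then show ?thesis using \<pi>M x by blast
  next
    case False
    have xM: "x \<in> M \<inter> cball p \<delta>" using x face_of_imp_subset[OF G(1)] by blast
    have "\<pi> x \<in> c" if c: "c facet_of M" "G \<subseteq> c" for c
    proof -
      have vc: "v \<in> c" using v(2)[OF c(1)] G c by blast
      have "a c \<bullet> x = b c" using x c ab[OF c(1)] by blast
      then have "a c \<bullet> \<pi> x = b c" using a_in[of c x] a_out[OF c(1) vc, of x] by fastforce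
      then show ?thesis using ab[OF c(1)] \<pi>M[OF xM] by blast
    qed
    moreover have "G \<noteq> {}" using G by auto
    ultimately show ?thesis using face_Int[OF G(1) _ False] by blast
  qed
  have F\<pi>': "\<pi> x \<in> F" if x: "x \<in> M \<inter> cball p \<delta>" for x
  proof -
    have "\<pi> x \<in> c" if "c \<in> A" for c
      using a_in[OF that, of x] ab[OF A(1)[OF that]] \<pi>M[OF x] by blast
    then show ?thesis using F_eq by blast
  qed
  show ?thesis
    using that[of L \<delta> k] lin \<delta>(1) F\<pi>' F\<pi> G\<pi> unfolding \<pi>_eq by blast
qed

section \<open>Smooth bump functions\<close>

lemma has_line_deriv_real_iff:
  fixes h :: "'e::euclidean_space \<Rightarrow> real"
  shows "has_line_deriv P y h x v \<longleftrightarrow>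
    ((\<lambda>t. h (x + t *\<^sub>R y)) has_real_derivative v) (at 0 within {t. x + t *\<^sub>R y \<in> P})"
  by (simp add: has_line_deriv_def has_field_derivative_iff)

lemma has_dd_compose_real:
  fixes h :: "'e::euclidean_space \<Rightarrow> real"
  assumes D: "\<And>t. t \<in> I \<Longrightarrow> (f has_real_derivative f' t) (at t)" "continuous_on I f'"
    and h: "has_dd P y h h'" "h ` P \<subseteq> I"
  shows "has_dd P y (\<lambda>x. f (h x)) (\<lambda>x. f' (h x) * h' x)"
  unfolding has_dd_def
proof (intro conjI ballI)
  have ch: "continuous_on P h" "continuous_on P h'" using h by (auto simp: has_dd_def)
  have "continuous_on I f" by (auto intro!: continuous_at_imp_continuous_on DERIV_isCont[OF D(1)])
  then show "continuous_on P (\<lambda>x. f (h x))" using continuous_on_compose2[OF _ ch(1) h(2)] by blast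
  show "continuous_on P (\<lambda>x. f' (h x) * h' x)"
    by (intro continuous_on_mult ch(2) continuous_on_compose2[OF D(2) ch(1) h(2)])
  fix x assume x: "x \<in> P"
  have "((\<lambda>t. h (x + t *\<^sub>R y)) has_real_derivative h' x) (at 0 within {t. x + t *\<^sub>R y \<in> P})"
    using h(1) x by (simp add: has_dd_def has_line_deriv_real_iff)
  moreover have "(f has_real_derivative f' (h x)) (at (h (x + 0 *\<^sub>R y)))" using D(1) h(2) x by auto
  ultimately show "has_line_deriv P y (\<lambda>x. f (h x)) x (f' (h x) * h' x)"
    unfolding has_line_deriv_real_iff by (rule DERIV_chain2[rotated])
qed

text \<open>Smoothness of the outer function is encoded by the sequence \<open>D\<close> of its
  successive derivatives; the induction covers all \<open>j\<close> at once because the chain rule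
  brings in \<open>D (Suc j)\<close>.\<close>

lemma Ck_compose_smooth:
  fixes h :: "'e::euclidean_space \<Rightarrow> real" and D :: "nat \<Rightarrow> real \<Rightarrow> real"
  assumes P: "compact P" and D: "\<And>j t. t \<in> I \<Longrightarrow> (D j has_real_derivative D (Suc j) t) (at t)"
    and h: "Ck k P h" "h ` P \<subseteq> I"
  shows "Ck k P (\<lambda>x. D j (h x))"
  using h(1)
proof (induction k arbitrary: j)
  case 0
  have "continuous_on I (D j)" by (auto intro!: continuous_at_imp_continuous_on DERIV_isCont[OF D])
  then show ?case using 0 continuous_on_compose2[OF _ _ h(2), of "D j"] by simp
next
  case (Suc k)
  show ?case
    unfolding Ck.simps
  proof
    fix y assume "y \<in> dirs P"
    then obtain h' where h': "has_dd P y h h'" "Ck k P h'" using Suc.prems by auto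
    have "continuous_on I (D (Suc j))" by (auto intro!: continuous_at_imp_continuous_on DERIV_isCont[OF D])
    then have "has_dd P y (\<lambda>x. D j (h x)) (\<lambda>x. D (Suc j) (h x) * h' x)"
      by (intro has_dd_compose_real[OF D _ h'(1) h(2)])
    moreover have "Ck k P (\<lambda>x. D (Suc j) (h x) *\<^sub>R h' x)"
      by (rule Ck_mult[OF P Suc.IH[OF Ck_SucD[OF Suc.prems]] h'(2)])
    ultimately show "\<exists>g. has_dd P y (\<lambda>x. D j (h x)) g \<and> Ck k P g" by auto
  qed
qed

lemma Ck_inverse:
  fixes h :: "'e::euclidean_space \<Rightarrow> real"
  assumes "compact P" "Ck k P h" "\<And>x. x \<in> P \<Longrightarrow> h x > 0"
  shows "Ck k P (\<lambda>x. inverse (h x))"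
proof -
  \<comment> \<open>The derivative of order \<open>j\<close> of the reciprocal.\<close>
  define D where "D j t = (- 1) ^ j * fact j * inverse (t ^ Suc j)" for j and t :: real
  have "(D j has_real_derivative D (Suc j) t) (at t)" if t: "t \<in> {0<..}" for j t
  proof -
    have "((\<lambda>t. t ^ Suc j) has_real_derivative real (Suc j) * t ^ j) (at t)"
      using DERIV_pow[of "Suc j" t] by simp
    from DERIV_cmult[OF DERIV_inverse_fun[OF this], of "(- 1) ^ j * fact j"]
    have "(D j has_real_derivative (- 1) ^ j * fact j *
        - (inverse (t ^ Suc j) * (real (Suc j) * t ^ j) * inverse (t ^ Suc j))) (at t)"
      using t unfolding D_def by (simp add: mult_ac)
    moreover have "(- 1) ^ j * fact j * - (inverse (t ^ Suc j) * (real (Suc j) * t ^ j) * inverse (t ^ Suc j)) = D (Suc j) t"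
      using t by (simp add: D_def field_simps)
    ultimately show ?thesis by simp
  qed
  then have "Ck k P (\<lambda>x. D 0 (h x))"
    by (rule Ck_compose_smooth[where D = D and I = "{0<..}", OF assms(1) _ assms(2)]) (use assms(3) in auto)
  then show ?thesis by (simp add: D_def)
qed

text \<open>The classical flat function \<open>exp (- 1 / t)\<close>, with a polynomial in
  \<open>1 / t\<close> as a factor so that the family is closed under differentiation.\<close>

definition flat :: "real poly \<Rightarrow> real \<Rightarrow> real" where
  "flat q t = (if t > 0 then poly q (1 / t) * exp (- 1 / t) else 0)"

lemma flat_tendsto_0: "(flat q \<longlongrightarrow> 0) (at_right 0)"
proof -
  have "((\<lambda>s. \<Sum>i\<le>degree q. coeff q i * (s ^ i / exp s)) \<longlongrightarrow> (\<Sum>i\<le>degree q. coeff q i * 0)) at_top"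
    by (intro tendsto_intros tendsto_power_div_exp_0)
  moreover have "(\<Sum>i\<le>degree q. coeff q i * (s ^ i / exp s)) = poly q s * exp (- s)" for s
    by (simp add: poly_altdef sum_distrib_right exp_minus divide_inverse mult.assoc)
  ultimately have "((\<lambda>s. poly q s * exp (- s)) \<longlongrightarrow> 0) at_top" by simp
  from filterlim_compose[OF this filterlim_inverse_at_top_right]
  have lim: "((\<lambda>t. poly q (inverse t) * exp (- inverse t)) \<longlongrightarrow> 0) (at_right 0)" .
  have "\<forall>\<^sub>F t in at_right 0. poly q (inverse t) * exp (- inverse t) = flat q t"
    unfolding eventually_at_filter by (auto simp: flat_def inverse_eq_divide)
  from Lim_transform_eventually[OF lim this] show ?thesis .
qed

text \<open>Differentiating the exponential produces the factor \<open>(1 / t)^2\<close>, and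
  differentiating \<open>1 / t\<close> inside the polynomial produces its negative; hence the square
  of the variable, \<open>[:0, 0, 1:]\<close>, times \<open>q - pderiv q\<close>.\<close>

lemma flat_has_derivative:
  "(flat q has_real_derivative flat ([:0, 0, 1:] * (q - pderiv q)) t) (at t)"
proof -
  consider "t > 0" | "t < 0" | "t = 0" by linarith
  then show ?thesis
  proof cases
    case 1
    have "((\<lambda>t. poly q (1 / t) * exp (- 1 / t)) has_real_derivative
        flat ([:0, 0, 1:] * (q - pderiv q)) t) (at t)"
      using 1 by (auto intro!: derivative_eq_intros simp: flat_def field_simps power2_eq_square)
    then show ?thesis
      by (rule has_field_derivative_transform_within_open[of _ _ _ "{0<..}"]) (use 1 in \<open>auto simp: flat_def\<close>)
  next
    case 2
    have "((\<lambda>t. 0) has_real_derivative 0) (at t)" by simp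
    then have "(flat q has_real_derivative 0) (at t)"
      by (rule has_field_derivative_transform_within_open[of _ _ _ "{..<0}"]) (use 2 in \<open>auto simp: flat_def\<close>)
    then show ?thesis using 2 by (simp add: flat_def)
  next
    case 3
    \<comment> \<open>Division by \<open>s\<close> is one more factor of the variable in the
      polynomial, so the quotient is again flat.\<close>
    have "((\<lambda>s. flat q s / s) \<longlongrightarrow> 0) (at_right 0)"
    proof (rule Lim_transform_eventually[OF flat_tendsto_0[of "[:0, 1:] * q"]])
      show "\<forall>\<^sub>F s in at_right 0. flat ([:0, 1:] * q) s = flat q s / s"
        unfolding eventually_at_filter by (auto simp: flat_def)
    qed
    moreover have "((\<lambda>s. flat q s / s) \<longlongrightarrow> 0) (at_left 0)"
    proof (rule Lim_transform_eventually[OF tendsto_const])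
      show "\<forall>\<^sub>F s in at_left 0. 0 = flat q s / s"
        unfolding eventually_at_filter by (auto simp: flat_def)
    qed
    ultimately have "((\<lambda>s. flat q s / s) \<longlongrightarrow> 0) (at 0)" by (simp add: filterlim_split_at)
    then show ?thesis using 3 by (simp add: has_field_derivative_iff flat_def)
  qed
qed

lemma Ck_affine_real: "Ck k P (\<lambda>x. x \<bullet> b + c)"
proof (cases k)
  case 0
  then show ?thesis by (auto intro!: continuous_intros)
next
  case (Suc j)
  have "has_dd P y (\<lambda>x. x \<bullet> b + c) (\<lambda>_. y \<bullet> b)" for y
    unfolding has_dd_def has_line_deriv_real_iff
    by (auto intro!: continuous_intros derivative_eq_intros simp: inner_add_left)
  then show ?thesis unfolding Suc Ck.simps using Ck_const by blast
qed

lemma Ck_quadratic: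
  fixes p :: "'e::euclidean_space"
  shows "Ck k P (\<lambda>x. r - (x - p) \<bullet> (x - p))"
proof (cases k)
  case 0
  then show ?thesis by (auto intro!: continuous_intros)
next
  case (Suc j)
  have "\<exists>g. has_dd P y (\<lambda>x. r - (x - p) \<bullet> (x - p)) g \<and> Ck j P g" for y
  proof (intro exI conjI)
    have "((\<lambda>t. r - (x + t *\<^sub>R y - p) \<bullet> (x + t *\<^sub>R y - p)) has_real_derivative (x \<bullet> ((-2) *\<^sub>R y) + 2 * (p \<bullet> y))) (at 0 within S)" for x S
    proof -
      have "((\<lambda>t. r - ((x - p) \<bullet> (x - p) + 2 * t * ((x - p) \<bullet> y) + t * t * (y \<bullet> y))) has_real_derivative
          (x \<bullet> ((-2) *\<^sub>R y) + 2 * (p \<bullet> y))) (at 0 within S)"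
        by (auto intro!: derivative_eq_intros simp: inner_diff_left)
      moreover have "(x + t *\<^sub>R y - p) \<bullet> (x + t *\<^sub>R y - p) = (x - p) \<bullet> (x - p) + 2 * t * ((x - p) \<bullet> y) + t * t * (y \<bullet> y)" for t
        by (simp add: inner_add_left inner_add_right inner_diff_left inner_diff_right inner_commute algebra_simps)
      ultimately show ?thesis by simp
    qed
    then show "has_dd P y (\<lambda>x. r - (x - p) \<bullet> (x - p)) (\<lambda>x. x \<bullet> ((-2) *\<^sub>R y) + 2 * (p \<bullet> y))"
      unfolding has_dd_def has_line_deriv_real_iff by (auto intro!: continuous_intros)
    show "Ck j P (\<lambda>x. x \<bullet> ((-2) *\<^sub>R y) + 2 * (p \<bullet> y))" by (rule Ck_affine_real)
  qed
  then show ?thesis unfolding Suc Ck.simps by blast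
qed

text \<open>The flat function is composed with the square of the radius minus the squared distance
  from \<open>p\<close>, which is positive exactly in the ball.\<close>

lemma smooth_bump:
  fixes p :: "'e::euclidean_space"
  assumes "\<rho> > 0"
  obtains h :: "'e \<Rightarrow> real" where "\<And>k P. compact P \<Longrightarrow> Ck k P h" "\<And>x. h x \<ge> 0"
    "\<And>x. h x > 0 \<longleftrightarrow> x \<in> ball p \<rho>"
proof -
  \<comment> \<open>The polynomial belonging to the derivative of order \<open>j\<close> of
    \<open>exp (- 1 / t)\<close>.\<close>
  define Q where "Q j = ((\<lambda>q. [:0, 0, 1:] * (q - pderiv q)) ^^ j) (1 :: real poly)" for j
  define h where "h x = flat (Q 0) (\<rho>\<^sup>2 - (x - p) \<bullet> (x - p))" for x
  have D: "(flat (Q j) has_real_derivative flat (Q (Suc j)) t) (at t)" for j t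
    using flat_has_derivative[of "Q j" t] by (simp add: Q_def)
  have "Ck k P h" if "compact P" for k P
    unfolding h_def by (rule Ck_compose_smooth[where D = "\<lambda>j. flat (Q j)" and I = UNIV, OF that D Ck_quadratic]) auto
  moreover have "h x \<ge> 0" for x by (simp add: h_def flat_def Q_def)
  moreover have "h x > 0 \<longleftrightarrow> x \<in> ball p \<rho>" for x
  proof -
    have "h x > 0 \<longleftrightarrow> (norm (x - p))\<^sup>2 < \<rho>\<^sup>2" by (simp add: h_def flat_def Q_def power2_norm_eq_inner)
    also have "\<dots> \<longleftrightarrow> norm (x - p) < \<rho>" using assms by (metis abs_norm_cancel abs_of_pos power2_less_imp_less power_strict_mono norm_ge_zero zero_less_numeral less_imp_le)
    finally show ?thesis by (simp add: dist_norm norm_minus_commute)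
  qed
  ultimately show ?thesis by (rule that)
qed

section \<open>Extension operators\<close>

text \<open>A family \<open>w\<close> is its own index in the convergence statement; taking the filter \<open>bot\<close> shows that
  an extension operator maps compatible families to \<open>C\<^sup>m\<close>-maps.\<close>

definition ext_op ::
  "enat \<Rightarrow> 'e::euclidean_space set set \<Rightarrow> 'e set \<Rightarrow> (('e set \<Rightarrow> 'e \<Rightarrow> 'y::locally_convex_space) \<Rightarrow> 'e \<Rightarrow> 'y) \<Rightarrow> bool" where
  "ext_op m \<F> Q A \<longleftrightarrow>
     (\<forall>a b u v. \<forall>x\<in>Q. A (family_lincomb \<F> a u b v) x = a *\<^sub>R A u x + b *\<^sub>R A v x) \<and>
     (\<forall>F v k. enat k \<le> m \<longrightarrow> (\<forall>G\<in>\<F>. Ck_conv k G (\<lambda>w. w G) (v G) F) \<longrightarrow> Ck_conv k Q A (A v) F)"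

lemma ext_op_zero: "ext_op m \<F> Q (\<lambda>_ _. 0)"
  unfolding ext_op_def using Ck_conv_const[OF Ck_const] by auto

lemma ext_op_eval:
  assumes "F \<in> \<F>"
  shows "ext_op m \<F> F (\<lambda>u. u F)"
  using assms by (auto simp: ext_op_def family_lincomb_def fun_lincomb_def)

lemma ext_op_affine_comp:
  fixes A :: "('e::euclidean_space set \<Rightarrow> 'e \<Rightarrow> 'y::locally_convex_space) \<Rightarrow> 'e \<Rightarrow> 'y"
  assumes "linear L" "(\<lambda>x. a + L x) ` Q \<subseteq> P" "ext_op m \<F> P A"
  shows "ext_op m \<F> Q (\<lambda>u x. A u (a + L x))"
  unfolding ext_op_def
proof (intro conjI allI ballI impI)
  fix b c u v x assume "x \<in> Q"
  then show "A (family_lincomb \<F> b u c v) (a + L x) = b *\<^sub>R A u (a + L x) + c *\<^sub>R A v (a + L x)"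
    using assms(2,3) by (auto simp: ext_op_def)
next
  fix F :: "('e set \<Rightarrow> 'e \<Rightarrow> 'y) filter" and v :: "'e set \<Rightarrow> 'e \<Rightarrow> 'y" and k
  assume "enat k \<le> m" "\<forall>G\<in>\<F>. Ck_conv k G (\<lambda>w. w G) (v G) F"
  then have "Ck_conv k P A (A v) F" using assms(3) unfolding ext_op_def by blast
  then show "Ck_conv k Q (\<lambda>u x. A u (a + L x)) (\<lambda>x. A v (a + L x)) F"
    by (rule Ck_conv_affine_comp[OF assms(1,2)])
qed

lemma ext_op_subset: "Q \<subseteq> P \<Longrightarrow> ext_op m \<F> P A \<Longrightarrow> ext_op m \<F> Q A"
  using ext_op_affine_comp[OF linear_id[unfolded id_def], of 0 Q P m \<F> A] by simp

lemma ext_op_add: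
  fixes A :: "('e::euclidean_space set \<Rightarrow> 'e \<Rightarrow> 'y::locally_convex_space) \<Rightarrow> 'e \<Rightarrow> 'y"
  assumes "ext_op m \<F> Q A" "ext_op m \<F> Q B"
  shows "ext_op m \<F> Q (\<lambda>u x. A u x + B u x)"
  unfolding ext_op_def
proof (intro conjI allI ballI impI)
  fix a b u v x assume "x \<in> Q"
  then have "A (family_lincomb \<F> a u b v) x = a *\<^sub>R A u x + b *\<^sub>R A v x"
    "B (family_lincomb \<F> a u b v) x = a *\<^sub>R B u x + b *\<^sub>R B v x"
    using assms unfolding ext_op_def by blast+
  then show "A (family_lincomb \<F> a u b v) x + B (family_lincomb \<F> a u b v) x =
      a *\<^sub>R (A u x + B u x) + b *\<^sub>R (A v x + B v x)" by (simp add: algebra_simps)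
next
  fix F :: "('e set \<Rightarrow> 'e \<Rightarrow> 'y) filter" and v :: "'e set \<Rightarrow> 'e \<Rightarrow> 'y" and k
  assume "enat k \<le> m" "\<forall>G\<in>\<F>. Ck_conv k G (\<lambda>w. w G) (v G) F"
  then have "Ck_conv k Q A (A v) F" "Ck_conv k Q B (B v) F" using assms unfolding ext_op_def by blast+
  then show "Ck_conv k Q (\<lambda>u x. A u x + B u x) (\<lambda>x. A v x + B v x) F" by (rule Ck_conv_add)
qed

lemma ext_op_sum:
  assumes "finite S" "\<And>s. s \<in> S \<Longrightarrow> ext_op m \<F> Q (A s)"
  shows "ext_op m \<F> Q (\<lambda>u x. \<Sum>s\<in>S. A s u x)"
  using assms
proof (induction S)
  case empty
  then show ?case by (simp add: ext_op_zero)
next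
  case (insert s S)
  then show ?case using ext_op_add[of m \<F> Q "A s"] by simp
qed

lemma ext_op_mult:
  fixes A :: "('e::euclidean_space set \<Rightarrow> 'e \<Rightarrow> 'y::locally_convex_space) \<Rightarrow> 'e \<Rightarrow> 'y"
    and h :: "'e \<Rightarrow> real"
  assumes "compact Q" "\<And>k. Ck k Q h" "ext_op m \<F> Q A"
  shows "ext_op m \<F> Q (\<lambda>u x. h x *\<^sub>R A u x)"
  unfolding ext_op_def
proof (intro conjI allI ballI impI)
  fix a b u v x assume "x \<in> Q"
  then have "A (family_lincomb \<F> a u b v) x = a *\<^sub>R A u x + b *\<^sub>R A v x"
    using assms unfolding ext_op_def by blast
  then show "h x *\<^sub>R A (family_lincomb \<F> a u b v) x = a *\<^sub>R (h x *\<^sub>R A u x) + b *\<^sub>R (h x *\<^sub>R A v x)"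
    by (simp add: scaleR_add_right mult.commute)
next
  fix F :: "('e set \<Rightarrow> 'e \<Rightarrow> 'y) filter" and v :: "'e set \<Rightarrow> 'e \<Rightarrow> 'y" and k
  assume "enat k \<le> m" "\<forall>G\<in>\<F>. Ck_conv k G (\<lambda>w. w G) (v G) F"
  then have "Ck_conv k Q A (A v) F" using assms unfolding ext_op_def by blast
  then show "Ck_conv k Q (\<lambda>u x. h x *\<^sub>R A u x) (\<lambda>x. h x *\<^sub>R A v x) F"
    by (rule Ck_conv_mult[OF assms(1,2)])
qed

lemma ext_op_extend_by_zero:
  fixes A :: "('e::euclidean_space set \<Rightarrow> 'e \<Rightarrow> 'y::locally_convex_space) \<Rightarrow> 'e \<Rightarrow> 'y"
  assumes P: "convex P" "p \<in> P" and r: "0 < e" "r < e"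
    and zero: "\<And>u x. x \<in> P \<inter> cball p e - cball p r \<Longrightarrow> A u x = 0"
    and A: "ext_op m \<F> (P \<inter> cball p e) A"
  shows "ext_op m \<F> P (\<lambda>u. extend_by_zero (P \<inter> cball p e) (A u))"
  unfolding ext_op_def
proof (intro conjI allI ballI impI)
  fix a b u v x
  show "extend_by_zero (P \<inter> cball p e) (A (family_lincomb \<F> a u b v)) x =
      a *\<^sub>R extend_by_zero (P \<inter> cball p e) (A u) x + b *\<^sub>R extend_by_zero (P \<inter> cball p e) (A v) x"
    using A unfolding ext_op_def extend_by_zero_def by (cases "x \<in> P \<inter> cball p e") auto
next
  fix F :: "('e set \<Rightarrow> 'e \<Rightarrow> 'y) filter" and v :: "'e set \<Rightarrow> 'e \<Rightarrow> 'y" and k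
  assume "enat k \<le> m" "\<forall>G\<in>\<F>. Ck_conv k G (\<lambda>w. w G) (v G) F"
  then have "Ck_conv k (P \<inter> cball p e) A (A v) F" using A unfolding ext_op_def by blast
  then show "Ck_conv k P (\<lambda>u. extend_by_zero (P \<inter> cball p e) (A u)) (extend_by_zero (P \<inter> cball p e) (A v)) F"
    by (intro Ck_conv_extend_by_zero[OF P r]) (auto simp: zero)
qed

lemma compatible_familiesD:
  assumes "u \<in> compatible_families m \<F>" "F \<in> \<F>"
  shows "u F \<in> Cm m F" "\<And>G x. G \<in> \<F> \<Longrightarrow> x \<in> F \<Longrightarrow> x \<in> G \<Longrightarrow> u F x = u G x"
proof -
  show "u F \<in> Cm m F" using assms by (auto simp: compatible_families_def)
  fix G x assume "G \<in> \<F>" "x \<in> F" "x \<in> G"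
  then have "restrict (u F) (F \<inter> G) = restrict (u G) (F \<inter> G)"
    using assms unfolding compatible_families_def by blast
  then have "restrict (u F) (F \<inter> G) x = restrict (u G) (F \<inter> G) x" by (rule fun_cong)
  then show "u F x = u G x" using \<open>x \<in> F\<close> \<open>x \<in> G\<close> by simp
qed

text \<open>If \<open>A\<close> extends the data on the faces \<open>\<G>\<close> and \<open>\<pi>\<close> is a local projection onto \<open>F\<close> that preserves
  them, then \<open>A u + (u F - A u) \<circ> \<pi>\<close> extends the data on \<open>\<G> \<union> {F}\<close>.\<close>

lemma local_extension:
  fixes M :: "'e::euclidean_space set"
  assumes M: "simple_polytope M" and \<F>: "\<And>F. F \<in> \<F> \<Longrightarrow> F face_of M \<and> F \<noteq> M" and fin: "finite \<F>"
    and p: "p \<in> M"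
  shows "\<exists>\<delta>>0. \<exists>A. ext_op m \<F> (M \<inter> cball p \<delta>) A \<and>
    (\<forall>u\<in>(compatible_families m \<F> :: ('e set \<Rightarrow> 'e \<Rightarrow> 'y::locally_convex_space) set).
      \<forall>F\<in>\<F>. \<forall>x\<in>F \<inter> cball p \<delta>. A u x = u F x)"
proof -
  have P: "polytope M" using M by (simp add: simple_polytope_def)
  have compM: "compact M" by (rule polytope_imp_compact[OF P])
  \<comment> \<open>\<G> collects the faces already treated; the ball may shrink with each new
    face.\<close>
  define Ext where "Ext \<G> \<delta> A \<longleftrightarrow> ext_op m \<F> (M \<inter> cball p \<delta>) A \<and>
    (\<forall>u\<in>(compatible_families m \<F> :: ('e set \<Rightarrow> 'e \<Rightarrow> 'y) set).
      \<forall>F\<in>\<G>. \<forall>x\<in>F \<inter> cball p \<delta>. A u x = u F x)" for \<G> \<delta> A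
  have step: "\<exists>\<delta>>0. \<exists>A. Ext \<G> \<delta> A" if "finite \<G>" "\<G> \<subseteq> {F \<in> \<F>. p \<in> F}" for \<G>
    using that
  proof (induction \<G>)
    case empty
    have "Ext {} 1 (\<lambda>_ _. 0)" unfolding Ext_def using ext_op_zero by auto
    then show ?case using zero_less_one by blast
  next
    case (insert F \<G>)
    obtain \<delta> A where \<delta>: "\<delta> > 0" and A: "Ext \<G> \<delta> A" using insert by auto
    have F: "F \<in> \<F>" "p \<in> F" "F face_of M" "F \<noteq> M" using insert.prems \<F> by auto
    obtain L k \<delta>1 where L: "linear L" "0 < \<delta>1"
      "\<And>x. x \<in> M \<inter> cball p \<delta>1 \<Longrightarrow> k + L x \<in> F" "\<And>x. x \<in> F \<Longrightarrow> k + L x = x"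
      "\<And>G x. G face_of M \<Longrightarrow> p \<in> G \<Longrightarrow> x \<in> G \<inter> cball p \<delta>1 \<Longrightarrow> k + L x \<in> G"
      by (rule local_face_projection[OF M F(3,4,2)]) (rule that)
    \<comment> \<open>\<open>A u\<close> is evaluated at projected points, which must lie in the old
      ball. The projection fixes \<open>p\<close>, so a smaller ball achieves this.\<close>
    have "continuous_on UNIV (\<lambda>x. k + L x)"
      using L(1) by (intro continuous_intros linear_continuous_on) (simp add: linear_conv_bounded_linear)
    then have "open ((\<lambda>x. k + L x) -` ball p \<delta>)" using open_vimage[OF open_ball] by blast
    moreover have "p \<in> (\<lambda>x. k + L x) -` ball p \<delta>" using L(4)[OF F(2)] \<delta> by simp
    ultimately obtain \<delta>2 where \<delta>2: "\<delta>2 > 0" "cball p \<delta>2 \<subseteq> (\<lambda>x. k + L x) -` ball p \<delta>"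
      using open_contains_cball by blast
    define \<delta>3 where "\<delta>3 = min \<delta> (min \<delta>1 \<delta>2)"
    have \<delta>3: "\<delta>3 > 0" "cball p \<delta>3 \<subseteq> cball p \<delta>" "cball p \<delta>3 \<subseteq> cball p \<delta>1" "cball p \<delta>3 \<subseteq> cball p \<delta>2"
      using \<delta> L(2) \<delta>2 by (auto simp: \<delta>3_def)
    let ?Q = "M \<inter> cball p \<delta>3"
    have \<pi>\<delta>: "k + L x \<in> cball p \<delta>" if "x \<in> cball p \<delta>3" for x
      using that \<delta>2(2) \<delta>3(4) by force
    have \<pi>F: "(\<lambda>x. k + L x) ` ?Q \<subseteq> F" using L(3) \<delta>3(3) by blast
    then have \<pi>Q: "(\<lambda>x. k + L x) ` ?Q \<subseteq> M \<inter> cball p \<delta>"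
      using \<pi>\<delta> face_of_imp_subset[OF F(3)] by blast
    define B where "B u x = A u x + (u F (k + L x) + (- 1) *\<^sub>R A u (k + L x))" for u x
    have A1: "ext_op m \<F> (M \<inter> cball p \<delta>) A" using A by (simp add: Ext_def)
    have comp: "compact ?Q" using compM by (intro compact_Int) auto
    have "ext_op m \<F> ?Q B"
      unfolding B_def
    proof (intro ext_op_add)
      show "ext_op m \<F> ?Q A" by (rule ext_op_subset[OF _ A1]) (use \<delta>3(2) in blast)
      show "ext_op m \<F> ?Q (\<lambda>u x. u F (k + L x))"
        by (rule ext_op_affine_comp[OF L(1) \<pi>F ext_op_eval[OF F(1)]])
      show "ext_op m \<F> ?Q (\<lambda>u x. (- 1) *\<^sub>R A u (k + L x))"
        by (rule ext_op_mult[OF comp Ck_const ext_op_affine_comp[OF L(1) \<pi>Q A1]])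
    qed
    moreover have "B u x = u G x"
      if u: "u \<in> compatible_families m \<F>" and G: "G \<in> insert F \<G>" and x: "x \<in> G \<inter> cball p \<delta>3" for u G x
    proof (cases "x \<in> F")
      case True
      have "G \<in> \<F>" using G insert.prems by auto
      then have "u F x = u G x" using compatible_familiesD(2)[OF u F(1)] True x by blast
      then show ?thesis using L(4)[OF True] by (simp add: B_def)
    next
      case False
      then have G: "G \<in> \<G>" "G \<in> \<F>" "p \<in> G" using G x insert.prems by auto
      have Gf: "G face_of M" using \<F> G by blast
      have xQ: "x \<in> ?Q" using x face_of_imp_subset[OF Gf] by blast
      have \<pi>G: "k + L x \<in> G" using L(5)[OF Gf G(3)] x \<delta>3(3) by blast
      \<comment> \<open>The projected point lies in both \<open>G\<close> and \<open>F\<close>, so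
        compatibility cancels the correction.\<close>
      have "A u (k + L x) = u G (k + L x)" using A u G(1) \<pi>G \<pi>\<delta> x by (auto simp: Ext_def)
      also have "\<dots> = u F (k + L x)"
        using compatible_familiesD(2)[OF u G(2) F(1) \<pi>G] \<pi>F xQ by blast
      finally have "B u x = A u x" by (simp add: B_def)
      also have "\<dots> = u G x" using A u G(1) x \<delta>3(2) unfolding Ext_def by blast
      finally show ?thesis .
    qed
    ultimately have "Ext (insert F \<G>) \<delta>3 B" unfolding Ext_def by blast
    then show ?case using \<delta>3(1) by blast
  qed
  have "finite {F \<in> \<F>. p \<in> F}" using fin by simp
  then obtain \<delta> A where \<delta>: "\<delta> > 0" and A: "Ext {F \<in> \<F>. p \<in> F} \<delta> A" using step[OF _ order_refl] by blast
  \<comment> \<open>The faces not through \<open>p\<close> are closed and finite in number, so a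
    small ball avoids them.\<close>
  have "\<forall>\<^sub>F x in nhds p. \<forall>F\<in>{F \<in> \<F>. p \<notin> F}. x \<notin> F"
  proof (rule eventually_ball_finite)
    show "finite {F \<in> \<F>. p \<notin> F}" using fin by simp
    show "\<forall>F\<in>{F \<in> \<F>. p \<notin> F}. \<forall>\<^sub>F x in nhds p. x \<notin> F"
    proof
      fix F assume "F \<in> {F \<in> \<F>. p \<notin> F}"
      moreover from this have "closed F"
        using face_of_imp_compact[OF polytope_imp_convex[OF P] compM] \<F> compact_imp_closed by blast
      ultimately have "open (- F)" "p \<in> - F" by auto
      then show "\<forall>\<^sub>F x in nhds p. x \<notin> F" unfolding eventually_nhds by blast
    qed
  qed
  then obtain \<delta>' where \<delta>': "\<delta>' > 0" "\<And>x F. dist x p < \<delta>' \<Longrightarrow> F \<in> \<F> \<Longrightarrow> p \<notin> F \<Longrightarrow> x \<notin> F"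
    unfolding eventually_nhds_metric by auto
  define \<epsilon> where "\<epsilon> = min \<delta> (\<delta>' / 2)"
  have \<epsilon>: "\<epsilon> > 0" "cball p \<epsilon> \<subseteq> cball p \<delta>" using \<delta> \<delta>'(1) by (auto simp: \<epsilon>_def)
  have \<epsilon>F: "p \<in> F" if "x \<in> cball p \<epsilon>" "F \<in> \<F>" "x \<in> F" for x F
  proof (rule ccontr)
    assume "p \<notin> F"
    moreover have "dist x p < \<delta>'" using that(1) \<delta>'(1) by (auto simp: \<epsilon>_def dist_commute)
    ultimately show False using \<delta>'(2) that(2,3) by blast
  qed
  have "ext_op m \<F> (M \<inter> cball p \<epsilon>) A"
    by (rule ext_op_subset[of _ "M \<inter> cball p \<delta>"]) (use A \<epsilon>(2) in \<open>auto simp: Ext_def\<close>)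
  moreover have "A u x = u F x" if "u \<in> compatible_families m \<F>" "F \<in> \<F>" "x \<in> F \<inter> cball p \<epsilon>" for u F x
  proof -
    have "p \<in> F" using \<epsilon>F[of x F] that by blast
    then show ?thesis using A that \<epsilon>(2) unfolding Ext_def by blast
  qed
  ultimately show ?thesis using \<epsilon>(1) by blast
qed

text \<open>Blending with the weights \<open>h p x / H x\<close> preserves the extension property,
  because at a point of a face all contributing local operators give the same value.\<close>

lemma global_extension:
  fixes M :: "'e::euclidean_space set"
  assumes M: "simple_polytope M" and \<F>: "\<And>F. F \<in> \<F> \<Longrightarrow> F face_of M \<and> F \<noteq> M" and fin: "finite \<F>"
  shows "\<exists>B. ext_op m \<F> M B \<and>
    (\<forall>u\<in>(compatible_families m \<F> :: ('e set \<Rightarrow> 'e \<Rightarrow> 'y::locally_convex_space) set).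
      \<forall>F\<in>\<F>. \<forall>x\<in>F. B u x = u F x)"
proof -
  have P: "polytope M" using M by (simp add: simple_polytope_def)
  have compM: "compact M" and convM: "convex M"
    using P by (auto intro: polytope_imp_compact polytope_imp_convex)
  have "\<forall>p\<in>M. \<exists>\<delta>>0. \<exists>A. ext_op m \<F> (M \<inter> cball p \<delta>) A \<and>
    (\<forall>u\<in>(compatible_families m \<F> :: ('e set \<Rightarrow> 'e \<Rightarrow> 'y) set).
      \<forall>F\<in>\<F>. \<forall>x\<in>F \<inter> cball p \<delta>. A u x = u F x)"
    using local_extension[OF M \<F> fin] by blast
  then obtain \<delta> A where \<delta>: "\<And>p. p \<in> M \<Longrightarrow> \<delta> p > 0"
    and A: "\<And>p. p \<in> M \<Longrightarrow> ext_op m \<F> (M \<inter> cball p (\<delta> p)) (A p)"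
    and ext: "\<And>p (u :: 'e set \<Rightarrow> 'e \<Rightarrow> 'y) F x. p \<in> M \<Longrightarrow> u \<in> compatible_families m \<F> \<Longrightarrow>
      F \<in> \<F> \<Longrightarrow> x \<in> F \<inter> cball p (\<delta> p) \<Longrightarrow> A p u x = u F x"
    unfolding bchoice_iff by (metis (no_types, lifting))
  \<comment> \<open>Half balls already cover, and the bumps live on them; the collar up to radius
    \<open>\<delta> p\<close> is what extension by zero requires.\<close>
  obtain S where S: "S \<subseteq> M" "finite S" "M \<subseteq> (\<Union>p\<in>S. ball p (\<delta> p / 2))"
  proof (rule compactE_image[OF compM])
    show "M \<subseteq> (\<Union>p\<in>M. ball p (\<delta> p / 2))" using \<delta> by force
  qed auto
  have "\<exists>h :: 'e \<Rightarrow> real. (\<forall>k P. compact P \<longrightarrow> Ck k P h) \<and> (\<forall>x. h x \<ge> 0) \<and> (\<forall>x. h x > 0 \<longleftrightarrow> x \<in> ball p (\<delta> p / 2))"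
    if p: "p \<in> M" for p
  proof -
    have "\<delta> p / 2 > 0" using \<delta>[OF p] by simp
    from smooth_bump[OF this, of p] show ?thesis by metis
  qed
  then obtain h :: "'e \<Rightarrow> 'e \<Rightarrow> real" where h: "\<And>p k P. p \<in> M \<Longrightarrow> compact P \<Longrightarrow> Ck k P (h p)"
    "\<And>p x. p \<in> M \<Longrightarrow> h p x \<ge> 0" "\<And>p x. p \<in> M \<Longrightarrow> h p x > 0 \<longleftrightarrow> x \<in> ball p (\<delta> p / 2)" by metis
  define H where "H x = (\<Sum>p\<in>S. h p x)" for x
  have H_pos: "H x > 0" if x: "x \<in> M" for x
  proof -
    obtain p where p: "p \<in> S" "x \<in> ball p (\<delta> p / 2)" using S(3) x by blast
    then have "h p x > 0" using h(3) S(1) by blast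
    also have "h p x \<le> H x" unfolding H_def using p(1) S h(2) by (intro member_le_sum) auto
    finally show ?thesis .
  qed
  \<comment> \<open>\<open>A p u\<close> is controlled only in its ball; multiplied by the bump it
    can be continued by zero to all of \<open>M\<close>.\<close>
  define B0 where "B0 p u = extend_by_zero (M \<inter> cball p (\<delta> p)) (\<lambda>x. h p x *\<^sub>R A p u x)" for p u
  define B where "B u x = inverse (H x) *\<^sub>R (\<Sum>p\<in>S. B0 p u x)" for u x
  have "ext_op m \<F> M B"
    unfolding B_def
  proof (rule ext_op_mult[OF compM _ ext_op_sum[OF S(2)]])
    show "Ck k M (\<lambda>x. inverse (H x))" for k
    proof (rule Ck_inverse[OF compM _ H_pos])
      show "Ck k M H" unfolding H_def by (rule Ck_sum[OF S(2)]) (use h(1) S(1) compM in blast)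
    qed
    fix p assume "p \<in> S"
    then have p: "p \<in> M" using S(1) by blast
    show "ext_op m \<F> M (B0 p)"
      unfolding B0_def
    proof (rule ext_op_extend_by_zero[OF convM p \<delta>[OF p], of "\<delta> p / 2"])
      show "\<delta> p / 2 < \<delta> p" using \<delta>[OF p] by simp
      fix u x assume "x \<in> M \<inter> cball p (\<delta> p) - cball p (\<delta> p / 2)"
      then have "\<not> h p x > 0" unfolding h(3)[OF p] by auto
      then have "h p x = 0" using h(2)[OF p, of x] by linarith
      then show "h p x *\<^sub>R A p u x = 0" by simp
    next
      show "ext_op m \<F> (M \<inter> cball p (\<delta> p)) (\<lambda>u x. h p x *\<^sub>R A p u x)"
      proof (rule ext_op_mult[OF _ _ A[OF p]])
        show "compact (M \<inter> cball p (\<delta> p))" using compM by (intro compact_Int) auto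
        then show "Ck k (M \<inter> cball p (\<delta> p)) (h p)" for k by (rule h(1)[OF p])
      qed
    qed
  qed
  moreover have "B u x = u F x" if u: "u \<in> compatible_families m \<F>" and F: "F \<in> \<F>" and x: "x \<in> F" for u F x
  proof -
    have xM: "x \<in> M" using \<F>[OF F] face_of_imp_subset x by blast
    have "B0 p u x = h p x *\<^sub>R u F x" if "p \<in> S" for p
    proof -
      have p: "p \<in> M" using S(1) that by blast
      show ?thesis
      proof (cases "x \<in> cball p (\<delta> p)")
        case True
        then show ?thesis using ext[OF p u F, of x] x xM by (simp add: B0_def extend_by_zero_def)
      next
        case False
        then have "x \<notin> ball p (\<delta> p / 2)" using \<delta>[OF p] by auto
        then have "h p x = 0" using h(2)[OF p, of x] h(3)[OF p, of x] by linarith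
        then show ?thesis using False by (simp add: B0_def extend_by_zero_def)
      qed
    qed
    then have "B u x = inverse (H x) *\<^sub>R (H x *\<^sub>R u F x)" by (simp add: B_def H_def scaleR_sum_left)
    then show ?thesis using H_pos[OF xM] by simp
  qed
  ultimately show ?thesis by blast
qed

section \<open>The extension theorem\<close>

text \<open>Starts the continuity proofs below: the identity converges along \<open>atin\<close>,
  and this convergence is unpacked into \<open>Ck_conv\<close>.\<close>

lemma limitin_atin_ident:
  assumes "x \<in> topspace X"
  shows "limitin X (\<lambda>y. y) x (atin X x)"
  using continuous_map_id[of X] assms unfolding continuous_map_atin id_def by blast

lemma uniform_conv_imp_tendsto:
  fixes f :: "'e \<Rightarrow> 'y::locally_convex_space"
  assumes "uniform_conv P u f F" "x \<in> P"
  shows "((\<lambda>i. u i x) \<longlongrightarrow> f x) F"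
  unfolding tendsto_def
proof (intro allI impI)
  fix V assume V: "open V" "f x \<in> V"
  then have "open {v. v + f x \<in> V}" "0 \<in> {v. v + f x \<in> V}"
    by (auto intro: open_translation_lcs)
  then have "\<forall>\<^sub>F i in F. \<forall>x'\<in>P. u i x' - f x' \<in> {v. v + f x \<in> V}"
    using assms(1) unfolding uniform_conv_def by blast
  then show "\<forall>\<^sub>F i in F. u i x \<in> V"
  proof eventually_elim
    case (elim i)
    then have "u i x - f x \<in> {v. v + f x \<in> V}" using assms(2) by blast
    then show ?case by simp
  qed
qed

lemma Cm_fun_lincomb:
  fixes f :: "'e::euclidean_space \<Rightarrow> 'y::locally_convex_space"
  assumes P: "convex P" "P \<noteq> {}" "compact P" and "f \<in> Cm m P" "g \<in> Cm m P"
  shows "fun_lincomb P a f b g \<in> Cm m P"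
  unfolding Cm_iff[OF P(1,2)]
proof (intro conjI allI impI)
  show "fun_lincomb P a f b g \<in> extensional P" by (simp add: fun_lincomb_def)
  fix k assume k: "enat k \<le> m"
  have "Ck k P f" "Ck k P g" using assms k Cm_iff[OF P(1,2)] by blast+
  then have "Ck k P (\<lambda>x. a *\<^sub>R f x + b *\<^sub>R g x)"
    by (intro Ck_add Ck_mult[OF P(3) Ck_const])
  then show "Ck k P (fun_lincomb P a f b g)"
    by (subst Ck_cong[of P _ "\<lambda>x. a *\<^sub>R f x + b *\<^sub>R g x"]) (auto simp: fun_lincomb_def)
qed

lemma continuous_map_eval_Cm:
  assumes P: "convex P" "P \<noteq> {}" "compact P" and x: "x \<in> P"
  shows "continuous_map (Cm_topology m P) euclidean (\<lambda>f :: 'e::euclidean_space \<Rightarrow> 'y::locally_convex_space. f x)"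
  unfolding continuous_map_atin
proof
  fix f :: "'e \<Rightarrow> 'y" assume f: "f \<in> topspace (Cm_topology m P)"
  have "limitin (Cm_topology m P) (\<lambda>f. f) f (atin (Cm_topology m P) f)" by (rule limitin_atin_ident[OF f])
  then have "Ck_conv 0 P (\<lambda>f. f) f (atin (Cm_topology m P) f)"
    unfolding limitin_Cm_topology[OF P] by (metis i0_lb zero_enat_def)
  then have "((\<lambda>f. f x) \<longlongrightarrow> f x) (atin (Cm_topology m P) f)"
    using uniform_conv_imp_tendsto[OF Ck_conv_imp_uniform x] by blast
  then show "limitin euclidean (\<lambda>f. f x) (f x) (atin (Cm_topology m P) f)" by simp
qed

text \<open>Point evaluations are continuous and \<open>'y\<close> is Hausdorff, so each single
  condition \<open>u F x = u G x\<close> is closed.\<close>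

lemma closedin_compatible_families:
  fixes \<F> :: "'e::euclidean_space set set"
  assumes \<F>: "\<And>F. F \<in> \<F> \<Longrightarrow> convex F \<and> F \<noteq> {} \<and> compact F"
  shows "closedin (Cm_product_topology m \<F>)
    (compatible_families m \<F> :: ('e set \<Rightarrow> 'e \<Rightarrow> 'y::locally_convex_space) set)"
proof -
  let ?X = "Cm_product_topology m \<F> :: ('e set \<Rightarrow> 'e \<Rightarrow> 'y) topology"
  let ?C = "\<lambda>(F, G, x). {u \<in> topspace ?X. u F x = u G x}"
  let ?I = "{(F, G, x). F \<in> \<F> \<and> G \<in> \<F> \<and> x \<in> F \<inter> G}"
  have top: "topspace ?X = Pi\<^sub>E \<F> (Cm m)"
    unfolding Cm_product_topology_def topspace_product_topology
    by (intro PiE_cong) (use \<F> topspace_Cm_topology in blast)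
  \<comment> \<open>Inserting the whole space keeps the intersection inside the product even if
    there is no condition.\<close>
  have "compatible_families m \<F> = \<Inter>(insert (topspace ?X) (?C ` ?I))"
  proof (intro set_eqI iffI)
    fix u :: "'e set \<Rightarrow> 'e \<Rightarrow> 'y" assume u: "u \<in> compatible_families m \<F>"
    then have "u \<in> topspace ?X" by (auto simp: top compatible_families_def)
    then show "u \<in> \<Inter>(insert (topspace ?X) (?C ` ?I))"
      using compatible_familiesD(2)[OF u] by auto
  next
    fix u assume u: "u \<in> \<Inter>(insert (topspace ?X) (?C ` ?I))"
    have "restrict (u F) (F \<inter> G) = restrict (u G) (F \<inter> G)" if "F \<in> \<F>" "G \<in> \<F>" for F G
      using u that by (intro restrict_ext) auto
    then show "u \<in> compatible_families m \<F>" using u by (auto simp: top compatible_families_def)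
  qed
  moreover have "closedin ?X (\<Inter>(insert (topspace ?X) (?C ` ?I)))"
  proof (rule closedin_Inter)
    fix S assume "S \<in> insert (topspace ?X) (?C ` ?I)"
    then consider "S = topspace ?X"
      | F G x where "F \<in> \<F>" "G \<in> \<F>" "x \<in> F" "x \<in> G" "S = {u \<in> topspace ?X. u F x = u G x}" by auto
    then show "closedin ?X S"
    proof cases
      case 2
      have eval: "continuous_map ?X euclidean (\<lambda>u. u F x)" if F: "F \<in> \<F>" "x \<in> F" for F
      proof -
        have "continuous_map ?X (Cm_topology m F) (\<lambda>u. u F)"
          unfolding Cm_product_topology_def by (rule continuous_map_product_projection[OF F(1)])
        from continuous_map_compose[OF this continuous_map_eval_Cm[OF _ _ _ F(2)]] \<F>[OF F(1)]
        show ?thesis by (simp add: o_def)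
      qed
      have "Hausdorff_space (euclidean :: 'y topology)"
        unfolding Hausdorff_space_def by (auto simp: disjnt_def) (metis hausdorff)
      then show ?thesis
        unfolding 2(5) by (rule closedin_continuous_maps_eq[OF _ eval[OF 2(1,3)] eval[OF 2(2,4)]])
    qed simp
  qed simp
  ultimately show ?thesis by simp
qed

lemma lincomb_closed_compatible_families:
  fixes \<F> :: "'e::euclidean_space set set"
  assumes \<F>: "\<And>F. F \<in> \<F> \<Longrightarrow> convex F \<and> F \<noteq> {} \<and> compact F"
  shows "lincomb_closed (family_lincomb \<F>)
    (compatible_families m \<F> :: ('e set \<Rightarrow> 'e \<Rightarrow> 'y::locally_convex_space) set)"
  unfolding lincomb_closed_def
proof (intro conjI allI ballI)
  have "(\<lambda>x\<in>F. 0 :: 'y) \<in> Cm m F" if "F \<in> \<F>" for F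
  proof -
    have F: "convex F" "F \<noteq> {}" using \<F>[OF that] by auto
    have "Ck k F (\<lambda>x\<in>F. 0 :: 'y)" for k
      by (subst Ck_cong[of F _ "\<lambda>_. 0"]) (auto simp: Ck_const)
    then show ?thesis by (simp add: Cm_iff[OF F])
  qed
  then have "(\<lambda>F\<in>\<F>. \<lambda>x\<in>F. 0 :: 'y) \<in> compatible_families m \<F>"
    by (auto simp: compatible_families_def fun_eq_iff)
  then show "compatible_families m \<F> \<noteq> ({} :: ('e set \<Rightarrow> 'e \<Rightarrow> 'y) set)" by blast
next
  fix a b and u v :: "'e set \<Rightarrow> 'e \<Rightarrow> 'y"
  assume u: "u \<in> compatible_families m \<F>" and v: "v \<in> compatible_families m \<F>"
  have "fun_lincomb F a (u F) b (v F) \<in> Cm m F" if "F \<in> \<F>" for F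
    using \<F>[OF that] compatible_familiesD(1)[OF u that] compatible_familiesD(1)[OF v that]
    by (intro Cm_fun_lincomb) auto
  then have "family_lincomb \<F> a u b v \<in> Pi\<^sub>E \<F> (Cm m)"
    by (simp add: family_lincomb_def)
  moreover have "restrict (family_lincomb \<F> a u b v F) (F \<inter> G) = restrict (family_lincomb \<F> a u b v G) (F \<inter> G)"
    if FG: "F \<in> \<F>" "G \<in> \<F>" for F G
  proof (rule restrict_ext)
    fix x assume x: "x \<in> F \<inter> G"
    have "u F x = u G x" "v F x = v G x"
      using compatible_familiesD(2)[OF u FG] compatible_familiesD(2)[OF v FG] x by blast+
    then show "family_lincomb \<F> a u b v F x = family_lincomb \<F> a u b v G x"
      using FG x by (simp add: family_lincomb_def fun_lincomb_def)
  qed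
  ultimately show "family_lincomb \<F> a u b v \<in> compatible_families m \<F>"
    unfolding compatible_families_def by blast
qed

theorem theorem1p4:
  fixes M :: "'e::euclidean_space set" and n l :: nat and m :: enat
  assumes "simple_polytope M" and "aff_dim M = int n" and "n \<ge> 1" and "l \<in> {1..n-1}"
  shows "let \<F> = faces_of_dim M l;
             C = Cm m M :: ('e \<Rightarrow> 'y::locally_convex_space) set;
             C_top = Cm_topology m M;
             \<E> = compatible_families m \<F>;
             \<E>_top = subtopology (Cm_product_topology m \<F>) \<E>;
             r = restrict_to_faces \<F>
         in closedin (Cm_product_topology m \<F>) \<E> \<and>
            lincomb_closed (family_lincomb \<F>) \<E> \<and>
            r ` C = \<E> \<and>
            continuous_map C_top \<E>_top r \<and>
            linear_between (fun_lincomb M) C (family_lincomb \<F>) \<E> r \<and>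
            (\<exists>\<sigma>. continuous_map \<E>_top C_top \<sigma> \<and>
                 linear_between (family_lincomb \<F>) \<E> (fun_lincomb M) C \<sigma> \<and>
                 (\<forall>u\<in>\<E>. r (\<sigma> u) = u))"
proof -
  define \<F> where "\<F> = faces_of_dim M l"
  define C where "C = (Cm m M :: ('e \<Rightarrow> 'y) set)"
  define \<E> where "\<E> = (compatible_families m \<F> :: ('e set \<Rightarrow> 'e \<Rightarrow> 'y) set)"
  define r where "r = (restrict_to_faces \<F> :: ('e \<Rightarrow> 'y) \<Rightarrow> _)"
  let ?T = "subtopology (Cm_product_topology m \<F>) \<E>"
  have P: "polytope M" using assms(1) by (simp add: simple_polytope_def)
  have M: "convex M" "M \<noteq> {}" "compact M"
    using P assms(1) by (auto simp: simple_polytope_def intro: polytope_imp_convex polytope_imp_compact)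
  \<comment> \<open>The bound \<open>l \<le> n - 1\<close> enters here: the faces are proper, as the
    local projections require.\<close>
  have face: "F face_of M \<and> F \<noteq> M" if "F \<in> \<F>" for F
    using that assms(2-4) by (auto simp: \<F>_def faces_of_dim_def)
  have sub: "F \<subseteq> M" if "F \<in> \<F>" for F using face[OF that] face_of_imp_subset by blast
  have cpt: "convex F" "F \<noteq> {}" "compact F" if "F \<in> \<F>" for F
    using face[OF that] face_of_imp_convex face_of_imp_compact[OF M(1,3)] that
    by (auto simp: \<F>_def faces_of_dim_def)
  have fin: "finite \<F>"
    by (rule finite_subset[OF _ finite_polytope_faces[OF P]]) (auto simp: \<F>_def faces_of_dim_def)
  have closed: "closedin (Cm_product_topology m \<F>) \<E>"
    unfolding \<E>_def by (rule closedin_compatible_families) (use cpt in blast)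
  have lc: "lincomb_closed (family_lincomb \<F>) \<E>"
    unfolding \<E>_def by (rule lincomb_closed_compatible_families) (use cpt in blast)
  have topC: "topspace (Cm_topology m M) = C" using topspace_Cm_topology[OF M(1,2)] by (simp add: C_def)
  have restrict_Cm: "restrict f F \<in> Cm m F" if f: "f \<in> C" and F: "F \<in> \<F>" for f F
  proof -
    have "Ck k F (restrict f F)" if "enat k \<le> m" for k
    proof -
      have "Ck k F f" using Ck_subset[OF sub[OF F]] f that Cm_iff[OF M(1,2)] unfolding C_def by blast
      then show ?thesis using Ck_cong[of F f "restrict f F"] by simp
    qed
    then show ?thesis by (simp add: Cm_iff[OF cpt(1,2)[OF F]])
  qed
  have r_in: "r f \<in> \<E>" if "f \<in> C" for f
    using restrict_Cm[OF that]
    by (auto simp: r_def restrict_to_faces_def \<E>_def compatible_families_def fun_eq_iff)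
  have r_cont: "continuous_map (Cm_topology m M) ?T r"
    unfolding continuous_map_in_subtopology
  proof
    show "r \<in> topspace (Cm_topology m M) \<rightarrow> \<E>" using r_in topC by auto
    show "continuous_map (Cm_topology m M) (Cm_product_topology m \<F>) r"
      unfolding Cm_product_topology_def continuous_map_componentwise
    proof (intro conjI ballI)
      show "r ` topspace (Cm_topology m M) \<subseteq> extensional \<F>"
        by (auto simp: r_def restrict_to_faces_def)
      fix F assume F: "F \<in> \<F>"
      show "continuous_map (Cm_topology m M) (Cm_topology m F) (\<lambda>f. r f F)"
        unfolding continuous_map_atin
      proof
        fix f assume f: "f \<in> topspace (Cm_topology m M :: ('e \<Rightarrow> 'y) topology)"
        let ?F = "atin (Cm_topology m M) f"
        have "limitin (Cm_topology m M) (\<lambda>f. f) f ?F" by (rule limitin_atin_ident[OF f])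
        then have lim: "\<forall>\<^sub>F g in ?F. g \<in> Cm m M" "\<And>k. enat k \<le> m \<Longrightarrow> Ck_conv k M (\<lambda>f. f) f ?F"
          unfolding limitin_Cm_topology[OF M] by auto
        show "limitin (Cm_topology m F) (\<lambda>f. r f F) (r f F) ?F"
          unfolding limitin_Cm_topology[OF cpt[OF F]]
        proof (intro conjI allI impI)
          show "r f F \<in> Cm m F" using restrict_Cm[OF _ F] f topC F by (simp add: r_def restrict_to_faces_def)
          show "\<forall>\<^sub>F g in ?F. r g F \<in> Cm m F"
            using lim(1) by eventually_elim (use restrict_Cm[OF _ F] F in \<open>simp add: r_def restrict_to_faces_def C_def\<close>)
          fix k assume "enat k \<le> m"
          from Ck_conv_subset[OF sub[OF F] lim(2)[OF this]]
          show "Ck_conv k F (\<lambda>f. r f F) (r f F) ?F"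
            by (rule Ck_conv_cong[rotated 2]) (use F in \<open>auto simp: r_def restrict_to_faces_def\<close>)
        qed
      qed
    qed
  qed
  have r_lin: "linear_between (fun_lincomb M) C (family_lincomb \<F>) \<E> r"
    unfolding linear_between_def
  proof (intro conjI allI ballI)
    show "r ` C \<subseteq> \<E>" using r_in by blast
    show "r (fun_lincomb M a u b v) = family_lincomb \<F> a (r u) b (r v)" for a b u v
    proof (rule ext)+
      fix F x
      show "r (fun_lincomb M a u b v) F x = family_lincomb \<F> a (r u) b (r v) F x"
        using sub[of F] by (auto simp: r_def restrict_to_faces_def family_lincomb_def fun_lincomb_def restrict_def)
    qed
  qed
  obtain B where B: "ext_op m \<F> M B" and B_ext: "\<And>u F x. u \<in> \<E> \<Longrightarrow> F \<in> \<F> \<Longrightarrow> x \<in> F \<Longrightarrow> B u x = u F x"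
    using global_extension[OF assms(1) face fin, of m] unfolding \<E>_def by blast
  have B_conv: "Ck_conv k M B (B v) F"
    if "enat k \<le> m" "\<And>G. G \<in> \<F> \<Longrightarrow> Ck_conv k G (\<lambda>w. w G) (v G) F" for k v F
    using B that unfolding ext_op_def by blast
  define \<sigma> where "\<sigma> u = restrict (B u) M" for u
  have \<sigma>_in: "\<sigma> u \<in> C" if u: "u \<in> \<E>" for u
    unfolding C_def Cm_iff[OF M(1,2)]
  proof (intro conjI allI impI)
    show "\<sigma> u \<in> extensional M" by (simp add: \<sigma>_def)
    fix k assume k: "enat k \<le> m"
    \<comment> \<open>Conditions holding eventually are void along \<open>bot\<close>, so the
      constant net may be exchanged for this one.\<close>
    have "Ck_conv k G (\<lambda>w. w G) (u G) bot" if G: "G \<in> \<F>" for G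
    proof -
      have "Ck k G (u G)"
        using compatible_familiesD(1)[OF u[unfolded \<E>_def] G] Cm_iff[OF cpt(1,2)[OF G]] k by blast
      from Ck_conv_const[OF this] show ?thesis by (rule Ck_conv_cong[rotated 2]) auto
    qed
    then have "Ck k M (B u)" using Ck_conv_imp_Ck[OF B_conv[OF k]] by blast
    then show "Ck k M (\<sigma> u)" using Ck_cong[of M "B u" "\<sigma> u"] by (simp add: \<sigma>_def)
  qed
  have r_\<sigma>: "r (\<sigma> u) = u" if u: "u \<in> \<E>" for u
  proof (rule ext)+
    fix F x
    have uE: "u \<in> Pi\<^sub>E \<F> (Cm m)" using u by (simp add: \<E>_def compatible_families_def)
    show "r (\<sigma> u) F x = u F x"
    proof (cases "F \<in> \<F>")
      case True
      \<comment> \<open>Equality is also due off \<open>F\<close>, where both sides are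
        \<open>undefined\<close>.\<close>
      then have "u F \<in> extensional F" using uE by (auto simp: Cm_def PiE_iff)
      then show ?thesis
        using True B_ext[OF u True] sub[OF True]
        by (auto simp: r_def restrict_to_faces_def \<sigma>_def restrict_def extensional_def)
    next
      case False
      then show ?thesis using uE by (auto simp: r_def restrict_to_faces_def PiE_iff extensional_def)
    qed
  qed
  have \<sigma>_cont: "continuous_map ?T (Cm_topology m M) \<sigma>"
    unfolding continuous_map_atin
  proof
    fix v assume v: "v \<in> topspace ?T"
    then have vE: "v \<in> \<E>" by simp
    have "limitin ?T (\<lambda>w. w) v (atin ?T v)" by (rule limitin_atin_ident[OF v])
    \<comment> \<open>Convergence in the subspace of the product is eventual membership together
      with convergence in each component; the latter is the hypothesis of
      \<open>B_conv\<close>.\<close>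
    then have ev: "\<forall>\<^sub>F w in atin ?T v. w \<in> \<E>"
      and lim: "\<And>G. G \<in> \<F> \<Longrightarrow> limitin (Cm_topology m G) (\<lambda>w. w G) (v G) (atin ?T v)"
      unfolding limitin_subtopology Cm_product_topology_def limitin_componentwise by auto
    show "limitin (Cm_topology m M) \<sigma> (\<sigma> v) (atin ?T v)"
      unfolding limitin_Cm_topology[OF M]
    proof (intro conjI allI impI)
      show "\<sigma> v \<in> Cm m M" using \<sigma>_in[OF vE] by (simp add: C_def)
      show "\<forall>\<^sub>F w in atin ?T v. \<sigma> w \<in> Cm m M"
        using ev by eventually_elim (use \<sigma>_in in \<open>simp add: C_def\<close>)
      fix k assume k: "enat k \<le> m"
      have "Ck_conv k M B (B v) (atin ?T v)"
        by (rule B_conv[OF k]) (use lim limitin_Cm_topology[OF cpt] k in blast)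
      then show "Ck_conv k M \<sigma> (\<sigma> v) (atin ?T v)"
        by (rule Ck_conv_cong[rotated 2]) (auto simp: \<sigma>_def)
    qed
  qed
  have \<sigma>_lin: "linear_between (family_lincomb \<F>) \<E> (fun_lincomb M) C \<sigma>"
    unfolding linear_between_def
  proof (intro conjI allI ballI)
    show "\<sigma> ` \<E> \<subseteq> C" using \<sigma>_in by blast
    show "\<sigma> (family_lincomb \<F> a u b v) = fun_lincomb M a (\<sigma> u) b (\<sigma> v)" for a b u v
    proof (rule ext)
      fix x
      show "\<sigma> (family_lincomb \<F> a u b v) x = fun_lincomb M a (\<sigma> u) b (\<sigma> v) x"
        using B by (cases "x \<in> M") (auto simp: \<sigma>_def fun_lincomb_def ext_op_def)
    qed
  qed
  have "r ` C = \<E>"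
  proof
    show "r ` C \<subseteq> \<E>" using r_in by blast
    show "\<E> \<subseteq> r ` C" using r_\<sigma> \<sigma>_in by (metis image_eqI subsetI)
  qed
  then show ?thesis
    using closed lc r_cont r_lin \<sigma>_cont \<sigma>_lin r_\<sigma>
    unfolding Let_def \<F>_def[symmetric] C_def[symmetric] \<E>_def[symmetric] r_def[symmetric] by blast
qed

end
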